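(* Let $L\to M$ be a spin bundle over a compact, oriented Riemannian surface $(M,g)$, and denote by $\bar\partial$ the Dirac structure on $L$, where $M$ is regarded as a Riemann surface via the conformal class of $g$. For non-negative $\epsilon=(\epsilon_1,\epsilon_2,\epsilon_3)$ the family of functionals $E_\epsilon\colon\Gamma(L^\times)\to\mathbb{R}$ on nowhere vanishing sections of $L$, given by \[ E_{\epsilon}(\psi)=\epsilon_1\int_M \frac{\langle*\bar\partial\psi\wedge\bar\partial\psi\rangle}{|\psi|^2}+(\epsilon_2-\epsilon_1)\int_M\frac{\langle *\bar\partial\psi\wedge\psi(\psi,\psi)\rangle^2}{|\psi|^8}+(\epsilon_3-\epsilon_1)\int_M\frac{\langle *\bar\partial\psi\wedge J\psi(\psi,\psi)\rangle^2}{|\psi|^8} \] subject to the constraint $|\psi|^4=g$, is well-defined on the Riemannian surface $(M,g)$. For $\epsilon_3=0$ and arbitrary $\epsilon_1,\epsilon_2>0$ the functional assumes its minimum value, zero, at a section $\psi\in\Gamma(L^\times)$ which gives rise to an isometric immersion $f\colon M\to\mathbb{R}^3$ satisfying $df=(\psi,\psi)$ in the prescribed regular homotopy class given by the spin bundle $L$.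
   Context: All objects are smooth. $\mathbb{H}$ denotes the quaternions and $\mathbb{R}^3=\operatorname{Im}\mathbb{H}$. On the Riemann surface $M$, $*$ is precomposition of $1$-forms with the complex structure of $TM$ (the negative of the Hodge star). $\Gamma(L^\times)$ is the space of nowhere vanishing sections of $L$. Spin bundle. A spin bundle over the Riemann surface $M$ is a right quaternionic line bundle $L\to M$ together with a spin pairing $(\cdot,\cdot)\colon L\times L\to\operatorname{Hom}(TM,\mathbb{H})$, i.e. real bilinear with $(\psi\lambda,\varphi\mu)=\bar\lambda(\psi,\varphi)\mu$ for $\lambda,\mu\in\mathbb{H}$, $\overline{(\psi,\varphi)}=-(\varphi,\psi)$, and $(\psi,\psi)_X\neq0$ for all non-zero $\psi\in L$, $X\in TM$; it is compatible with the Riemann surface: the metrics $|(\psi,\psi)|^2$ are in the conformal class of $M$ for $\psi$ nowhere vanishing, and $J\in\Gamma(\operatorname{End}(L))$ denotes the unique quaternionic linear complex structure with $*(\psi,\varphi)=(J\psi,\varphi)=(\psi,J\varphi)$. Two spin bundles are isomorphic if there is a quaternionic linear bundle isomorphism over the identity of $M$ intertwining the spin pairings. For $L$-valued $1$-forms $\mu$ the pairing is extended by $(\mu,\psi)_{X,Y}=(\mu_X,\psi)_Y-(\mu_Y,\psi)_X$ and $(\psi,\mu)_{X,Y}=(\psi,\mu_X)_Y-(\psi,\mu_Y)_X$. $\bar KL$ is the bundle of $L$-valued $1$-forms $\mu$ with $*\mu=-J\mu$, and $\mu^{0,1}=\frac12(\mu+J*\mu)$. Dirac structure. $\bar\partial\colon\Gamma(L)\to\Gamma(\bar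 KL)$ is the unique real linear operator with $[J,\bar\partial]=0$, $\bar\partial(\psi\lambda)=(\bar\partial\psi)\lambda+(\psi\,d\lambda)^{0,1}$ for $\lambda\in C^\infty(M,\mathbb{H})$, and $d(\psi,\varphi)=(\bar\partial\psi,\varphi)+(\psi,\bar\partial\varphi)$. Half-densities. $|K|\to M$ is the real oriented line bundle with fiber $|K|_x=\mathbb{R}\sqrt{g_x}$. $|K|^2$ is identified with $\Lambda^2TM^*$ by sending a metric in the conformal class to its volume form. $|\psi|^2:=|(\psi,\psi)|\in|K|$ is a quadratic form on $L$ with polarization $\langle\cdot,\cdot\rangle\colon L\times L\to|K|$, so $\langle\psi\lambda,\psi\mu\rangle=\operatorname{Re}(\bar\lambda\mu)|\psi|^2$; thus $|\psi|^4=|(\psi,\psi)|^2$ is a metric in the conformal class, and the constraint $|\psi|^4=g$ means $|(\psi,\psi)_X|^2=g(X,X)$. For $L$-valued $1$-forms $\mu,\nu$, the $|K|\otimes\Lambda^2TM^*$-valued wedge is normalized by $\langle\mu\wedge\nu\rangle_{X,Y}=\frac12(\langle\mu_X,\nu_Y\rangle-\langle\mu_Y,\nu_X\rangle)$. Expressions such as $\psi(\psi,\psi)$ and $J\psi(\psi,\psi)$ are the $L$-valued $1$-forms $X\mapsto\psi\,(\psi,\psi)_X$ and $X\mapsto J\psi\,(\psi,\psi)_X$. The quotients in $E_\epsilon$ are sections of $|K|^2\cong\Lambda^2TM^*$. Regular homotopy class given by $L$. For a conformal immersion $f\colon M\to\mathbb{R}^3$, the induced spin bundle is $L_f:=M\times\mathbb{H}$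 with pairing $(\psi,\varphi)=\bar\psi\,df\,\varphi$; a general immersion $h$, with $dh=\omega\circ B$ where $\omega$ is conformal and $B$ is positive self-adjoint with $\det B=1$, induces the bundle $M\times\mathbb{H}$ with pairing $\bar\psi\,\omega\,\varphi$. Isomorphism classes of spin bundles over $M$ correspond in this way bijectively to regular homotopy classes of immersions $M\to\mathbb{R}^3$; the regular homotopy class given by $L$ consists of the immersions whose induced spin bundle is isomorphic to $L$. Standing assumption on periods. A closed $1$-form $(\psi,\psi)$ a priori only gives an immersion of the universal cover with translation periods; it is assumed throughout that the resulting immersions are defined on $M$, i.e. that the periods $\int_\gamma(\psi,\psi)$, $\gamma\in H_1(M,\mathbb{Z})$, vanish (this can be enforced by adding the squared periods $\sum_\gamma|\int_\gamma(\psi,\psi)|^2$, over a basis of $H_1(M,\mathbb{Z})$, to the functional).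
   Formalization: Attainment of zero fails for smooth sections in general (e.g. hyperbolic genus 2), so it is replaced: E≥0, and a constrained ψ with vanishing periods has E=0 iff it yields an isometric immersion f with df=(ψ,ψ) in the class of L; every such f arises from a zero of E. *)

theory Defs
  imports "HOL-Analysis.Analysis"
begin

section \<open>Quaternions\<close>

text \<open>
  A quaternion is a pair of its real and its imaginary part; the imaginary quaternions are \<open>\<real>\<^sup>3\<close>, embedded as
  \<open>v \<mapsto> (0, v)\<close>. Norm and inner product of the product type are those of the quaternions.
\<close>

type_synonym quat = "real \<times> (real^3)"

definition qmult :: "quat \<Rightarrow> quat \<Rightarrow> quat" (infixl \<open>\<odot>\<close> 70) where
  "p \<odot> q = (fst p * fst q - snd p \<bullet> snd q,
            fst p *\<^sub>R snd q + fst q *\<^sub>R snd p + cross3 (snd p) (snd q))"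

definition qcnj :: "quat \<Rightarrow> quat" where
  "qcnj q = (fst q, - snd q)"

definition qreal :: "real \<Rightarrow> quat" where
  "qreal r = (r, 0)"

definition qimag :: "real^3 \<Rightarrow> quat" where
  "qimag v = (0, v)"


section \<open>Smooth functions on open sets\<close>

fun ck_on :: "nat \<Rightarrow> 'a::euclidean_space set \<Rightarrow> ('a \<Rightarrow> 'b::real_normed_vector) \<Rightarrow> bool" where
  "ck_on 0 S f \<longleftrightarrow> continuous_on S f"
| "ck_on (Suc n) S f \<longleftrightarrow> (\<forall>x\<in>S. f differentiable (at x)) \<and>
     (\<forall>v. ck_on n S (\<lambda>x. frechet_derivative f (at x) v))"

definition smooth_on :: "'a::euclidean_space set \<Rightarrow> ('a \<Rightarrow> 'b::real_normed_vector) \<Rightarrow> bool" where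
  "smooth_on S f \<longleftrightarrow> (\<forall>n. ck_on n S f)"


section \<open>Oriented surfaces\<close>

type_synonym 'm chart = "'m set \<times> ('m \<Rightarrow> real^2)"

definition chart_inv :: "'m chart \<Rightarrow> real^2 \<Rightarrow> 'm" where
  "chart_inv c = inv_into (fst c) (snd c)"

text \<open>The underlying point set of the surface is the whole type.\<close>

definition oriented_surface :: "'m::t2_space chart set \<Rightarrow> bool" where
  "oriented_surface A \<longleftrightarrow>
     (\<Union>c\<in>A. fst c) = UNIV \<and>
     (\<forall>c\<in>A. open (fst c) \<and> open (snd c ` fst c) \<and>
        homeomorphism (fst c) (snd c ` fst c) (snd c) (chart_inv c)) \<and>
     (\<forall>c\<in>A. \<forall>d\<in>A. smooth_on (snd c ` (fst c \<inter> fst d)) (snd d \<circ> chart_inv c) \<and>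
        (\<forall>y \<in> snd c ` (fst c \<inter> fst d).
           0 < det (matrix (frechet_derivative (snd d \<circ> chart_inv c) (at y)))))"

definition smooth_map ::
    "'m::t2_space chart set \<Rightarrow> 'm set \<Rightarrow> ('m \<Rightarrow> 'b::real_normed_vector) \<Rightarrow> bool" where
  "smooth_map A U h \<longleftrightarrow> (\<forall>c\<in>A. smooth_on (snd c ` (U \<inter> fst c)) (h \<circ> chart_inv c))"


section \<open>Tangent vectors and forms\<close>

text \<open>
  A tangent vector at \<open>x\<close> is represented by its coordinates in a preferred chart \<open>chart_at A x\<close>
  around \<open>x\<close>, so that the tangent space at \<open>x\<close> is the vector space \<open>real^2\<close>, oriented in the
  standard way; \<open>tvec A c x w\<close> is the tangent vector at \<open>x\<close> whose coordinates in the chart \<open>c\<close>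
  are \<open>w\<close>. As \<open>chart_at A x\<close> jumps with \<open>x\<close>, smoothness of a form is tested on the
  coordinate fields \<open>\<lambda>x. tvec A c x w\<close>.
\<close>

definition chart_at :: "'m chart set \<Rightarrow> 'm \<Rightarrow> 'm chart" where
  "chart_at A x = (SOME c. c \<in> A \<and> x \<in> fst c)"

definition tvec :: "'m chart set \<Rightarrow> 'm chart \<Rightarrow> 'm \<Rightarrow> real^2 \<Rightarrow> real^2" where
  "tvec A c x w = frechet_derivative (snd (chart_at A x) \<circ> chart_inv c) (at (snd c x)) w"

definition differential ::
    "'m chart set \<Rightarrow> ('m \<Rightarrow> 'b::real_normed_vector) \<Rightarrow> 'm \<Rightarrow> real^2 \<Rightarrow> 'b" where
  "differential A h x X =
     frechet_derivative (h \<circ> chart_inv (chart_at A x)) (at (snd (chart_at A x) x)) X"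

definition local_form ::
    "'m chart set \<Rightarrow> 'm chart \<Rightarrow> ('m \<Rightarrow> real^2 \<Rightarrow> 'b) \<Rightarrow> real^2 \<Rightarrow> real^2 \<Rightarrow> 'b" where
  "local_form A c \<alpha> w y = \<alpha> (chart_inv c y) (tvec A c (chart_inv c y) w)"

definition smooth_form ::
    "'m::t2_space chart set \<Rightarrow> 'm set \<Rightarrow> ('m \<Rightarrow> real^2 \<Rightarrow> 'b::real_normed_vector) \<Rightarrow> bool" where
  "smooth_form A U \<alpha> \<longleftrightarrow> (\<forall>x\<in>U. linear (\<alpha> x)) \<and>
     (\<forall>c\<in>A. \<forall>w. smooth_on (snd c ` (U \<inter> fst c)) (local_form A c \<alpha> w))"

definition ext_deriv ::
    "'m chart set \<Rightarrow> ('m \<Rightarrow> real^2 \<Rightarrow> 'b::real_normed_vector) \<Rightarrow> 'm \<Rightarrow> real^2 \<Rightarrow> real^2 \<Rightarrow> 'b" where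
  "ext_deriv A \<alpha> x X Y = (let c = chart_at A x in
     frechet_derivative (local_form A c \<alpha> Y) (at (snd c x)) X -
     frechet_derivative (local_form A c \<alpha> X) (at (snd c x)) Y)"

definition closed_form ::
    "'m chart set \<Rightarrow> ('m \<Rightarrow> real^2 \<Rightarrow> 'b::real_normed_vector) \<Rightarrow> bool" where
  "closed_form A \<alpha> \<longleftrightarrow> (\<forall>x X Y. ext_deriv A \<alpha> x X Y = 0)"


section \<open>Riemannian metrics and the induced complex structure\<close>

type_synonym 'm bilin = "'m \<Rightarrow> real^2 \<Rightarrow> real^2 \<Rightarrow> real"

definition riemannian_metric :: "'m::t2_space chart set \<Rightarrow> 'm bilin \<Rightarrow> bool" where
  "riemannian_metric A g \<longleftrightarrow>
     (\<forall>x. bilinear (g x) \<and> (\<forall>X Y. g x X Y = g x Y X) \<and> (\<forall>X. X \<noteq> 0 \<longrightarrow> 0 < g x X X)) \<and>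
     (\<forall>c\<in>A. \<forall>v w. smooth_on (snd c ` fst c)
        (\<lambda>y. g (chart_inv c y) (tvec A c (chart_inv c y) v) (tvec A c (chart_inv c y) w)))"

text \<open>\<open>rot g x\<close> is the complex structure of the tangent space at \<open>x\<close>: the positive quarter turn.\<close>

definition rot :: "'m bilin \<Rightarrow> 'm \<Rightarrow> real^2 \<Rightarrow> real^2" where
  "rot g x X = (THE Y. g x X Y = 0 \<and> g x Y Y = g x X X \<and> 0 \<le> X$1 * Y$2 - X$2 * Y$1)"

definition star :: "'m bilin \<Rightarrow> ('m \<Rightarrow> real^2 \<Rightarrow> 'b) \<Rightarrow> 'm \<Rightarrow> real^2 \<Rightarrow> 'b" where
  "star g \<mu> x X = \<mu> x (rot g x X)"

definition vol :: "'m bilin \<Rightarrow> 'm bilin" where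
  "vol g x X Y = g x (rot g x X) Y"


section \<open>Integration of 2-forms\<close>

definition borel_partition ::
    "'m::t2_space chart set \<Rightarrow> nat \<Rightarrow> (nat \<Rightarrow> 'm chart) \<Rightarrow> (nat \<Rightarrow> 'm set) \<Rightarrow> bool" where
  "borel_partition A n c P \<longleftrightarrow>
     (\<Union>i<n. P i) = UNIV \<and> disjoint_family_on P {..<n} \<and>
     (\<forall>i<n. c i \<in> A \<and> P i \<in> sets borel \<and> P i \<subseteq> fst (c i))"

definition local_density :: "'m chart set \<Rightarrow> 'm chart \<Rightarrow> 'm bilin \<Rightarrow> real^2 \<Rightarrow> real" where
  "local_density A c \<sigma> y =
     \<sigma> (chart_inv c y) (tvec A c (chart_inv c y) (axis 1 1)) (tvec A c (chart_inv c y) (axis 2 1))"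

text \<open>
  The integral exists if the local integrals exist for every finite Borel partition subordinate
  to the atlas and their sum does not depend on the partition.
\<close>

definition has_surface_integral :: "'m::t2_space chart set \<Rightarrow> 'm bilin \<Rightarrow> real \<Rightarrow> bool" where
  "has_surface_integral A \<sigma> I \<longleftrightarrow>
     (\<forall>n c P. borel_partition A n c P \<longrightarrow>
        (\<forall>i<n. local_density A (c i) \<sigma> absolutely_integrable_on snd (c i) ` P i) \<and>
        (\<Sum>i<n. integral (snd (c i) ` P i) (local_density A (c i) \<sigma>)) = I)"

definition surface_integral :: "'m::t2_space chart set \<Rightarrow> 'm bilin \<Rightarrow> real" where
  "surface_integral A \<sigma> = (THE I. has_surface_integral A \<sigma> I)"


section \<open>Half-densities\<close>

text \<open>
  An element of the \<open>n\<close>-th power of the line \<open>|K|\<close> at \<open>x\<close> is a function of a tangent vector: a real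
  multiple of \<open>X \<mapsto> sqrt (g(X,X)) ^ n\<close>. Products and quotients are taken pointwise. Since
  \<open>vol g (X, rot X) = g(X,X)\<close>, the identification of 2-forms with squares of half-densities
  sends a 2-form \<open>\<sigma>\<close> to \<open>X \<mapsto> \<sigma>(X, rot X)\<close>; its inverse sends \<open>r * g\<close> to \<open>r * vol g\<close>.
\<close>

definition K_power :: "'m bilin \<Rightarrow> nat \<Rightarrow> 'm \<Rightarrow> (real^2 \<Rightarrow> real) set" where
  "K_power g n x = {k. \<exists>r. \<forall>X. k X = r * sqrt (g x X X) ^ n}"

definition form_of_density :: "'m bilin \<Rightarrow> ('m \<Rightarrow> real^2 \<Rightarrow> real) \<Rightarrow> 'm bilin" where
  "form_of_density g q x X Y = q x X / g x X X * vol g x X Y"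


section \<open>Spin bundles\<close>

text \<open>
  The type \<open>'l\<close> is the total space. The smooth structure of the bundle is given by local frames
  \<open>(U, s)\<close> with \<open>s\<close> a nowhere vanishing section over \<open>U\<close>. The pairing \<open>spair L v w X\<close> is
  evaluated for \<open>v\<close>, \<open>w\<close> in the same fibre.
\<close>

record ('m, 'l) spin_data =
  lproj :: "'l \<Rightarrow> 'm"
  ladd :: "'l \<Rightarrow> 'l \<Rightarrow> 'l"
  lscale :: "'l \<Rightarrow> quat \<Rightarrow> 'l"
  lframes :: "('m set \<times> ('m \<Rightarrow> 'l)) set"
  spair :: "'l \<Rightarrow> 'l \<Rightarrow> real^2 \<Rightarrow> quat"

definition lzero :: "('m, 'l) spin_data \<Rightarrow> 'l \<Rightarrow> bool" where
  "lzero L v \<longleftrightarrow> v = lscale L v 0"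

definition lneg :: "('m, 'l) spin_data \<Rightarrow> 'l \<Rightarrow> 'l" where
  "lneg L v = lscale L v (qreal (-1))"

definition coef :: "('m, 'l) spin_data \<Rightarrow> 'l \<Rightarrow> 'l \<Rightarrow> quat" where
  "coef L b v = (THE q. v = lscale L b q)"

text \<open>
  Every fibre is of the form \<open>s\<cdot>\<H>\<close> with unique coefficients; hence the remaining axioms of a right
  vector space (in particular the group axioms of \<open>ladd\<close>) follow from those listed.
\<close>

definition quaternionic_line_bundle ::
    "'m::t2_space chart set \<Rightarrow> ('m, 'l) spin_data \<Rightarrow> bool" where
  "quaternionic_line_bundle A L \<longleftrightarrow>
     (\<forall>v w. lproj L v = lproj L w \<longrightarrow> lproj L (ladd L v w) = lproj L v) \<and>
     (\<forall>v q. lproj L (lscale L v q) = lproj L v) \<and>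
     (\<forall>v. lscale L v (qreal 1) = v) \<and>
     (\<forall>v p q. lscale L (lscale L v p) q = lscale L v (p \<odot> q)) \<and>
     (\<forall>v p q. lscale L v (p + q) = ladd L (lscale L v p) (lscale L v q)) \<and>
     (\<forall>v w q. lproj L v = lproj L w \<longrightarrow>
        lscale L (ladd L v w) q = ladd L (lscale L v q) (lscale L w q)) \<and>
     (\<Union>(U, s)\<in>lframes L. U) = UNIV \<and>
     (\<forall>(U, s)\<in>lframes L. open U \<and>
        (\<forall>x\<in>U. lproj L (s x) = x \<and> (\<forall>v. lproj L v = x \<longrightarrow> (\<exists>!q. v = lscale L (s x) q)))) \<and>
     (\<forall>(U, s)\<in>lframes L. \<forall>(V, t)\<in>lframes L.
        smooth_map A (U \<inter> V) (\<lambda>x. coef L (s x) (t x)))"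

definition spin_pairing ::
    "'m::t2_space chart set \<Rightarrow> ('m, 'l) spin_data \<Rightarrow> bool" where
  "spin_pairing A L \<longleftrightarrow>
     (\<forall>v w. lproj L v = lproj L w \<longrightarrow> linear (spair L v w)) \<and>
     (\<forall>u v w X. lproj L u = lproj L v \<and> lproj L v = lproj L w \<longrightarrow>
        spair L (ladd L u v) w X = spair L u w X + spair L v w X \<and>
        spair L u (ladd L v w) X = spair L u v X + spair L u w X) \<and>
     (\<forall>v w p q X. lproj L v = lproj L w \<longrightarrow>
        spair L (lscale L v p) (lscale L w q) X = qcnj p \<odot> spair L v w X \<odot> q) \<and>
     (\<forall>v w X. lproj L v = lproj L w \<longrightarrow> qcnj (spair L v w X) = - spair L w v X) \<and>
     (\<forall>v X. \<not> lzero L v \<and> X \<noteq> 0 \<longrightarrow> spair L v v X \<noteq> 0) \<and>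
     (\<forall>(U, s)\<in>lframes L. smooth_form A U (\<lambda>x. spair L (s x) (s x)))"

definition spin_bundle ::
    "'m::t2_space chart set \<Rightarrow> 'm bilin \<Rightarrow> ('m, 'l) spin_data \<Rightarrow> bool" where
  "spin_bundle A g L \<longleftrightarrow> quaternionic_line_bundle A L \<and> spin_pairing A L \<and>
     (\<forall>v. \<not> lzero L v \<longrightarrow>
        (\<exists>\<rho>>0. \<forall>X. (norm (spair L v v X))\<^sup>2 = \<rho> * g (lproj L v) X X))"

definition section_of :: "'m::t2_space chart set \<Rightarrow> ('m, 'l) spin_data \<Rightarrow> ('m \<Rightarrow> 'l) set" where
  "section_of A L = {\<psi>. (\<forall>x. lproj L (\<psi> x) = x) \<and>
     (\<forall>(U, s)\<in>lframes L. smooth_map A U (\<lambda>x. coef L (s x) (\<psi> x)))}"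

definition nonvanishing_section ::
    "'m::t2_space chart set \<Rightarrow> ('m, 'l) spin_data \<Rightarrow> ('m \<Rightarrow> 'l) set" where
  "nonvanishing_section A L = {\<psi> \<in> section_of A L. \<forall>x. \<not> lzero L (\<psi> x)}"

definition bundle_form ::
    "'m::t2_space chart set \<Rightarrow> ('m, 'l) spin_data \<Rightarrow> ('m \<Rightarrow> real^2 \<Rightarrow> 'l) set" where
  "bundle_form A L = {\<mu>. (\<forall>x X. lproj L (\<mu> x X) = x) \<and>
     (\<forall>x X Y. \<mu> x (X + Y) = ladd L (\<mu> x X) (\<mu> x Y)) \<and>
     (\<forall>x r X. \<mu> x (r *\<^sub>R X) = lscale L (\<mu> x X) (qreal r)) \<and>
     (\<forall>(U, s)\<in>lframes L. smooth_form A U (\<lambda>x X. coef L (s x) (\<mu> x X)))}"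

definition spin_iso ::
    "'m::t2_space chart set \<Rightarrow> ('m, 'l) spin_data \<Rightarrow> ('m, 'k) spin_data \<Rightarrow> bool" where
  "spin_iso A L L' \<longleftrightarrow> (\<exists>\<Phi>. bij \<Phi> \<and>
     (\<forall>v. lproj L' (\<Phi> v) = lproj L v) \<and>
     (\<forall>v w. lproj L v = lproj L w \<longrightarrow> \<Phi> (ladd L v w) = ladd L' (\<Phi> v) (\<Phi> w)) \<and>
     (\<forall>v q. \<Phi> (lscale L v q) = lscale L' (\<Phi> v) q) \<and>
     (\<forall>(U, s)\<in>lframes L. \<forall>(V, t)\<in>lframes L'.
        smooth_map A (U \<inter> V) (\<lambda>x. coef L' (t x) (\<Phi> (s x)))) \<and>
     (\<forall>v w X. lproj L v = lproj L w \<longrightarrow> spair L' (\<Phi> v) (\<Phi> w) X = spair L v w X))"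

definition spin_complex_structure ::
    "'m::t2_space chart set \<Rightarrow> 'm bilin \<Rightarrow> ('m, 'l) spin_data \<Rightarrow> ('l \<Rightarrow> 'l) \<Rightarrow> bool" where
  "spin_complex_structure A g L J \<longleftrightarrow>
     (\<forall>v. lproj L (J v) = lproj L v) \<and>
     (\<forall>v w. lproj L v = lproj L w \<longrightarrow> J (ladd L v w) = ladd L (J v) (J w)) \<and>
     (\<forall>v q. J (lscale L v q) = lscale L (J v) q) \<and>
     (\<forall>v. J (J v) = lneg L v) \<and>
     (\<forall>\<psi>\<in>section_of A L. J \<circ> \<psi> \<in> section_of A L) \<and>
     (\<forall>v w X. lproj L v = lproj L w \<longrightarrow>
        spair L v w (rot g (lproj L v) X) = spair L (J v) w X \<and>
        spair L v w (rot g (lproj L v) X) = spair L v (J w) X)"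


section \<open>Dirac structure\<close>

definition Kbar_form ::
    "'m::t2_space chart set \<Rightarrow> 'm bilin \<Rightarrow> ('m, 'l) spin_data \<Rightarrow> ('l \<Rightarrow> 'l) \<Rightarrow>
     ('m \<Rightarrow> real^2 \<Rightarrow> 'l) set" where
  "Kbar_form A g L J = {\<mu> \<in> bundle_form A L. \<forall>x X. star g \<mu> x X = lneg L (J (\<mu> x X))}"

definition Kbar_part ::
    "'m bilin \<Rightarrow> ('m, 'l) spin_data \<Rightarrow> ('l \<Rightarrow> 'l) \<Rightarrow> ('m \<Rightarrow> real^2 \<Rightarrow> 'l) \<Rightarrow> 'm \<Rightarrow> real^2 \<Rightarrow> 'l" where
  "Kbar_part g L J \<mu> x X = lscale L (ladd L (\<mu> x X) (J (star g \<mu> x X))) (qreal (1/2))"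

definition dirac_structure ::
    "'m::t2_space chart set \<Rightarrow> 'm bilin \<Rightarrow> ('m, 'l) spin_data \<Rightarrow> ('l \<Rightarrow> 'l) \<Rightarrow>
     (('m \<Rightarrow> 'l) \<Rightarrow> 'm \<Rightarrow> real^2 \<Rightarrow> 'l) \<Rightarrow> bool" where
  "dirac_structure A g L J D \<longleftrightarrow>
     (\<forall>\<psi>\<in>section_of A L. D \<psi> \<in> Kbar_form A g L J) \<and>
     (\<forall>\<psi>\<in>section_of A L. \<forall>\<phi>\<in>section_of A L. \<forall>x X.
        D (\<lambda>y. ladd L (\<psi> y) (\<phi> y)) x X = ladd L (D \<psi> x X) (D \<phi> x X)) \<and>
     (\<forall>\<psi>\<in>section_of A L. \<forall>r x X.
        D (\<lambda>y. lscale L (\<psi> y) (qreal r)) x X = lscale L (D \<psi> x X) (qreal r)) \<and>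
     (\<forall>\<psi>\<in>section_of A L. \<forall>x X. D (J \<circ> \<psi>) x X = J (D \<psi> x X)) \<and>
     (\<forall>\<psi>\<in>section_of A L. \<forall>l. smooth_map A UNIV l \<longrightarrow> (\<forall>x X.
        D (\<lambda>y. lscale L (\<psi> y) (l y)) x X =
          ladd L (lscale L (D \<psi> x X) (l x))
            (Kbar_part g L J (\<lambda>y Y. lscale L (\<psi> y) (differential A l y Y)) x X))) \<and>
     (\<forall>\<psi>\<in>section_of A L. \<forall>\<phi>\<in>section_of A L. \<forall>x X Y.
        ext_deriv A (\<lambda>y. spair L (\<psi> y) (\<phi> y)) x X Y =
          (spair L (D \<psi> x X) (\<phi> x) Y - spair L (D \<psi> x Y) (\<phi> x) X) +
          (spair L (\<psi> x) (D \<phi> x X) Y - spair L (\<psi> x) (D \<phi> x Y) X))"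


section \<open>The functional\<close>

text \<open>\<open>lnorm2 L v\<close> is the half-density \<open>|v|\<^sup>2\<close> and \<open>linner\<close> its polarization.\<close>

definition lnorm2 :: "('m, 'l) spin_data \<Rightarrow> 'l \<Rightarrow> real^2 \<Rightarrow> real" where
  "lnorm2 L v X = norm (spair L v v X)"

definition linner :: "('m, 'l) spin_data \<Rightarrow> 'l \<Rightarrow> 'l \<Rightarrow> real^2 \<Rightarrow> real" where
  "linner L v w X = (lnorm2 L (ladd L v w) X - lnorm2 L v X - lnorm2 L w X) / 2"

definition wedge ::
    "('m, 'l) spin_data \<Rightarrow> ('m \<Rightarrow> real^2 \<Rightarrow> 'l) \<Rightarrow> ('m \<Rightarrow> real^2 \<Rightarrow> 'l) \<Rightarrow>
     'm \<Rightarrow> real^2 \<Rightarrow> real^2 \<Rightarrow> real^2 \<Rightarrow> real" where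
  "wedge L \<mu> \<nu> x X Y Z = (linner L (\<mu> x X) (\<nu> x Y) Z - linner L (\<mu> x Y) (\<nu> x X) Z) / 2"

text \<open>The half-density valued 2-form \<open>wedge\<close>, regarded as a section of the third power of \<open>|K|\<close>.\<close>

definition wedge_density ::
    "'m bilin \<Rightarrow> ('m, 'l) spin_data \<Rightarrow> ('m \<Rightarrow> real^2 \<Rightarrow> 'l) \<Rightarrow> ('m \<Rightarrow> real^2 \<Rightarrow> 'l) \<Rightarrow>
     'm \<Rightarrow> real^2 \<Rightarrow> real" where
  "wedge_density g L \<mu> \<nu> x Z = wedge L \<mu> \<nu> x Z (rot g x Z) Z"

definition integrand1 ::
    "'m bilin \<Rightarrow> ('m, 'l) spin_data \<Rightarrow> (('m \<Rightarrow> 'l) \<Rightarrow> 'm \<Rightarrow> real^2 \<Rightarrow> 'l) \<Rightarrow> ('m \<Rightarrow> 'l) \<Rightarrow>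
     'm \<Rightarrow> real^2 \<Rightarrow> real" where
  "integrand1 g L D \<psi> x Z = wedge_density g L (star g (D \<psi>)) (D \<psi>) x Z / lnorm2 L (\<psi> x) Z"

definition integrand2 ::
    "'m bilin \<Rightarrow> ('m, 'l) spin_data \<Rightarrow> (('m \<Rightarrow> 'l) \<Rightarrow> 'm \<Rightarrow> real^2 \<Rightarrow> 'l) \<Rightarrow> ('m \<Rightarrow> 'l) \<Rightarrow>
     'm \<Rightarrow> real^2 \<Rightarrow> real" where
  "integrand2 g L D \<psi> x Z =
     (wedge_density g L (star g (D \<psi>))
        (\<lambda>y X. lscale L (\<psi> y) (spair L (\<psi> y) (\<psi> y) X)) x Z)\<^sup>2 / lnorm2 L (\<psi> x) Z ^ 4"

definition integrand3 ::
    "'m bilin \<Rightarrow> ('m, 'l) spin_data \<Rightarrow> ('l \<Rightarrow> 'l) \<Rightarrow> (('m \<Rightarrow> 'l) \<Rightarrow> 'm \<Rightarrow> real^2 \<Rightarrow> 'l) \<Rightarrow>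
     ('m \<Rightarrow> 'l) \<Rightarrow> 'm \<Rightarrow> real^2 \<Rightarrow> real" where
  "integrand3 g L J D \<psi> x Z =
     (wedge_density g L (star g (D \<psi>))
        (\<lambda>y X. lscale L (J (\<psi> y)) (spair L (\<psi> y) (\<psi> y) X)) x Z)\<^sup>2 / lnorm2 L (\<psi> x) Z ^ 4"

definition energy ::
    "'m::t2_space chart set \<Rightarrow> 'm bilin \<Rightarrow> ('m, 'l) spin_data \<Rightarrow> ('l \<Rightarrow> 'l) \<Rightarrow>
     (('m \<Rightarrow> 'l) \<Rightarrow> 'm \<Rightarrow> real^2 \<Rightarrow> 'l) \<Rightarrow> real \<Rightarrow> real \<Rightarrow> real \<Rightarrow> ('m \<Rightarrow> 'l) \<Rightarrow> real" where
  "energy A g L J D \<epsilon>\<^sub>1 \<epsilon>\<^sub>2 \<epsilon>\<^sub>3 \<psi> =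
     \<epsilon>\<^sub>1 * surface_integral A (form_of_density g (integrand1 g L D \<psi>)) +
     (\<epsilon>\<^sub>2 - \<epsilon>\<^sub>1) * surface_integral A (form_of_density g (integrand2 g L D \<psi>)) +
     (\<epsilon>\<^sub>3 - \<epsilon>\<^sub>1) * surface_integral A (form_of_density g (integrand3 g L J D \<psi>))"

definition integrable_density ::
    "'m::t2_space chart set \<Rightarrow> 'm bilin \<Rightarrow> ('m \<Rightarrow> real^2 \<Rightarrow> real) \<Rightarrow> bool" where
  "integrable_density A g q \<longleftrightarrow> (\<forall>x. q x \<in> K_power g 2 x) \<and>
     (\<exists>!I. has_surface_integral A (form_of_density g q) I)"

definition metric_constraint :: "'m bilin \<Rightarrow> ('m, 'l) spin_data \<Rightarrow> ('m \<Rightarrow> 'l) \<Rightarrow> bool" where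
  "metric_constraint g L \<psi> \<longleftrightarrow> (\<forall>x X. (lnorm2 L (\<psi> x) X)\<^sup>2 = g x X X)"


section \<open>Periods\<close>

text \<open>A closed curve is given as a list of smooth pieces, each parametrized over \<open>[0,1]\<close>.\<close>

definition smooth_curve :: "'m::t2_space chart set \<Rightarrow> (real \<Rightarrow> 'm) \<Rightarrow> bool" where
  "smooth_curve A \<gamma> \<longleftrightarrow> (\<exists>T. open T \<and> {0..1} \<subseteq> T \<and> continuous_on T \<gamma> \<and>
     (\<forall>c\<in>A. smooth_on (T \<inter> \<gamma> -` fst c) (snd c \<circ> \<gamma>)))"

definition velocity :: "'m chart set \<Rightarrow> (real \<Rightarrow> 'm) \<Rightarrow> real \<Rightarrow> real^2" where
  "velocity A \<gamma> t = vector_derivative (snd (chart_at A (\<gamma> t)) \<circ> \<gamma>) (at t)"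

definition closed_curve :: "'m::t2_space chart set \<Rightarrow> (real \<Rightarrow> 'm) list \<Rightarrow> bool" where
  "closed_curve A \<gamma>s \<longleftrightarrow> \<gamma>s \<noteq> [] \<and> (\<forall>\<gamma>\<in>set \<gamma>s. smooth_curve A \<gamma>) \<and>
     (\<forall>i<length \<gamma>s. (\<gamma>s ! i) 1 = (\<gamma>s ! (Suc i mod length \<gamma>s)) 0)"

definition curve_integral ::
    "'m chart set \<Rightarrow> ('m \<Rightarrow> real^2 \<Rightarrow> 'b::euclidean_space) \<Rightarrow> (real \<Rightarrow> 'm) list \<Rightarrow> 'b" where
  "curve_integral A \<alpha> \<gamma>s = (\<Sum>\<gamma>\<leftarrow>\<gamma>s. integral {0..1} (\<lambda>t. \<alpha> (\<gamma> t) (velocity A \<gamma> t)))"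

text \<open>
  Periods are only defined for closed 1-forms, where the integral over a closed curve depends on
  its homology class alone.
\<close>

definition vanishing_periods ::
    "'m::t2_space chart set \<Rightarrow> ('m \<Rightarrow> real^2 \<Rightarrow> 'b::euclidean_space) \<Rightarrow> bool" where
  "vanishing_periods A \<alpha> \<longleftrightarrow>
     (closed_form A \<alpha> \<longrightarrow> (\<forall>\<gamma>s. closed_curve A \<gamma>s \<longrightarrow> curve_integral A \<alpha> \<gamma>s = 0))"


section \<open>Immersions and regular homotopy classes\<close>

definition immersion :: "'m::t2_space chart set \<Rightarrow> ('m \<Rightarrow> real^3) \<Rightarrow> bool" where
  "immersion A f \<longleftrightarrow> smooth_map A UNIV f \<and> (\<forall>x. inj (differential A f x))"

definition isometric_immersion ::
    "'m::t2_space chart set \<Rightarrow> 'm bilin \<Rightarrow> ('m \<Rightarrow> real^3) \<Rightarrow> bool" where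
  "isometric_immersion A g f \<longleftrightarrow> immersion A f \<and>
     (\<forall>x X Y. differential A f x X \<bullet> differential A f x Y = g x X Y)"

definition conformal_form ::
    "'m::t2_space chart set \<Rightarrow> 'm bilin \<Rightarrow> ('m \<Rightarrow> real^2 \<Rightarrow> real^3) \<Rightarrow> bool" where
  "conformal_form A g \<omega> \<longleftrightarrow> smooth_form A UNIV \<omega> \<and>
     (\<forall>x. \<exists>\<rho>>0. \<forall>X Y. \<omega> x X \<bullet> \<omega> x Y = \<rho> * g x X Y)"

definition induced_bundle :: "('m \<Rightarrow> real^2 \<Rightarrow> real^3) \<Rightarrow> ('m, 'm \<times> quat) spin_data" where
  "induced_bundle \<omega> =
     \<lparr> lproj = fst,
       ladd = (\<lambda>v w. (fst v, snd v + snd w)),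
       lscale = (\<lambda>v q. (fst v, snd v \<odot> q)),
       lframes = {(UNIV, \<lambda>x. (x, qreal 1))},
       spair = (\<lambda>v w X. qcnj (snd v) \<odot> qimag (\<omega> (fst v) X) \<odot> snd w) \<rparr>"

definition in_regular_homotopy_class ::
    "'m::t2_space chart set \<Rightarrow> 'm bilin \<Rightarrow> ('m, 'l) spin_data \<Rightarrow> ('m \<Rightarrow> real^3) \<Rightarrow> bool" where
  "in_regular_homotopy_class A g L h \<longleftrightarrow> immersion A h \<and>
     (\<exists>\<omega> B. conformal_form A g \<omega> \<and>
        (\<forall>x. linear (B x) \<and> (\<forall>X Y. g x (B x X) Y = g x X (B x Y)) \<and>
           (\<forall>X. X \<noteq> 0 \<longrightarrow> 0 < g x (B x X) X) \<and> det (matrix (B x)) = 1) \<and>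
        (\<forall>x X. differential A h x X = \<omega> x (B x X)) \<and>
        spin_iso A (induced_bundle \<omega>) L)"

end

theory Submission
  imports Defs
begin

text \<open>
  Use \<open>\<psi>\<close> itself as frame of \<open>L\<close>. At a point write \<open>\<sigma> = (\<psi>,\<psi>)\<close>, \<open>J\<psi> = \<psi>n\<close> and \<open>D\<psi> = \<psi>m\<close>, where \<open>n\<^sup>2 = -1\<close>,
  \<open>\<sigma>\<close> is imaginary, and \<open>*\<sigma> = -n\<sigma>\<close>, \<open>*m = -nm\<close>. The three integrands become \<open>|m|\<^sup>2\<close>, \<open>\<langle>m,\<sigma>\<rangle>\<^sup>2/|\<sigma>|\<^sup>2\<close> and
  \<open>\<langle>m,n\<sigma>\<rangle>\<^sup>2/|n\<sigma>|\<^sup>2\<close>. As \<open>\<sigma>\<close> and \<open>n\<sigma>\<close> are orthogonal, the energy density is \<open>\<epsilon>\<^sub>1|r|\<^sup>2\<close> plus \<open>\<epsilon>\<^sub>2\<close> times the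
  second and \<open>\<epsilon>\<^sub>3\<close> times the third of these, where \<open>r\<close> is the part of \<open>m\<close> orthogonal to \<open>\<sigma>\<close> and \<open>n\<sigma>\<close>.
  It is non-negative, and for \<open>\<epsilon>\<^sub>3 = 0\<close> it vanishes iff \<open>m\<close> is a real multiple of \<open>n\<sigma>\<close>. The same condition
  characterizes the vanishing of \<open>d\<sigma>(X, rot X) = -4 Im (n\<sigma>m)\<close>. Hence zero energy means that \<open>(\<psi>,\<psi>)\<close> is
  closed; without periods it integrates along chains of curves to \<open>f\<close> with \<open>df = (\<psi>,\<psi>)\<close>, and
  \<open>(x,q) \<mapsto> \<psi>(x)q\<close> identifies the spin bundle induced by \<open>f\<close> with \<open>L\<close>. Conversely, for an isometric \<open>f\<close> in
  the regular homotopy class of \<open>L\<close>, the image of the constant section 1 under the bundle isomorphism is \<open>\<psi>\<close>.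
\<close>

section \<open>Smooth functions\<close>

lemma has_derivative_cong_open:
  assumes "open S" "x \<in> S" "\<And>y. y \<in> S \<Longrightarrow> f y = g y"
  shows "(f has_derivative f') (at x) \<longleftrightarrow> (g has_derivative f') (at x)"
  using assms has_derivative_transform_within_open[of f f' x UNIV S g]
    has_derivative_transform_within_open[of g f' x UNIV S f] by auto

lemma frechet_derivative_cong_open:
  assumes "open S" "x \<in> S" "\<And>y. y \<in> S \<Longrightarrow> f y = g y"
  shows "frechet_derivative f (at x) = frechet_derivative g (at x)"
  unfolding frechet_derivative_def using has_derivative_cong_open[OF assms] by simp

lemma ck_on_cong:
  assumes "open S" "\<And>x. x \<in> S \<Longrightarrow> f x = g x"
  shows "ck_on n S f \<longleftrightarrow> ck_on n S g"
  using assms(2)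
proof (induction n arbitrary: f g)
  case 0
  then show ?case by (simp cong: continuous_on_cong)
next
  case (Suc n)
  have "f differentiable (at x) \<longleftrightarrow> g differentiable (at x)" if "x \<in> S" for x
    unfolding differentiable_def using has_derivative_cong_open[OF assms(1) that, of f g] Suc.prems by auto
  moreover have "ck_on n S (\<lambda>x. frechet_derivative f (at x) v) \<longleftrightarrow>
      ck_on n S (\<lambda>x. frechet_derivative g (at x) v)" for v
    using frechet_derivative_cong_open[OF assms(1), of _ f g] Suc.prems by (intro Suc.IH) simp
  ultimately show ?case by simp
qed

lemma smooth_on_cong:
  assumes "open S" "\<And>x. x \<in> S \<Longrightarrow> f x = g x"
  shows "smooth_on S f \<longleftrightarrow> smooth_on S g"
  unfolding smooth_on_def using ck_on_cong[of S f g] assms by blast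

lemma ck_on_SucD: "ck_on (Suc n) S f \<Longrightarrow> ck_on n S f"
proof (induction n arbitrary: f)
  case 0
  then show ?case
    by (simp add: continuous_at_imp_continuous_on differentiable_imp_continuous_within)
next
  case (Suc n)
  then show ?case by (metis ck_on.simps(2))
qed

lemma ck_on_SucI:
  assumes "open S" "\<And>x. x \<in> S \<Longrightarrow> (f has_derivative f' x) (at x)" "\<And>v. ck_on n S (\<lambda>x. f' x v)"
  shows "ck_on (Suc n) S f"
proof -
  have "ck_on n S (\<lambda>x. frechet_derivative f (at x) v)" for v
    using assms(3) ck_on_cong[OF assms(1), of "\<lambda>x. f' x v" "\<lambda>x. frechet_derivative f (at x) v"]
      frechet_derivative_at[OF assms(2)] by auto
  then show ?thesis using assms(2) by (auto intro: differentiableI)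
qed

lemma ck_on_has_derivative:
  "ck_on (Suc n) S f \<Longrightarrow> x \<in> S \<Longrightarrow> (f has_derivative frechet_derivative f (at x)) (at x)"
  by (simp flip: frechet_derivative_works)

lemma smooth_onI:
  assumes "open S" "\<And>x. x \<in> S \<Longrightarrow> (f has_derivative f' x) (at x)" "\<And>v. smooth_on S (\<lambda>x. f' x v)"
  shows "smooth_on S f"
  using assms ck_on_SucI[of S f f'] ck_on_SucD unfolding smooth_on_def by blast

lemma smooth_on_continuous: "smooth_on S f \<Longrightarrow> continuous_on S f"
  unfolding smooth_on_def by (metis ck_on.simps(1))

lemma smooth_on_has_derivative:
  "smooth_on S f \<Longrightarrow> x \<in> S \<Longrightarrow> (f has_derivative frechet_derivative f (at x)) (at x)"
  unfolding smooth_on_def using ck_on_has_derivative by blast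

lemma smooth_on_frechet_derivative:
  "smooth_on S f \<Longrightarrow> smooth_on S (\<lambda>x. frechet_derivative f (at x) v)"
  unfolding smooth_on_def by (metis ck_on.simps(2))

lemma ck_on_local:
  assumes "\<And>x. x \<in> S \<Longrightarrow> \<exists>T. open T \<and> x \<in> T \<and> ck_on n T f"
  shows "ck_on n S f"
  using assms
proof (induction n arbitrary: f)
  case 0
  have "isCont f x" if "x \<in> S" for x
    using 0[OF that] continuous_on_eq_continuous_at by auto
  then show ?case by (simp add: continuous_at_imp_continuous_on)
next
  case (Suc n)
  have "f differentiable (at x)" if "x \<in> S" for x
    using Suc.prems[OF that] by auto
  moreover have "ck_on n S (\<lambda>x. frechet_derivative f (at x) v)" for v
    using Suc.prems by (intro Suc.IH) (metis ck_on.simps(2))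
  ultimately show ?case by auto
qed

lemma ck_on_add:
  assumes "open S"
  shows "ck_on n S f \<Longrightarrow> ck_on n S g \<Longrightarrow> ck_on n S (\<lambda>x. f x + g x)"
proof (induction n arbitrary: f g)
  case 0
  then show ?case by (auto intro: continuous_intros)
next
  case (Suc n)
  show ?case
    by (rule ck_on_SucI[OF assms has_derivative_add[OF Suc.prems[THEN ck_on_has_derivative]]])
      (use Suc in auto)
qed

lemma ck_on_bounded_bilinear:
  assumes "bounded_bilinear p" "open S"
  shows "ck_on n S f \<Longrightarrow> ck_on n S g \<Longrightarrow> ck_on n S (\<lambda>x. p (f x) (g x))"
proof (induction n arbitrary: f g)
  case 0
  then show ?case by (auto intro: bounded_bilinear.continuous_on[OF assms(1)])
next
  case (Suc n)
  show ?case
    by (rule ck_on_SucI[OF assms(2)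
          bounded_bilinear.FDERIV[OF assms(1) Suc.prems[THEN ck_on_has_derivative]]])
      (use Suc.prems Suc.prems[THEN ck_on_SucD] in \<open>auto intro!: ck_on_add assms(2) Suc.IH\<close>)
qed

lemma smooth_on_bounded_bilinear:
  "bounded_bilinear p \<Longrightarrow> open S \<Longrightarrow> smooth_on S f \<Longrightarrow> smooth_on S g \<Longrightarrow>
    smooth_on S (\<lambda>x. p (f x) (g x))"
  unfolding smooth_on_def using ck_on_bounded_bilinear by blast

lemma ck_on_bounded_linear:
  assumes "bounded_linear l" "open S"
  shows "ck_on n S f \<Longrightarrow> ck_on n S (\<lambda>x. l (f x))"
proof (induction n arbitrary: f)
  case 0
  then show ?case by (auto intro: bounded_linear.continuous_on[OF assms(1)])
next
  case (Suc n)
  show ?case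
    by (rule ck_on_SucI[OF assms(2)
          bounded_linear.has_derivative[OF assms(1) Suc.prems[THEN ck_on_has_derivative]]])
      (use Suc in auto)
qed

lemma smooth_on_bounded_linear:
  "bounded_linear l \<Longrightarrow> open S \<Longrightarrow> smooth_on S f \<Longrightarrow> smooth_on S (\<lambda>x. l (f x))"
  unfolding smooth_on_def using ck_on_bounded_linear by blast

lemma ck_on_compose_affine:
  assumes l: "bounded_linear l" and T: "open T" "\<And>t. t \<in> T \<Longrightarrow> a + l t \<in> S"
  shows "ck_on n S f \<Longrightarrow> ck_on n T (\<lambda>t. f (a + l t))"
proof (induction n arbitrary: f)
  case 0
  then show ?case
    by (auto intro!: continuous_on_compose2[where g=f and f="\<lambda>t. a + l t"] continuous_intros
        bounded_linear.continuous_on[OF l] T(2))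
next
  case (Suc n)
  have "((\<lambda>t. a + l t) has_derivative l) (at t)" for t
    by (auto intro!: derivative_eq_intros bounded_linear_imp_has_derivative[OF l])
  then have "((\<lambda>t. f (a + l t)) has_derivative
      (\<lambda>s. frechet_derivative f (at (a + l t)) (l s))) (at t)" if "t \<in> T" for t
    using ck_on_has_derivative[OF Suc.prems T(2)[OF that]]
    by (rule has_derivative_compose[where g=f])
  then show ?case
    using Suc by (intro ck_on_SucI[OF T(1)]) auto
qed

lemma smooth_on_compose_affine:
  assumes "bounded_linear l" "open T" "\<And>t. t \<in> T \<Longrightarrow> a + l t \<in> S" "smooth_on S f"
  shows "smooth_on T (\<lambda>t. f (a + l t))"
  using ck_on_compose_affine[OF assms(1-3)] assms(4) unfolding smooth_on_def by blast

lemma has_vector_derivative_along_line: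
  assumes "(f has_derivative f') (at (y + t *\<^sub>R h))"
  shows "((\<lambda>t. f (y + t *\<^sub>R h)) has_vector_derivative f' h) (at t)"
proof -
  have "((\<lambda>t. f (y + t *\<^sub>R h)) has_derivative (\<lambda>s. f' (s *\<^sub>R h))) (at t)"
    by (rule has_derivative_compose[where f="\<lambda>t. y + t *\<^sub>R h" and g=f, OF _ assms])
      (auto intro!: derivative_eq_intros)
  then show ?thesis
    unfolding has_vector_derivative_def using linear_scale[OF has_derivative_linear[OF assms]] by simp
qed

lemma open_contains_rectangle:
  assumes "open S" "x \<in> S"
  shows "\<exists>r>0. \<forall>s t. \<bar>s\<bar> \<le> r \<longrightarrow> \<bar>t\<bar> \<le> r \<longrightarrow> x + s *\<^sub>R u + t *\<^sub>R (v::'a::real_normed_vector) \<in> S"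
proof -
  have "open ((\<lambda>(s, t). x + s *\<^sub>R u + t *\<^sub>R v) -` S)"
    unfolding split_beta by (intro open_vimage assms continuous_intros)
  then obtain A B where product: "open A" "open B" "0 \<in> A" "0 \<in> B"
      "A \<times> B \<subseteq> (\<lambda>(s, t). x + s *\<^sub>R u + t *\<^sub>R v) -` S"
    by (rule open_prod_elim[of _ "(0, 0)"]) (use assms(2) in auto)
  then obtain r where "r > 0" "cball 0 r \<subseteq> A \<inter> B"
    using open_contains_cball[of "A \<inter> B"] by (meson IntI open_Int)
  then show ?thesis using product(5) by (intro exI[of _ r]) (auto simp: subset_eq)
qed

lemma integral_frechet_derivative_line:
  fixes f :: "'a::real_normed_vector \<Rightarrow> 'b::banach"
  assumes "0 \<le> t" "\<And>\<tau>. \<tau> \<in> {0..t} \<Longrightarrow> f differentiable (at (y + \<tau> *\<^sub>R v))"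
  shows "integral {0..t} (\<lambda>\<tau>. frechet_derivative f (at (y + \<tau> *\<^sub>R v)) v) = f (y + t *\<^sub>R v) - f y"
proof -
  have "((\<lambda>\<tau>. f (y + \<tau> *\<^sub>R v)) has_vector_derivative frechet_derivative f (at (y + \<tau> *\<^sub>R v)) v)
      (at \<tau> within {0..t})" if "\<tau> \<in> {0..t}" for \<tau>
    using has_vector_derivative_along_line[OF assms(2)[OF that, unfolded frechet_derivative_works]]
    by (rule has_vector_derivative_at_within)
  from integral_unique[OF fundamental_theorem_of_calculus[OF assms(1) this]] show ?thesis by simp
qed

lemma has_vector_derivative_integral_along_line:
  fixes F :: "'a::euclidean_space \<Rightarrow> 'b::banach"
  assumes F: "ck_on 1 S F" and t: "0 \<le> t" "t \<le> r" "0 < r"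
    and rectangle: "\<And>s \<tau>. \<bar>s\<bar> \<le> r \<Longrightarrow> \<bar>\<tau>\<bar> \<le> r \<Longrightarrow> x + s *\<^sub>R u + \<tau> *\<^sub>R v \<in> S"
  shows "((\<lambda>s. integral {0..t} (\<lambda>\<tau>. F (x + s *\<^sub>R u + \<tau> *\<^sub>R v))) has_vector_derivative
    integral {0..t} (\<lambda>\<tau>. frechet_derivative F (at (x + \<tau> *\<^sub>R v)) u)) (at 0)"
proof -
  define F' where "F' y = frechet_derivative F (at y) u" for y
  let ?y = "\<lambda>s \<tau>. x + s *\<^sub>R u + \<tau> *\<^sub>R v"
  have continuous: "continuous_on S F" "continuous_on S F'"
    using F ck_on_SucD[of 0 S F] by (auto simp: F'_def[abs_def])
  have "((\<lambda>s. integral (cbox 0 t) (\<lambda>\<tau>. F (?y s \<tau>))) has_vector_derivative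
      integral (cbox 0 t) (\<lambda>\<tau>. F' (?y 0 \<tau>))) (at 0 within ball 0 r)"
  proof (rule leibniz_rule_vector_derivative)
    fix s \<tau> :: real assume "s \<in> ball 0 r" "\<tau> \<in> cbox 0 t"
    then have "x + \<tau> *\<^sub>R v + s *\<^sub>R u \<in> S"
      using rectangle[of s \<tau>] t by (auto simp: add_ac)
    then have "(F has_derivative frechet_derivative F (at (x + \<tau> *\<^sub>R v + s *\<^sub>R u)))
        (at (x + \<tau> *\<^sub>R v + s *\<^sub>R u))"
      using F by (simp flip: frechet_derivative_works)
    from has_vector_derivative_along_line[OF this]
    show "((\<lambda>s. F (?y s \<tau>)) has_vector_derivative F' (?y s \<tau>)) (at s within ball 0 r)"
      by (simp add: F'_def add_ac has_vector_derivative_at_within)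
  next
    fix s :: real assume "s \<in> ball 0 r"
    then show "(\<lambda>\<tau>. F (?y s \<tau>)) integrable_on cbox 0 t"
      using rectangle[of s] t
      by (intro integrable_continuous continuous_on_compose2[OF continuous(1)] continuous_intros) auto
  next
    show "continuous_on (ball 0 r \<times> cbox 0 t) (\<lambda>(s, \<tau>). F' (?y s \<tau>))"
      unfolding split_beta using rectangle t
      by (intro continuous_on_compose2[OF continuous(2)] continuous_intros) auto
  qed (use t in auto)
  then show ?thesis
    using t by (simp add: at_within_open[of 0 "ball 0 r"] F'_def)
qed

lemma frechet_derivative_diff_eq_integral:
  fixes f :: "'a::euclidean_space \<Rightarrow> 'b::banach"
  assumes f: "ck_on 2 S f" and t: "0 \<le> t" "t \<le> r" "0 < r"
    and rectangle: "\<And>s \<tau>. \<bar>s\<bar> \<le> r \<Longrightarrow> \<bar>\<tau>\<bar> \<le> r \<Longrightarrow> x + s *\<^sub>R u + \<tau> *\<^sub>R v \<in> S"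
  shows "frechet_derivative f (at (x + t *\<^sub>R v)) u - frechet_derivative f (at x) u =
    integral {0..t} (\<lambda>\<tau>. frechet_derivative (\<lambda>y. frechet_derivative f (at y) v) (at (x + \<tau> *\<^sub>R v)) u)"
proof -
  define D where "D w y = frechet_derivative f (at y) w" for w y
  let ?y = "\<lambda>s \<tau>. x + s *\<^sub>R u + \<tau> *\<^sub>R v"
  have deriv: "(f has_derivative (\<lambda>w. D w y)) (at y)" "f differentiable (at y)" if "y \<in> S" for y
    using f that by (auto simp: D_def numeral_2_eq_2 simp flip: frechet_derivative_works)
  have FTC: "integral {0..t} (\<lambda>\<tau>. D v (?y s \<tau>)) = f (?y s t) - f (x + s *\<^sub>R u)" if "\<bar>s\<bar> \<le> r" for s
    unfolding D_def using t rectangle[OF that] by (intro integral_frechet_derivative_line deriv(2)) auto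
  have "((\<lambda>s. integral {0..t} (\<lambda>\<tau>. D v (?y s \<tau>))) has_vector_derivative D u (x + t *\<^sub>R v) - D u x) (at 0)"
  proof (rule has_vector_derivative_transform_within_open[of _ _ _ "ball 0 r"])
    show "((\<lambda>s. f (?y s t) - f (x + s *\<^sub>R u)) has_vector_derivative D u (x + t *\<^sub>R v) - D u x) (at 0)"
      using has_vector_derivative_along_line[OF deriv(1), of "x + t *\<^sub>R v" 0 u]
        has_vector_derivative_along_line[OF deriv(1), of x 0 u] rectangle[of 0 t] rectangle[of 0 0] t
      by (intro has_vector_derivative_diff) (auto simp: add_ac)
  qed (use t FTC in auto)
  moreover have "ck_on 1 S (D v)"
    using f by (simp add: D_def[abs_def] numeral_2_eq_2)
  from has_vector_derivative_integral_along_line[OF this t rectangle]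
  have "((\<lambda>s. integral {0..t} (\<lambda>\<tau>. D v (?y s \<tau>))) has_vector_derivative
      integral {0..t} (\<lambda>\<tau>. frechet_derivative (D v) (at (x + \<tau> *\<^sub>R v)) u)) (at 0)" .
  ultimately show ?thesis
    unfolding D_def[abs_def] by (rule vector_derivative_unique_at)
qed

lemma second_derivative_symmetric:
  fixes f :: "'a::euclidean_space \<Rightarrow> 'b::banach"
  assumes S: "open S" "x \<in> S" and f: "ck_on 2 S f"
  shows "frechet_derivative (\<lambda>y. frechet_derivative f (at y) u) (at x) v =
    frechet_derivative (\<lambda>y. frechet_derivative f (at y) v) (at x) u"
proof -
  define E where "E u v y = frechet_derivative (\<lambda>y. frechet_derivative f (at y) u) (at y) v" for u v y
  obtain r where r: "r > 0" "\<And>s t. \<bar>s\<bar> \<le> r \<Longrightarrow> \<bar>t\<bar> \<le> r \<Longrightarrow> x + s *\<^sub>R u + t *\<^sub>R v \<in> S"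
    using open_contains_rectangle[OF S, of u v] by metis
  have segment: "x + t *\<^sub>R v \<in> S" if "t \<in> {0..r}" for t using r(2)[of 0 t] that by auto
  have "continuous_on S (E v u)"
    using f by (simp add: E_def[abs_def] numeral_2_eq_2)
  then have "continuous_on {0..r} (\<lambda>t. E v u (x + t *\<^sub>R v))"
    by (rule continuous_on_compose2) (use segment in \<open>auto intro!: continuous_intros\<close>)
  then have "((\<lambda>t. integral {0..t} (\<lambda>\<tau>. E v u (x + \<tau> *\<^sub>R v))) has_vector_derivative E v u (x + 0 *\<^sub>R v))
      (at 0 within {0..r})"
    by (rule integral_has_vector_derivative) (use r in auto)
  moreover have "((\<lambda>t. integral {0..t} (\<lambda>\<tau>. E v u (x + \<tau> *\<^sub>R v))) has_vector_derivative E u v x)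
      (at 0 within {0..r})"
  proof (rule has_vector_derivative_transform)
    have "((\<lambda>y. frechet_derivative f (at y) u) has_derivative (\<lambda>w. E u w (x + 0 *\<^sub>R v)))
        (at (x + 0 *\<^sub>R v))"
      using f S(2) by (simp add: E_def numeral_2_eq_2 flip: frechet_derivative_works)
    from has_vector_derivative_along_line[OF this]
    have "((\<lambda>t. frechet_derivative f (at (x + t *\<^sub>R v)) u) has_vector_derivative E u v x) (at 0)"
      by simp
    then show "((\<lambda>t. frechet_derivative f (at (x + t *\<^sub>R v)) u - frechet_derivative f (at x) u)
        has_vector_derivative E u v x) (at 0 within {0..r})"
      by (simp only: has_vector_derivative_diff_const has_vector_derivative_at_within)
  qed (use r frechet_derivative_diff_eq_integral[OF f _ _ r] in \<open>auto simp: E_def\<close>)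
  ultimately have "E v u (x + 0 *\<^sub>R v) = E u v x"
    using r(1) by (intro vector_derivative_unique_within_closed_interval[of 0 r 0]) auto
  then show ?thesis by (simp add: E_def)
qed

lemma linear_family_continuous_operator_norm:
  fixes \<beta> :: "'a::euclidean_space \<Rightarrow> 'c::euclidean_space \<Rightarrow> 'b::real_normed_vector"
  assumes S: "open S" "y \<in> S" and linear: "\<And>z. z \<in> S \<Longrightarrow> linear (\<beta> z)"
    and continuous: "\<And>w. continuous_on S (\<lambda>z. \<beta> z w)" and "0 < e"
  shows "\<exists>d>0. ball y d \<subseteq> S \<and> (\<forall>z\<in>ball y d. \<forall>h. norm (\<beta> z h - \<beta> y h) \<le> e * norm h)"
proof -
  define B where "B z = Blinfun (\<beta> z)" for z
  have B: "blinfun_apply (B z) = \<beta> z" if "z \<in> S" for z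
    unfolding B_def using linear[OF that]
    by (simp add: bounded_linear_Blinfun_apply linear_conv_bounded_linear)
  have "continuous_on S B"
  proof (rule continuous_on_blinfun_componentwise)
    show "continuous_on S (\<lambda>z. blinfun_apply (B z) w)" for w
      using continuous[of w] by (rule continuous_on_eq) (simp add: B)
  qed
  then have "isCont B y" using S continuous_on_eq_continuous_at by blast
  then obtain d where d: "d > 0" "\<And>z. dist z y < d \<Longrightarrow> norm (B z - B y) < e"
    using \<open>0 < e\<close> unfolding continuous_at_eps_delta dist_norm by blast
  obtain d' where d': "d' > 0" "ball y d' \<subseteq> S" using S openE by blast
  have "norm (\<beta> z h - \<beta> y h) \<le> e * norm h" if "z \<in> ball y (min d d')" for z h
  proof -
    have "norm (\<beta> z h - \<beta> y h) = norm (blinfun_apply (B z - B y) h)"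
      using B that d'(2) S(2) by (auto simp: blinfun.diff_left)
    also have "\<dots> \<le> norm (B z - B y) * norm h" by (rule norm_blinfun)
    also have "\<dots> \<le> e * norm h"
      using d(2)[of z] that by (intro mult_right_mono) (auto simp: dist_commute less_imp_le)
    finally show ?thesis .
  qed
  then show ?thesis
    using d(1) d' by (intro exI[of _ "min d d'"]) auto
qed

lemma has_derivative_of_line_integrals:
  fixes \<beta> :: "'a::euclidean_space \<Rightarrow> 'a \<Rightarrow> 'b::euclidean_space"
  assumes S: "open S" "y \<in> S" and linear: "\<And>z. z \<in> S \<Longrightarrow> linear (\<beta> z)"
    and continuous: "\<And>w. continuous_on S (\<lambda>z. \<beta> z w)"
    and F: "\<And>h. (\<And>t. t \<in> {0..1} \<Longrightarrow> y + t *\<^sub>R h \<in> S) \<Longrightarrow>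
      F (y + h) = F y + integral {0..1} (\<lambda>t. \<beta> (y + t *\<^sub>R h) h)"
  shows "(F has_derivative \<beta> y) (at y)"
  unfolding has_derivative_at_alt
proof (intro conjI allI impI)
  show "bounded_linear (\<beta> y)" using linear[OF S(2)] by (simp add: linear_conv_bounded_linear)
  fix e :: real assume "0 < e"
  then obtain d where d: "0 < d" "ball y d \<subseteq> S" "\<And>z h. z \<in> ball y d \<Longrightarrow> norm (\<beta> z h - \<beta> y h) \<le> e * norm h"
    using linear_family_continuous_operator_norm[OF S linear continuous] by metis
  have "norm (F (y + h) - F y - \<beta> y h) \<le> e * norm h" if "norm h < d" for h
  proof -
    have in_ball: "y + t *\<^sub>R h \<in> ball y d" if "t \<in> {0..1}" for t
      using mult_right_mono[of "\<bar>t\<bar>" 1 "norm h"] that \<open>norm h < d\<close> by (simp add: dist_norm)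
    then have segment: "y + t *\<^sub>R h \<in> S" if "t \<in> {0..1}" for t using that d(2) by blast
    have "(\<lambda>t. \<beta> (y + t *\<^sub>R h) h) integrable_on {0..1}"
      by (intro integrable_continuous_real continuous_on_compose2[OF continuous] continuous_intros)
        (use segment in auto)
    then have "((\<lambda>t. \<beta> (y + t *\<^sub>R h) h - \<beta> y h) has_integral
        integral {0..1} (\<lambda>t. \<beta> (y + t *\<^sub>R h) h) - \<beta> y h) {0..1}"
      using has_integral_const_real[of "\<beta> y h" 0 1] by (intro has_integral_diff integrable_integral) auto
    then have "norm (integral {0..1} (\<lambda>t. \<beta> (y + t *\<^sub>R h) h) - \<beta> y h) \<le>
        e * norm h * measure lborel {0..1::real}"
      using d(3)[OF in_ball] \<open>0 < e\<close> by (intro has_integral_bound_real[of _ "{}"]) auto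
    then show ?thesis using F[OF segment] by simp
  qed
  from this[of "z - y" for z]
  show "\<exists>d>0. \<forall>z. norm (z - y) < d \<longrightarrow> norm (F z - F y - \<beta> y (z - y)) \<le> e * norm (z - y)"
    using d(1) by (intro exI[of _ d]) simp
qed

section \<open>Charts and tangent vectors\<close>

definition transition_derivative :: "'m chart \<Rightarrow> 'm chart \<Rightarrow> 'm \<Rightarrow> real^2 \<Rightarrow> real^2" where
  "transition_derivative c d x = frechet_derivative (snd d \<circ> chart_inv c) (at (snd c x))"

lemma tvec_eq_transition_derivative: "tvec A c x = transition_derivative c (chart_at A x) x"
  unfolding tvec_def transition_derivative_def ..

locale surface_atlas =
  fixes A :: "'m::t2_space chart set"
  assumes atlas: "oriented_surface A"
begin

lemma chart_inv_left [simp]: "c \<in> A \<Longrightarrow> x \<in> fst c \<Longrightarrow> chart_inv c (snd c x) = x"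
  using atlas unfolding oriented_surface_def homeomorphism_def by blast

lemma chart_inv_in: "c \<in> A \<Longrightarrow> y \<in> snd c ` fst c \<Longrightarrow> chart_inv c y \<in> fst c"
  by auto

lemma open_chart_domain: "c \<in> A \<Longrightarrow> open (fst c)"
  and open_chart_range: "c \<in> A \<Longrightarrow> open (snd c ` fst c)"
  and continuous_chart: "c \<in> A \<Longrightarrow> continuous_on (fst c) (snd c)"
  and continuous_chart_inv: "c \<in> A \<Longrightarrow> continuous_on (snd c ` fst c) (chart_inv c)"
  using atlas unfolding oriented_surface_def homeomorphism_def by blast+

lemma inj_on_chart: "c \<in> A \<Longrightarrow> inj_on (snd c) (fst c)"
  by (metis chart_inv_left inj_onI)

lemma ex_chart: "\<exists>c\<in>A. x \<in> fst c"
  using atlas unfolding oriented_surface_def by blast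

lemma chart_at_mem: "chart_at A x \<in> A" "x \<in> fst (chart_at A x)"
  unfolding chart_at_def using someI_ex[of "\<lambda>c. c \<in> A \<and> x \<in> fst c"] ex_chart by blast+

lemma chart_image_eq_vimage:
  "c \<in> A \<Longrightarrow> snd c ` (U \<inter> fst c) = chart_inv c -` U \<inter> snd c ` fst c"
  by force

lemma open_chart_image: "c \<in> A \<Longrightarrow> open U \<Longrightarrow> open (snd c ` (U \<inter> fst c))"
  unfolding chart_image_eq_vimage
  using continuous_open_preimage[OF continuous_chart_inv open_chart_range]
  by (metis inf_commute)

lemma open_chart_preimage: "c \<in> A \<Longrightarrow> open V \<Longrightarrow> open (snd c -` V \<inter> fst c)"
  using continuous_open_preimage[OF continuous_chart open_chart_domain] by (metis inf_commute)

lemma smooth_transition: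
  "c \<in> A \<Longrightarrow> d \<in> A \<Longrightarrow> smooth_on (snd c ` (fst c \<inter> fst d)) (snd d \<circ> chart_inv c)"
  using atlas unfolding oriented_surface_def by blast

lemma transition_has_derivative:
  assumes "c \<in> A" "x \<in> fst c" "d \<in> A" "x \<in> fst d"
  shows "((snd d \<circ> chart_inv c) has_derivative transition_derivative c d x) (at (snd c x))"
  unfolding transition_derivative_def
  using smooth_on_has_derivative[OF smooth_transition] assms by blast

lemmas linear_transition_derivative = has_derivative_linear[OF transition_has_derivative]

lemma det_transition_derivative_pos:
  assumes "c \<in> A" "x \<in> fst c" "d \<in> A" "x \<in> fst d"
  shows "0 < det (matrix (transition_derivative c d x))"
  unfolding transition_derivative_def using atlas assms unfolding oriented_surface_def by blast

lemma has_derivative_change_chart: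
  assumes c_in: "c \<in> A" "x \<in> fst c" and d_in: "d \<in> A" "x \<in> fst d"
    and "(h \<circ> chart_inv d has_derivative h') (at (snd d x))"
  shows "(h \<circ> chart_inv c has_derivative h' \<circ> transition_derivative c d x) (at (snd c x))"
proof -
  have "((h \<circ> chart_inv d) \<circ> (snd d \<circ> chart_inv c) has_derivative h' \<circ> transition_derivative c d x)
      (at (snd c x))"
    using assms by (intro diff_chain_at transition_has_derivative) auto
  then show ?thesis
    by (rule has_derivative_transform_within_open
        [OF _ open_chart_image[OF c_in(1) open_chart_domain[OF d_in(1)]]])
      (use c_in d_in in auto)
qed

lemma transition_derivative_compose:
  assumes "c \<in> A" "x \<in> fst c" "d \<in> A" "x \<in> fst d" "e \<in> A" "x \<in> fst e"
  shows "transition_derivative c e x = transition_derivative d e x \<circ> transition_derivative c d x"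
  using frechet_derivative_at[OF has_derivative_change_chart[OF assms(1-4)
        transition_has_derivative[OF assms(3-6)]]]
  unfolding transition_derivative_def[of c e] by simp

lemma tvec_change_chart:
  assumes "c \<in> A" "x \<in> fst c" "d \<in> A" "x \<in> fst d"
  shows "tvec A c x = tvec A d x \<circ> transition_derivative c d x"
  unfolding tvec_eq_transition_derivative using transition_derivative_compose[OF assms chart_at_mem] .

lemma tvec_chart_at [simp]: "tvec A (chart_at A x) x w = w"
proof -
  let ?c = "chart_at A x"
  have "transition_derivative ?c ?c x = frechet_derivative (\<lambda>y. y) (at (snd ?c x))"
    unfolding transition_derivative_def
    by (rule frechet_derivative_cong_open[OF open_chart_range[OF chart_at_mem(1)]]) (use chart_at_mem in auto)
  then show ?thesis by (simp add: tvec_eq_transition_derivative)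
qed

lemma linear_tvec: "c \<in> A \<Longrightarrow> x \<in> fst c \<Longrightarrow> linear (tvec A c x)"
  unfolding tvec_eq_transition_derivative by (intro linear_transition_derivative chart_at_mem)

lemma smooth_map_has_derivative:
  assumes "smooth_map A UNIV h" "c \<in> A" "x \<in> fst c"
  shows "(h \<circ> chart_inv c has_derivative differential A h x \<circ> tvec A c x) (at (snd c x))"
proof -
  have "((h \<circ> chart_inv (chart_at A x)) has_derivative differential A h x) (at (snd (chart_at A x) x))"
    unfolding differential_def[abs_def]
    using assms(1) chart_at_mem unfolding smooth_map_def by (intro smooth_on_has_derivative) auto
  then show ?thesis
    unfolding tvec_eq_transition_derivative
    by (rule has_derivative_change_chart[OF assms(2,3) chart_at_mem])
qed

lemma frechet_derivative_chart:
  assumes "smooth_map A UNIV h" "c \<in> A" "y \<in> snd c ` fst c"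
  shows "frechet_derivative (h \<circ> chart_inv c) (at y) w = local_form A c (differential A h) w y"
proof -
  have "differential A h x \<circ> tvec A c x = frechet_derivative (h \<circ> chart_inv c) (at (snd c x))"
    if "x \<in> fst c" for x
    by (rule frechet_derivative_at[OF smooth_map_has_derivative[OF assms(1,2) that]])
  from this[THEN fun_cong] show ?thesis
    using assms(2,3) by (auto simp: local_form_def)
qed

lemma smooth_form_differential:
  assumes "smooth_map A UNIV h"
  shows "smooth_form A UNIV (differential A h)"
  unfolding smooth_form_def
proof (intro conjI ballI allI)
  fix x show "linear (differential A h x)"
    using has_derivative_linear[OF smooth_map_has_derivative[OF assms chart_at_mem]] by (simp add: o_def)
next
  fix c w assume c_in: "c \<in> A"
  have "smooth_on (snd c ` fst c) (\<lambda>y. frechet_derivative (h \<circ> chart_inv c) (at y) w)"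
    using assms c_in by (intro smooth_on_frechet_derivative) (simp add: smooth_map_def)
  moreover have "smooth_on (snd c ` fst c) (\<lambda>y. frechet_derivative (h \<circ> chart_inv c) (at y) w) \<longleftrightarrow>
      smooth_on (snd c ` fst c) (local_form A c (differential A h) w)"
    by (rule smooth_on_cong[OF open_chart_range[OF c_in]]) (rule frechet_derivative_chart[OF assms c_in])
  ultimately show "smooth_on (snd c ` (UNIV \<inter> fst c)) (local_form A c (differential A h) w)" by simp
qed

lemma closed_form_differential:
  fixes h :: "'m \<Rightarrow> 'b::banach"
  assumes "smooth_map A UNIV h"
  shows "closed_form A (differential A h)"
  unfolding closed_form_def
proof (intro allI)
  fix x X Y
  let ?c = "chart_at A x"
  have y: "open (snd ?c ` fst ?c)" "snd ?c x \<in> snd ?c ` fst ?c"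
    using open_chart_range chart_at_mem by auto
  have D: "frechet_derivative (local_form A ?c (differential A h) w) (at (snd ?c x)) =
      frechet_derivative (\<lambda>y. frechet_derivative (h \<circ> chart_inv ?c) (at y) w) (at (snd ?c x))" for w
    by (rule frechet_derivative_cong_open[OF y]) (simp add: frechet_derivative_chart[OF assms chart_at_mem(1)])
  have "ck_on 2 (snd ?c ` fst ?c) (h \<circ> chart_inv ?c)"
    using assms chart_at_mem(1) by (auto simp: smooth_map_def smooth_on_def)
  from second_derivative_symmetric[OF y this]
  show "ext_deriv A (differential A h) x X Y = 0"
    unfolding ext_deriv_def Let_def D by simp
qed

lemma linear_local_form:
  assumes "linear (\<alpha> (chart_inv c y))" "c \<in> A" "y \<in> snd c ` fst c"
  shows "linear (\<lambda>w. local_form A c \<alpha> w y)"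
  unfolding local_form_def
  using linear_compose[OF linear_tvec[OF assms(2) chart_inv_in[OF assms(2,3)]] assms(1)]
  by (simp add: o_def)

lemma smooth_form_local:
  "smooth_form A UNIV \<alpha> \<Longrightarrow> c \<in> A \<Longrightarrow> smooth_on (snd c ` fst c) (local_form A c \<alpha> w)"
  unfolding smooth_form_def by (metis inf_top.left_neutral)

lemma differential_bounded_linear:
  assumes l: "bounded_linear l" and f: "smooth_map A UNIV f"
  shows "smooth_map A UNIV (\<lambda>x. l (f x))" "differential A (\<lambda>x. l (f x)) x X = l (differential A f x X)"
proof -
  show "smooth_map A UNIV (\<lambda>x. l (f x))"
    using smooth_on_bounded_linear[OF l open_chart_range] f unfolding smooth_map_def by (simp add: o_def)
  from frechet_derivative_at[OF bounded_linear.has_derivative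
      [OF l smooth_map_has_derivative[OF f chart_at_mem, of x]]]
  show "differential A (\<lambda>x. l (f x)) x X = l (differential A f x X)"
    unfolding differential_def[of A "\<lambda>x. l (f x)"] by (simp add: o_def) (metis tvec_chart_at)
qed

end

section \<open>Integration of 2-forms\<close>

lemma vec2_eq_axis_sum: "(X::real^2) = X$1 *\<^sub>R axis 1 1 + X$2 *\<^sub>R axis 2 1"
  by (simp add: vec_eq_iff forall_2 axis_def)

definition area2 :: "real^2 \<Rightarrow> real^2 \<Rightarrow> real" where
  "area2 X Y = X$1 * Y$2 - X$2 * Y$1"

lemma area2_axis: "area2 (axis 1 1) (axis 2 1) = 1"
  by (simp add: area2_def axis_def)

lemma area2_linear_image:
  fixes T :: "real^2 \<Rightarrow> real^2"
  assumes "linear T"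
  shows "area2 (T X) (T Y) = det (matrix T) * area2 X Y"
proof -
  have "T Z = Z$1 *\<^sub>R T (axis 1 1) + Z$2 *\<^sub>R T (axis 2 1)" for Z
    using vec2_eq_axis_sum[of Z] linear_add[OF assms] linear_scale[OF assms] by metis
  then have T: "T Z $ i = Z$1 * T (axis 1 1) $ i + Z$2 * T (axis 2 1) $ i" for Z i
    by (metis vector_add_component vector_scaleR_component real_scaleR_def)
  show ?thesis
    unfolding area2_def T[of X] T[of Y] by (simp add: det_2 matrix_def algebra_simps)
qed

definition two_form :: "'m bilin \<Rightarrow> bool" where
  "two_form \<sigma> \<longleftrightarrow> (\<forall>x. \<exists>k. \<forall>X Y. \<sigma> x X Y = k * area2 X Y)"

definition nonneg_form :: "'m bilin \<Rightarrow> bool" where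
  "nonneg_form \<sigma> \<longleftrightarrow> (\<forall>x X Y. 0 < area2 X Y \<longrightarrow> 0 \<le> \<sigma> x X Y)"

definition continuous_two_form :: "'m chart set \<Rightarrow> 'm bilin \<Rightarrow> bool" where
  "continuous_two_form A \<sigma> \<longleftrightarrow> (\<forall>c\<in>A. continuous_on (snd c ` fst c) (local_density A c \<sigma>))"

definition chart_integrable :: "'m chart set \<Rightarrow> 'm chart \<Rightarrow> 'm set \<Rightarrow> 'm bilin \<Rightarrow> bool" where
  "chart_integrable A c P \<sigma> \<longleftrightarrow> local_density A c \<sigma> absolutely_integrable_on snd c ` P"

definition chart_integral :: "'m chart set \<Rightarrow> 'm chart \<Rightarrow> 'm set \<Rightarrow> 'm bilin \<Rightarrow> real" where
  "chart_integral A c P \<sigma> = integral (snd c ` P) (local_density A c \<sigma>)"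

lemma chart_integrable_integrable_on:
  "chart_integrable A c P \<sigma> \<Longrightarrow> local_density A c \<sigma> integrable_on snd c ` P"
  unfolding chart_integrable_def by (rule set_lebesgue_integral_eq_integral(1))

lemma has_surface_integral_alt:
  "has_surface_integral A \<sigma> I \<longleftrightarrow> (\<forall>n c P. borel_partition A n c P \<longrightarrow>
     (\<forall>i<n. chart_integrable A (c i) (P i) \<sigma>) \<and> (\<Sum>i<n. chart_integral A (c i) (P i) \<sigma>) = I)"
  unfolding has_surface_integral_def chart_integrable_def chart_integral_def ..

lemma borel_partitionD:
  assumes "borel_partition A n c P"
  shows "(\<Union>i<n. P i) = UNIV" "disjoint_family_on P {..<n}"
    "i < n \<Longrightarrow> c i \<in> A" "i < n \<Longrightarrow> P i \<in> sets borel" "i < n \<Longrightarrow> P i \<subseteq> fst (c i)"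
  using assms unfolding borel_partition_def by auto

lemma absolutely_integrable_change_of_variables_real:
  fixes f :: "real^'n::{finite,wellorder} \<Rightarrow> real"
    and \<phi> :: "real^'n::{finite,wellorder} \<Rightarrow> real^'n::{finite,wellorder}"
  assumes "S \<in> sets lebesgue" "\<And>x. x \<in> S \<Longrightarrow> (\<phi> has_derivative \<phi>' x) (at x within S)" "inj_on \<phi> S"
  defines "pullback \<equiv> \<lambda>x. \<bar>det (matrix (\<phi>' x))\<bar> * f (\<phi> x)"
  shows "pullback absolutely_integrable_on S \<longleftrightarrow> f absolutely_integrable_on \<phi> ` S"
    and "f absolutely_integrable_on \<phi> ` S \<Longrightarrow> integral S pullback = integral (\<phi> ` S) f"
proof -
  have "pullback absolutely_integrable_on S \<and> integral S pullback = b \<longleftrightarrow>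
      f absolutely_integrable_on \<phi> ` S \<and> integral (\<phi> ` S) f = b" for b
    using has_absolute_integral_change_of_variables[OF assms(1-3), of "\<lambda>y. vec (f y) :: real^1" "vec b"]
    unfolding pullback_def by (simp add: absolutely_integrable_on_1_iff integral_on_1_eq)
  then show "pullback absolutely_integrable_on S \<longleftrightarrow> f absolutely_integrable_on \<phi> ` S"
    "f absolutely_integrable_on \<phi> ` S \<Longrightarrow> integral S pullback = integral (\<phi> ` S) f"
    by blast+
qed

context surface_atlas
begin

lemma area2_tvec_pos:
  assumes "c \<in> A" "x \<in> fst c" "0 < area2 X Y"
  shows "0 < area2 (tvec A c x X) (tvec A c x Y)"
  using det_transition_derivative_pos[OF assms(1,2) chart_at_mem] assms(3)
  by (simp add: area2_linear_image[OF linear_tvec[OF assms(1,2)]] flip: tvec_eq_transition_derivative)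

lemma local_density_nonneg:
  assumes "nonneg_form \<sigma>" "c \<in> A" "y \<in> snd c ` fst c"
  shows "0 \<le> local_density A c \<sigma> y"
  using area2_tvec_pos[OF assms(2) chart_inv_in[OF assms(2,3)]] assms(1)
  unfolding local_density_def nonneg_form_def by (simp add: area2_axis)

lemma borel_chart_image:
  assumes "c \<in> A" "P \<in> sets borel" "P \<subseteq> fst c"
  shows "snd c ` P \<in> sets borel"
proof -
  have "chart_inv c \<in> measurable (restrict_space borel (snd c ` fst c)) borel"
    by (rule borel_measurable_continuous_on_restrict[OF continuous_chart_inv[OF assms(1)]])
  from measurable_sets[OF this assms(2)]
  have "chart_inv c -` P \<inter> snd c ` fst c \<in> sets (restrict_space borel (snd c ` fst c))"
    by (simp add: space_restrict_space)
  then have "chart_inv c -` P \<inter> snd c ` fst c \<in> sets borel"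
    using open_chart_range[OF assms(1)] by (simp add: sets_restrict_space_iff)
  moreover have "snd c ` P = chart_inv c -` P \<inter> snd c ` fst c"
    using chart_image_eq_vimage[OF assms(1), of P] assms(3) by (simp add: Int_absorb2)
  ultimately show ?thesis by simp
qed

lemma chart_box:
  assumes "c \<in> A" "x \<in> fst c"
  obtains a b B where "snd c x \<in> box a b" "B \<in> sets borel" "B \<subseteq> fst c" "snd c ` B = cbox a b"
    "cbox a b \<subseteq> snd c ` fst c"
proof -
  obtain a b where box: "snd c x \<in> box a b" "cbox a b \<subseteq> snd c ` fst c"
    using open_contains_cbox open_chart_range[OF assms(1)] assms(2) by (metis imageI)
  let ?B = "chart_inv c ` cbox a b"
  have "compact ?B"
    using continuous_on_subset[OF continuous_chart_inv[OF assms(1)] box(2)] compact_cbox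
    by (rule compact_continuous_image)
  then have "?B \<in> sets borel" by (intro borel_closed compact_imp_closed)
  moreover have "?B \<subseteq> fst c" "snd c ` ?B = cbox a b"
    using box(2) assms(1) by (force simp: image_image)+
  ultimately show ?thesis using box(2) by (rule that[OF box(1)])
qed

lemma chart_integrable_subset:
  assumes "chart_integrable A c P \<sigma>" "c \<in> A" "P \<subseteq> fst c" "Q \<in> sets borel" "Q \<subseteq> P"
  shows "chart_integrable A c Q \<sigma>"
proof -
  have "snd c ` Q \<in> sets lebesgue" using borel_chart_image[OF assms(2,4)] assms(3,5) by simp
  then show ?thesis
    using assms(1,5) unfolding chart_integrable_def by (auto intro: set_integrable_subset)
qed

lemma local_density_change_chart:
  assumes "c \<in> A" "x \<in> fst c" "d \<in> A" "x \<in> fst d" "two_form \<sigma>"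
  shows "local_density A c \<sigma> (snd c x) =
    det (matrix (transition_derivative c d x)) * local_density A d \<sigma> (snd d x)"
proof -
  obtain k where k: "\<And>X Y. \<sigma> x X Y = k * area2 X Y" using assms(5) unfolding two_form_def by blast
  have "area2 (tvec A c x X) (tvec A c x Y) =
      det (matrix (transition_derivative c d x)) * area2 (tvec A d x X) (tvec A d x Y)" for X Y
    unfolding tvec_change_chart[OF assms(1-4)] o_def area2_linear_image[OF linear_tvec[OF assms(3,4)]]
      area2_linear_image[OF linear_transition_derivative[OF assms(1-4)]] by simp
  then show ?thesis
    unfolding local_density_def chart_inv_left[OF assms(1,2)] chart_inv_left[OF assms(3,4)] k by simp
qed

lemma chart_integral_change_chart:
  assumes c_in: "c \<in> A" and d_in: "d \<in> A" and Q: "Q \<in> sets borel" "Q \<subseteq> fst c \<inter> fst d"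
    and \<sigma>: "two_form \<sigma>" "chart_integrable A d Q \<sigma>"
  shows "chart_integrable A c Q \<sigma>" and "chart_integral A c Q \<sigma> = chart_integral A d Q \<sigma>"
proof -
  let ?g = "snd d \<circ> chart_inv c" and ?S = "snd c ` Q"
  let ?g' = "\<lambda>y. transition_derivative c d (chart_inv c y)"
  let ?h = "\<lambda>y. \<bar>det (matrix (?g' y))\<bar> * local_density A d \<sigma> (?g y)"
  have image: "?g ` ?S = snd d ` Q"
    using Q c_in by (force simp: image_image)
  have pullback: "?h y = local_density A c \<sigma> y" if "y \<in> ?S" for y
    using that Q c_in d_in local_density_change_chart[OF c_in _ d_in _ \<sigma>(1)]
    by (auto simp: subset_eq abs_of_pos[OF det_transition_derivative_pos[OF c_in _ d_in]])
  have deriv: "(?g has_derivative ?g' y) (at y within ?S)" if "y \<in> ?S" for y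
    using that Q c_in transition_has_derivative[OF c_in _ d_in]
    by (auto simp: subset_eq intro: has_derivative_at_withinI)
  have "inj_on (?g \<circ> snd c) Q \<longleftrightarrow> inj_on (snd d) Q"
    by (rule inj_on_cong) (use Q c_in in auto)
  then have inj: "inj_on ?g ?S"
    using inj_on_subset[OF inj_on_chart[OF d_in]] Q(2) by (intro inj_on_imageI) simp
  have S: "?S \<in> sets lebesgue" using borel_chart_image[OF c_in Q(1)] Q(2) by simp
  note change = absolutely_integrable_change_of_variables_real[OF S deriv inj, of "local_density A d \<sigma>",
      unfolded image, folded chart_integrable_def chart_integral_def]
  have "?h absolutely_integrable_on ?S \<longleftrightarrow> local_density A c \<sigma> absolutely_integrable_on ?S"
    by (rule set_integrable_cong[OF refl refl]) (rule pullback)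
  then show "chart_integrable A c Q \<sigma>"
    using change(1) \<sigma>(2) by (simp add: chart_integrable_def)
  have "integral ?S ?h = integral ?S (local_density A c \<sigma>)"
    by (rule integral_cong) (rule pullback)
  then show "chart_integral A c Q \<sigma> = chart_integral A d Q \<sigma>"
    using change(2) \<sigma>(2) by (simp add: chart_integral_def)
qed

lemma chart_integral_partition:
  fixes n :: nat
  assumes c_in: "c \<in> A" "P \<subseteq> fst c" and Q: "(\<Union>j<n. Q j) = UNIV" "disjoint_family_on Q {..<n}"
    and integrable: "\<And>j. j < n \<Longrightarrow> chart_integrable A c (P \<inter> Q j) \<sigma>"
  shows "chart_integrable A c P \<sigma>" "chart_integral A c P \<sigma> = (\<Sum>j<n. chart_integral A c (P \<inter> Q j) \<sigma>)"
proof -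
  let ?f = "local_density A c \<sigma>"
  have P: "snd c ` P = (\<Union>j<n. snd c ` (P \<inter> Q j))"
    using Q(1) by (simp flip: image_UN Int_UN_distrib)
  have "?f absolutely_integrable_on (\<Union>j<k. snd c ` (P \<inter> Q j))" if "k \<le> n" for k
    using that
  proof (induction k)
    case (Suc k)
    then show ?case
      using absolutely_integrable_Un[of _ ?f "snd c ` (P \<inter> Q k)"] integrable[of k]
      by (simp add: lessThan_Suc Un_commute[of "snd c ` (P \<inter> Q k)"] chart_integrable_def)
  qed simp
  then show "chart_integrable A c P \<sigma>" unfolding chart_integrable_def P by blast
  have "(?f has_integral (\<Sum>j<n. chart_integral A c (P \<inter> Q j) \<sigma>)) (\<Union>j\<in>{..<n}. snd c ` (P \<inter> Q j))"
  proof (rule has_integral_UN)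
    show "(?f has_integral chart_integral A c (P \<inter> Q j) \<sigma>) (snd c ` (P \<inter> Q j))" if "j \<in> {..<n}" for j
      using chart_integrable_integrable_on[OF integrable] that
      unfolding chart_integral_def by (intro integrable_integral) simp
    have "snd c ` (P \<inter> Q i) \<inter> snd c ` (P \<inter> Q j) = {}" if "i < n" "j < n" "i \<noteq> j" for i j
      using c_in(2) Q(2) that inj_onD[OF inj_on_chart[OF c_in(1)]] unfolding disjoint_family_on_def by blast
    then show "pairwise (\<lambda>i j. negligible (snd c ` (P \<inter> Q i) \<inter> snd c ` (P \<inter> Q j))) {..<n}"
      by (simp add: pairwise_def)
  qed simp
  then show "chart_integral A c P \<sigma> = (\<Sum>j<n. chart_integral A c (P \<inter> Q j) \<sigma>)"
    unfolding chart_integral_def[of A c P] P by (rule integral_unique)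
qed

lemma borel_partition_integral_eq:
  assumes \<sigma>: "two_form \<sigma>" and partitions: "borel_partition A n c P" "borel_partition A m d Q"
    and integrable: "\<And>j. j < m \<Longrightarrow> chart_integrable A (d j) (Q j) \<sigma>"
  shows "i < n \<Longrightarrow> chart_integrable A (c i) (P i) \<sigma>"
    and "(\<Sum>i<n. chart_integral A (c i) (P i) \<sigma>) = (\<Sum>j<m. chart_integral A (d j) (Q j) \<sigma>)"
proof -
  note P = borel_partitionD[OF partitions(1)] and Q = borel_partitionD[OF partitions(2)]
  have integrable_d: "chart_integrable A (d j) (P i \<inter> Q j) \<sigma>" if "i < n" "j < m" for i j
    using chart_integrable_subset[OF integrable Q(3,5)] P(4) Q(4) that by simp
  have overlap: "P i \<inter> Q j \<in> sets borel" "P i \<inter> Q j \<subseteq> fst (c i) \<inter> fst (d j)" if "i < n" "j < m" for i j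
    using P(4,5)[OF that(1)] Q(4,5)[OF that(2)] by auto
  note change = chart_integral_change_chart[OF P(3) Q(3) overlap \<sigma> integrable_d]
  note split_P = chart_integral_partition[OF P(3,5) Q(1,2) change(1)]
  then show "i < n \<Longrightarrow> chart_integrable A (c i) (P i) \<sigma>" by blast
  have split_Q: "chart_integral A (d j) (Q j) \<sigma> = (\<Sum>i<n. chart_integral A (d j) (P i \<inter> Q j) \<sigma>)"
    if "j < m" for j
    using chart_integral_partition(2)[OF Q(3,5) P(1,2)] integrable_d that by (simp add: Int_commute)
  have "(\<Sum>i<n. chart_integral A (c i) (P i) \<sigma>) = (\<Sum>i<n. \<Sum>j<m. chart_integral A (d j) (P i \<inter> Q j) \<sigma>)"
    using split_P(2) change(2) by simp
  also have "\<dots> = (\<Sum>j<m. \<Sum>i<n. chart_integral A (d j) (P i \<inter> Q j) \<sigma>)" by (rule sum.swap)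
  also have "\<dots> = (\<Sum>j<m. chart_integral A (d j) (Q j) \<sigma>)" using split_Q by simp
  finally show "(\<Sum>i<n. chart_integral A (c i) (P i) \<sigma>) = (\<Sum>j<m. chart_integral A (d j) (Q j) \<sigma>)" .
qed

lemma has_surface_integral_partition:
  assumes "two_form \<sigma>" "borel_partition A n c P" "\<And>i. i < n \<Longrightarrow> chart_integrable A (c i) (P i) \<sigma>"
  shows "has_surface_integral A \<sigma> (\<Sum>i<n. chart_integral A (c i) (P i) \<sigma>)"
  unfolding has_surface_integral_alt using borel_partition_integral_eq[OF assms(1) _ assms(2,3)] by blast

lemma has_surface_integral_add:
  assumes "has_surface_integral A \<sigma> I" "has_surface_integral A \<tau> I'"
  shows "has_surface_integral A (\<lambda>x X Y. \<sigma> x X Y + \<tau> x X Y) (I + I')"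
proof -
  have "local_density A c (\<lambda>x X Y. \<sigma> x X Y + \<tau> x X Y) =
      (\<lambda>y. local_density A c \<sigma> y + local_density A c \<tau> y)" for c
    by (simp add: local_density_def fun_eq_iff)
  then have "chart_integrable A c P (\<lambda>x X Y. \<sigma> x X Y + \<tau> x X Y) \<and>
      chart_integral A c P (\<lambda>x X Y. \<sigma> x X Y + \<tau> x X Y) = chart_integral A c P \<sigma> + chart_integral A c P \<tau>"
    if "chart_integrable A c P \<sigma>" "chart_integrable A c P \<tau>" for c P
    using that that[THEN chart_integrable_integrable_on]
    by (simp add: chart_integrable_def chart_integral_def set_integral_add integral_add)
  then show ?thesis using assms unfolding has_surface_integral_alt by (simp add: sum.distrib)
qed

lemma has_surface_integral_cmult:
  assumes "has_surface_integral A \<sigma> I"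
  shows "has_surface_integral A (\<lambda>x X Y. r * \<sigma> x X Y) (r * I)"
proof -
  have "local_density A c (\<lambda>x X Y. r * \<sigma> x X Y) = (\<lambda>y. r * local_density A c \<sigma> y)" for c
    by (simp add: local_density_def fun_eq_iff)
  then have "chart_integrable A c P (\<lambda>x X Y. r * \<sigma> x X Y) \<and>
      chart_integral A c P (\<lambda>x X Y. r * \<sigma> x X Y) = r * chart_integral A c P \<sigma>"
    if "chart_integrable A c P \<sigma>" for c P
    using that by (simp add: chart_integrable_def chart_integral_def set_integrable_mult_right)
  then show ?thesis using assms unfolding has_surface_integral_alt by (simp flip: sum_distrib_left)
qed

end

locale compact_surface = surface_atlas A for A :: "'m::t2_space chart set" +
  assumes compact_surface: "compact (UNIV :: 'm set)"
begin

lemma ex_borel_partition_subordinate: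
  assumes "\<And>x. \<exists>c\<in>A. \<exists>V. open V \<and> x \<in> V \<and> V \<subseteq> fst c \<and> R c V"
  shows "\<exists>n c P. borel_partition A n c P \<and> (\<forall>i<n. \<exists>V. P i \<subseteq> V \<and> V \<subseteq> fst (c i) \<and> R (c i) V)"
proof -
  obtain c V where V: "\<And>x. c x \<in> A" "\<And>x. open (V x)" "\<And>x. x \<in> V x" "\<And>x. V x \<subseteq> fst (c x)" "\<And>x. R (c x) (V x)"
    using assms by metis
  obtain F where "F \<subseteq> UNIV" and F: "finite F" "UNIV \<subseteq> (\<Union>x\<in>F. V x)"
    by (rule compactE_image[OF compact_surface, of UNIV V]) (use V(2,3) in auto)
  obtain h :: "nat \<Rightarrow> 'm" and n where h: "F = h ` {i. i < n}"
    using finite_imp_nat_seg_image_inj_on[OF F(1)] by metis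
  define P where "P = disjointed (V \<circ> h)"
  have P: "P i \<subseteq> V (h i)" for i
    using disjointed_subset[of "V \<circ> h" i] by (simp add: P_def)
  have "borel_partition A n (c \<circ> h) P"
    unfolding borel_partition_def
  proof (intro conjI allI impI)
    show "(\<Union>i<n. P i) = UNIV"
      using finite_UN_disjointed_eq[of "V \<circ> h" n] F(2) by (force simp: P_def h lessThan_atLeast0)
    show "disjoint_family_on P {..<n}"
      unfolding P_def using disjoint_family_disjointed by (metis disjoint_family_on_mono subset_UNIV)
    show "P i \<in> sets borel" for i
      unfolding P_def disjointed_def using V(2) by (intro sets.Diff sets.finite_UN) auto
    show "(c \<circ> h) i \<in> A" "P i \<subseteq> fst ((c \<circ> h) i)" for i
      using V(1) order_trans[OF P V(4)] by simp_all
  qed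
  then show ?thesis
    using V(4,5) P by (metis comp_apply)
qed

lemma borel_partition_starting_with:
  assumes "c\<^sub>0 \<in> A" "B \<in> sets borel" "B \<subseteq> fst c\<^sub>0"
  obtains n c P where "borel_partition A (Suc n) c P" "c 0 = c\<^sub>0" "P 0 = B"
proof -
  have "\<exists>c\<in>A. \<exists>V. open V \<and> x \<in> V \<and> V \<subseteq> fst c \<and> True" for x
    using ex_chart[of x] open_chart_domain by auto
  from ex_borel_partition_subordinate[OF this] obtain n c P where partition: "borel_partition A n c P"
    by blast
  note P = borel_partitionD[OF partition]
  have "borel_partition A (Suc n) (case_nat c\<^sub>0 c) (case_nat B (\<lambda>i. P i - B))"
    unfolding borel_partition_def
  proof (intro conjI)
    show "(\<Union>i<Suc n. case i of 0 \<Rightarrow> B | Suc j \<Rightarrow> P j - B) = UNIV"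
      using P(1) unfolding lessThan_Suc_eq_insert_0 by auto
    show "disjoint_family_on (case_nat B (\<lambda>i. P i - B)) {..<Suc n}"
      using P(2) unfolding disjoint_family_on_def by (auto split: nat.splits)
  qed (use assms P(3-5) in \<open>auto simp: subset_eq split: nat.splits\<close>)
  then show ?thesis by (rule that) simp_all
qed

lemma ex_borel_partition: "\<exists>n c P. borel_partition A n c P"
  using ex_chart borel_partition_starting_with[of _ "{}"] by (metis empty_subsetI sets.empty_sets)

lemma ex_surface_integral:
  assumes \<sigma>: "two_form \<sigma>" "continuous_two_form A \<sigma>"
  shows "\<exists>I. has_surface_integral A \<sigma> I"
proof -
  have "\<exists>c\<in>A. \<exists>V. open V \<and> x \<in> V \<and> V \<subseteq> fst c \<and> chart_integrable A c V \<sigma>" for x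
  proof -
    obtain c where c_in: "c \<in> A" "x \<in> fst c" using ex_chart by blast
    obtain a b B where B: "snd c x \<in> box a b" "B \<in> sets borel" "B \<subseteq> fst c" "snd c ` B = cbox a b"
        "cbox a b \<subseteq> snd c ` fst c"
      using chart_box[OF c_in] .
    have "continuous_on (cbox a b) (local_density A c \<sigma>)"
      using \<sigma>(2) c_in(1) unfolding continuous_two_form_def by (metis continuous_on_subset B(5))
    then have integrable: "chart_integrable A c B \<sigma>"
      unfolding chart_integrable_def B(4) by (rule absolutely_integrable_continuous)
    have V: "open (snd c -` box a b \<inter> fst c)" by (rule open_chart_preimage[OF c_in(1) open_box])
    have "snd c -` box a b \<inter> fst c \<subseteq> B"
      using inj_on_image_mem_iff[OF inj_on_chart[OF c_in(1)] _ B(3)] box_subset_cbox[of a b] B(4) by auto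
    then have "chart_integrable A c (snd c -` box a b \<inter> fst c) \<sigma>"
      by (rule chart_integrable_subset[OF integrable c_in(1) B(3) borel_open[OF V]])
    then show ?thesis using V B(1) c_in by blast
  qed
  from ex_borel_partition_subordinate[OF this] obtain n c P where P: "borel_partition A n c P"
      and integrable: "\<forall>i<n. \<exists>V. P i \<subseteq> V \<and> V \<subseteq> fst (c i) \<and> chart_integrable A (c i) V \<sigma>"
    by blast
  have "chart_integrable A (c i) (P i) \<sigma>" if "i < n" for i
    using chart_integrable_subset[OF _ _ _ borel_partitionD(4)[OF P that]] borel_partitionD(3)[OF P that]
      integrable that by blast
  then show ?thesis using has_surface_integral_partition[OF \<sigma>(1) P] by blast
qed

lemma has_surface_integral_unique:
  assumes "has_surface_integral A \<sigma> I" "has_surface_integral A \<sigma> I'"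
  shows "I = I'"
  using assms ex_borel_partition unfolding has_surface_integral_def by blast

lemma surface_integral_eqI: "has_surface_integral A \<sigma> I \<Longrightarrow> surface_integral A \<sigma> = I"
  unfolding surface_integral_def using has_surface_integral_unique by blast

lemma chart_integral_nonneg:
  assumes "nonneg_form \<sigma>" "c \<in> A" "P \<subseteq> fst c" "chart_integrable A c P \<sigma>"
  shows "0 \<le> chart_integral A c P \<sigma>"
  unfolding chart_integral_def
  using assms(3) local_density_nonneg[OF assms(1,2)]
  by (intro integral_nonneg chart_integrable_integrable_on assms(4)) blast

lemma surface_integral_nonneg:
  assumes "nonneg_form \<sigma>" "has_surface_integral A \<sigma> I"
  shows "0 \<le> I"
proof -
  obtain n c P where partition: "borel_partition A n c P" using ex_borel_partition by blast
  then have "I = (\<Sum>i<n. chart_integral A (c i) (P i) \<sigma>)"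
    using assms(2) unfolding has_surface_integral_alt by blast
  also have "\<dots> \<ge> 0"
    using assms partition borel_partitionD[OF partition] unfolding has_surface_integral_alt
    by (intro sum_nonneg chart_integral_nonneg) auto
  finally show ?thesis .
qed

lemma chart_integral_eq_0:
  assumes "nonneg_form \<sigma>" "has_surface_integral A \<sigma> 0" "c\<^sub>0 \<in> A" "B \<in> sets borel" "B \<subseteq> fst c\<^sub>0"
  shows "chart_integral A c\<^sub>0 B \<sigma> = 0"
proof -
  obtain n c P where partition: "borel_partition A (Suc n) c P" "c 0 = c\<^sub>0" "P 0 = B"
    using borel_partition_starting_with[OF assms(3-5)] .
  have sum: "(\<Sum>i<Suc n. chart_integral A (c i) (P i) \<sigma>) = 0"
    and integrable: "\<And>i. i < Suc n \<Longrightarrow> chart_integrable A (c i) (P i) \<sigma>"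
    using partition(1) assms(2) unfolding has_surface_integral_alt by blast+
  have "0 \<le> chart_integral A (c i) (P i) \<sigma>" if "i < Suc n" for i
    using borel_partitionD[OF partition(1)] integrable that
    by (intro chart_integral_nonneg[OF assms(1)]) auto
  then have "chart_integral A (c 0) (P 0) \<sigma> = 0"
    using sum sum_nonneg_eq_0_iff[of "{..<Suc n}" "\<lambda>i. chart_integral A (c i) (P i) \<sigma>"] by auto
  then show ?thesis by (simp add: partition)
qed

lemma local_density_eq_0:
  assumes "nonneg_form \<sigma>" "continuous_two_form A \<sigma>" "has_surface_integral A \<sigma> 0" "c \<in> A" "y \<in> snd c ` fst c"
  shows "local_density A c \<sigma> y = 0"
proof -
  obtain x where x_in: "x \<in> fst c" "y = snd c x" using assms(5) by blast
  obtain a b B where B: "y \<in> box a b" "B \<in> sets borel" "B \<subseteq> fst c" "snd c ` B = cbox a b"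
      "cbox a b \<subseteq> snd c ` fst c"
    using chart_box[OF assms(4) x_in(1), folded x_in(2)] .
  have cont: "continuous_on (cbox a b) (local_density A c \<sigma>)"
    using assms(2,4) unfolding continuous_two_form_def by (metis continuous_on_subset B(5))
  have "integral (cbox a b) (local_density A c \<sigma>) = 0"
    using chart_integral_eq_0[OF assms(1,3,4) B(2,3)] by (simp add: chart_integral_def B(4))
  moreover have "0 \<le> local_density A c \<sigma> z" if "z \<in> cbox a b" for z
    using local_density_nonneg[OF assms(1,4)] that B(5) by blast
  ultimately show ?thesis
    using integral_cbox_eq_0_iff[OF cont] B(1) box_subset_cbox[of a b] by blast
qed

lemma surface_integral_eq_0_iff:
  assumes "two_form \<sigma>" "nonneg_form \<sigma>" "continuous_two_form A \<sigma>" "has_surface_integral A \<sigma> I"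
  shows "I = 0 \<longleftrightarrow> (\<forall>x X Y. \<sigma> x X Y = 0)"
proof
  assume I: "I = 0"
  show "\<forall>x X Y. \<sigma> x X Y = 0"
  proof (intro allI)
    fix x X Y
    obtain k where k: "\<And>X Y. \<sigma> x X Y = k * area2 X Y" using assms(1) unfolding two_form_def by blast
    have "local_density A (chart_at A x) \<sigma> (snd (chart_at A x) x) = 0"
      using assms(4) I chart_at_mem by (intro local_density_eq_0[OF assms(2,3)]) auto
    then have "k = 0" by (simp add: local_density_def chart_inv_left[OF chart_at_mem] k area2_axis)
    then show "\<sigma> x X Y = 0" by (simp add: k)
  qed
next
  assume "\<forall>x X Y. \<sigma> x X Y = 0"
  then have "\<sigma> = (\<lambda>x X Y. 0 * \<sigma> x X Y)" by (intro ext) simp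
  then have "has_surface_integral A \<sigma> (0 * I)"
    using has_surface_integral_cmult[OF assms(4), of 0] by simp
  then show "I = 0" using has_surface_integral_unique[OF assms(4)] by simp
qed

end

section \<open>Metrics and densities\<close>

lemma area2_add_scale:
  "area2 (a *\<^sub>R X + b *\<^sub>R Y) (c *\<^sub>R X + d *\<^sub>R Y) = (a * d - b * c) * area2 X Y"
  by (simp add: area2_def algebra_simps)

lemma area2_zero_right [simp]: "area2 X 0 = 0"
  by (simp add: area2_def)

lemma area2_basis:
  assumes "area2 X Y \<noteq> 0"
  obtains a b where "Z = a *\<^sub>R X + b *\<^sub>R Y"
proof -
  have "area2 X Y *\<^sub>R Z = area2 Z Y *\<^sub>R X + area2 X Z *\<^sub>R Y"
    by (simp add: area2_def vec_eq_iff forall_2 algebra_simps)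
  then have "(1 / area2 X Y) *\<^sub>R (area2 X Y *\<^sub>R Z) =
      (area2 Z Y / area2 X Y) *\<^sub>R X + (area2 X Z / area2 X Y) *\<^sub>R Y"
    by (simp add: scaleR_add_right)
  then show ?thesis using assms by (intro that) simp
qed

locale riemannian_surface = surface_atlas A for A :: "'m::t2_space chart set" +
  fixes g :: "'m bilin"
  assumes metric: "riemannian_metric A g"
begin

lemma metric_bilinear: "bilinear (g x)"
  and metric_sym: "g x X Y = g x Y X"
  and metric_pos: "X \<noteq> 0 \<Longrightarrow> 0 < g x X X"
  using metric unfolding riemannian_metric_def by blast+

lemmas metric_linear = bilinear_ladd[OF metric_bilinear] bilinear_radd[OF metric_bilinear]
  bilinear_lmul[OF metric_bilinear] bilinear_rmul[OF metric_bilinear]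

lemma metric_zero [simp]: "g x 0 Y = 0" "g x Y 0 = 0"
  using bilinear_lzero[OF metric_bilinear] bilinear_rzero[OF metric_bilinear] by auto

lemma metric_eq_0_iff [simp]: "g x X X = 0 \<longleftrightarrow> X = 0"
  using metric_pos[of X x] by (cases "X = 0") auto

lemma metric_nonneg: "0 \<le> g x X X"
  using metric_pos[of X x] by (cases "X = 0") auto

definition oriented_orthonormal :: "'m \<Rightarrow> real^2 \<Rightarrow> real^2 \<Rightarrow> bool" where
  "oriented_orthonormal x e f \<longleftrightarrow> g x e e = 1 \<and> g x f f = 1 \<and> g x e f = 0 \<and> 0 < area2 e f"

lemma ex_oriented_orthonormal: "\<exists>e f. oriented_orthonormal x e f"
proof -
  define a b where "a = (axis 1 1 :: real^2)" and "b = (axis 2 1 :: real^2)"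
  define w where "w = b - (g x a b / g x a a) *\<^sub>R a"
  have area: "area2 a w = 1" by (simp add: area2_def axis_def a_def b_def w_def)
  then have nonzero: "a \<noteq> 0" "w \<noteq> 0" using area2_zero_right[of a] by (auto simp: area2_def)
  then have pos: "0 < g x a a" "0 < g x w w" by (auto intro: metric_pos)
  let ?e = "(1 / sqrt (g x a a)) *\<^sub>R a" and ?f = "(1 / sqrt (g x w w)) *\<^sub>R w"
  have "g x a w = 0"
    unfolding w_def using pos(1) bilinear_rsub[OF metric_bilinear] by (simp add: metric_linear)
  moreover have "0 < area2 ?e ?f"
    using area2_add_scale[of "1 / sqrt (g x a a)" a 0 w 0 "1 / sqrt (g x w w)"] area pos by simp
  ultimately have "oriented_orthonormal x ?e ?f"
    unfolding oriented_orthonormal_def using nonzero pos by (simp add: metric_linear)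
  then show ?thesis by blast
qed

lemma oriented_orthonormal_coordinates:
  assumes "oriented_orthonormal x e f"
  obtains a b where "X = a *\<^sub>R e + b *\<^sub>R f"
  using area2_basis[of e f X] assms unfolding oriented_orthonormal_def by auto

lemma metric_orthonormal:
  assumes "oriented_orthonormal x e f"
  shows "g x (a *\<^sub>R e + b *\<^sub>R f) (c *\<^sub>R e + d *\<^sub>R f) = a * c + b * d"
  using assms metric_sym[of x e f] by (simp add: oriented_orthonormal_def metric_linear)

lemma rot_orthonormal:
  assumes "oriented_orthonormal x e f"
  shows "rot g x (a *\<^sub>R e + b *\<^sub>R f) = (- b) *\<^sub>R e + a *\<^sub>R f"
  unfolding rot_def area2_def[symmetric]
proof (rule the_equality, intro conjI)
  note inner = metric_orthonormal[OF assms] and area = area2_add_scale[of _ e _ f]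
  have area_pos: "0 < area2 e f" using assms by (simp add: oriented_orthonormal_def)
  show "0 \<le> area2 (a *\<^sub>R e + b *\<^sub>R f) ((- b) *\<^sub>R e + a *\<^sub>R f)"
    unfolding area using area_pos by simp
  fix Z assume Z: "g x (a *\<^sub>R e + b *\<^sub>R f) Z = 0 \<and>
    g x Z Z = g x (a *\<^sub>R e + b *\<^sub>R f) (a *\<^sub>R e + b *\<^sub>R f) \<and> 0 \<le> area2 (a *\<^sub>R e + b *\<^sub>R f) Z"
  obtain c d where Z_eq: "Z = c *\<^sub>R e + d *\<^sub>R f" using oriented_orthonormal_coordinates[OF assms] .
  have eqs: "a * c + b * d = 0" "c * c + d * d = a * a + b * b" "0 \<le> a * d - b * c"
    using Z area_pos unfolding Z_eq inner area by (simp_all add: zero_le_mult_iff)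
  have "(a * d - b * c)\<^sup>2 = (a * a + b * b) * (c * c + d * d) - (a * c + b * d)\<^sup>2"
    by algebra
  then have "(a * d - b * c)\<^sup>2 = (a * a + b * b)\<^sup>2" unfolding eqs by (simp add: power2_eq_square)
  then have "a * d - b * c = a * a + b * b" using eqs(3) by (rule power2_eq_imp_eq) simp
  then have "(c + b)\<^sup>2 + (d - a)\<^sup>2 = 0" using eqs(2) by (simp add: power2_eq_square algebra_simps)
  then have "c = - b" "d = a" unfolding sum_power2_eq_zero_iff by linarith+
  then show "Z = (- b) *\<^sub>R e + a *\<^sub>R f" unfolding Z_eq by simp
qed (simp_all only: metric_orthonormal[OF assms], simp_all)

lemma metric_rot: "g x X (rot g x X) = 0" "g x (rot g x X) (rot g x X) = g x X X"
  and rot_rot: "rot g x (rot g x X) = - X"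
proof -
  obtain e f where orthonormal: "oriented_orthonormal x e f" using ex_oriented_orthonormal by blast
  obtain a b where "X = a *\<^sub>R e + b *\<^sub>R f" using oriented_orthonormal_coordinates[OF orthonormal] .
  then show "g x X (rot g x X) = 0" "g x (rot g x X) (rot g x X) = g x X X" "rot g x (rot g x X) = - X"
    by (simp_all only: rot_orthonormal[OF orthonormal] metric_orthonormal[OF orthonormal]) simp_all
qed

lemma vol_eq_area2: "\<exists>k>0. \<forall>X Y. vol g x X Y = k * area2 X Y"
  and vol_square: "(vol g x X Y)\<^sup>2 = g x X X * g x Y Y - (g x X Y)\<^sup>2"
proof -
  obtain e f where orthonormal: "oriented_orthonormal x e f" using ex_oriented_orthonormal by blast
  note coords = oriented_orthonormal_coordinates[OF orthonormal]
  have vol: "vol g x (a *\<^sub>R e + b *\<^sub>R f) (c *\<^sub>R e + d *\<^sub>R f) = a * d - b * c" for a b c d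
    unfolding vol_def rot_orthonormal[OF orthonormal] metric_orthonormal[OF orthonormal] by simp
  have area_pos: "0 < area2 e f" using orthonormal by (simp add: oriented_orthonormal_def)
  have "vol g x X Y = 1 / area2 e f * area2 X Y" for X Y
    by (rule coords[of X], rule coords[of Y]) (use area_pos in \<open>simp add: vol area2_add_scale\<close>)
  then show "\<exists>k>0. \<forall>X Y. vol g x X Y = k * area2 X Y" using area_pos by (metis zero_less_divide_1_iff)
  obtain a b c d where XY_eq: "X = a *\<^sub>R e + b *\<^sub>R f" "Y = c *\<^sub>R e + d *\<^sub>R f" using coords by metis
  show "(vol g x X Y)\<^sup>2 = g x X X * g x Y Y - (g x X Y)\<^sup>2"
    unfolding XY_eq vol metric_orthonormal[OF orthonormal] by algebra
qed

lemma vol_rot: "vol g x X (rot g x X) = g x X X"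
  unfolding vol_def by (rule metric_rot)

lemma vol_pos: "0 < area2 X Y \<Longrightarrow> 0 < vol g x X Y"
  using vol_eq_area2[of x] by auto

lemma rot_basis:
  assumes "X \<noteq> 0"
  obtains a b where "Y = a *\<^sub>R X + b *\<^sub>R rot g x X"
proof -
  have "vol g x X (rot g x X) \<noteq> 0" unfolding vol_rot using assms by simp
  then have "area2 X (rot g x X) \<noteq> 0" using vol_eq_area2[of x] by force
  then show ?thesis by (rule area2_basis) (rule that)
qed

lemma metric_rot_combination:
  "g x (a *\<^sub>R X + b *\<^sub>R rot g x X) (a *\<^sub>R X + b *\<^sub>R rot g x X) = (a\<^sup>2 + b\<^sup>2) * g x X X"
  by (simp add: metric_linear metric_rot metric_sym[of x "rot g x X" X] power2_eq_square algebra_simps)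

lemma K_powerI:
  assumes "\<And>X a b. X \<noteq> 0 \<Longrightarrow> k (a *\<^sub>R X + b *\<^sub>R rot g x X) = sqrt (a\<^sup>2 + b\<^sup>2) ^ n * k X"
  shows "k \<in> K_power g n x"
  unfolding K_power_def
proof (intro CollectI exI allI)
  let ?e = "axis 1 1 :: real^2"
  have e: "?e \<noteq> 0" by (simp add: axis_eq_0_iff)
  fix X
  obtain a b where X: "X = a *\<^sub>R ?e + b *\<^sub>R rot g x ?e" using rot_basis[OF e] .
  have "sqrt (g x X X) ^ n = sqrt (a\<^sup>2 + b\<^sup>2) ^ n * sqrt (g x ?e ?e) ^ n"
    unfolding X metric_rot_combination by (simp add: real_sqrt_mult power_mult_distrib)
  then show "k X = k ?e / sqrt (g x ?e ?e) ^ n * sqrt (g x X X) ^ n"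
    using assms[OF e, of a b] e unfolding X by simp
qed

lemma K_power_add: "k \<in> K_power g n x \<Longrightarrow> l \<in> K_power g n x \<Longrightarrow> (\<lambda>X. k X + l X) \<in> K_power g n x"
  unfolding K_power_def by (auto simp flip: distrib_right)

lemma K_power_cmult: "k \<in> K_power g n x \<Longrightarrow> (\<lambda>X. r * k X) \<in> K_power g n x"
  unfolding K_power_def by (auto simp flip: mult.assoc)

definition continuous_density :: "('m \<Rightarrow> real^2 \<Rightarrow> real) \<Rightarrow> bool" where
  "continuous_density q \<longleftrightarrow> (\<forall>x. q x \<in> K_power g 2 x) \<and>
     (\<forall>c\<in>A. \<forall>w. w \<noteq> 0 \<longrightarrow> continuous_on (snd c ` fst c) (local_form A c q w))"

lemma continuous_density_add:
  assumes "continuous_density p" "continuous_density q"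
  shows "continuous_density (\<lambda>x X. p x X + q x X)"
proof -
  have "local_form A c (\<lambda>x X. p x X + q x X) w = (\<lambda>y. local_form A c p w y + local_form A c q w y)" for c w
    by (simp add: local_form_def fun_eq_iff)
  then show ?thesis
    using assms K_power_add unfolding continuous_density_def by (simp add: continuous_on_add)
qed

lemma continuous_density_cmult:
  assumes "continuous_density q"
  shows "continuous_density (\<lambda>x X. r * q x X)"
proof -
  have "local_form A c (\<lambda>x X. r * q x X) w = (\<lambda>y. r * local_form A c q w y)" for c w
    by (simp add: local_form_def fun_eq_iff)
  then show ?thesis
    using assms K_power_cmult unfolding continuous_density_def by (simp add: continuous_on_mult_left)
qed

lemma continuous_densityE:
  assumes "continuous_density q"
  obtains r where "\<And>X. q x X = r * g x X X"
  using assms metric_nonneg unfolding continuous_density_def K_power_def by fastforce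

lemma two_form_density:
  assumes "continuous_density q"
  shows "two_form (form_of_density g q)"
  unfolding two_form_def
proof
  fix x
  obtain r where r: "\<And>X. q x X = r * g x X X" using continuous_densityE[OF assms, of x] by metis
  obtain k where k: "\<And>X Y. vol g x X Y = k * area2 X Y" using vol_eq_area2 by metis
  have "form_of_density g q x X Y = r * k * area2 X Y" for X Y
    unfolding form_of_density_def r k by (cases "X = 0") (auto simp: area2_def)
  then show "\<exists>k. \<forall>X Y. form_of_density g q x X Y = k * area2 X Y" by blast
qed

lemma form_of_density_eq_0_iff:
  assumes "continuous_density q"
  shows "(\<forall>X Y. form_of_density g q x X Y = 0) \<longleftrightarrow> (\<forall>X. q x X = 0)"
proof -
  obtain r where r: "\<And>X. q x X = r * g x X X" using continuous_densityE[OF assms, of x] by metis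
  have "form_of_density g q x X (rot g x X) = q x X" for X
    by (cases "X = 0") (simp_all add: form_of_density_def vol_rot r)
  moreover have "\<forall>X. q x X = 0 \<Longrightarrow> form_of_density g q x X Y = 0" for X Y
    by (simp add: form_of_density_def)
  ultimately show ?thesis by metis
qed

lemma nonneg_form_density: "(\<And>x X. 0 \<le> q x X) \<Longrightarrow> nonneg_form (form_of_density g q)"
  unfolding nonneg_form_def form_of_density_def using vol_pos metric_nonneg
  by (simp add: less_imp_le)

lemma tvec_nonzero:
  assumes "c \<in> A" "x \<in> fst c" "w \<noteq> 0"
  shows "tvec A c x w \<noteq> 0"
proof -
  have "area2 w (vector [- w$2, w$1]) = w$1 * w$1 + w$2 * w$2" by (simp add: area2_def)
  moreover have "0 < w$1 * w$1 + w$2 * w$2"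
    using assms(3) by (simp add: vec_eq_iff forall_2 sum_squares_gt_zero_iff)
  ultimately show ?thesis
    using area2_tvec_pos[OF assms(1,2), of w "vector [- w$2, w$1]"] by (auto simp: area2_def)
qed

lemma continuous_two_form_density:
  assumes q: "continuous_density q"
  shows "continuous_two_form A (form_of_density g q)"
  unfolding continuous_two_form_def
proof
  fix c assume c_in: "c \<in> A"
  let ?X = "\<lambda>y. tvec A c (chart_inv c y) (axis 1 1)" and ?Y = "\<lambda>y. tvec A c (chart_inv c y) (axis 2 1)"
    and ?g = "\<lambda>y. g (chart_inv c y)"
  have cont_g: "continuous_on (snd c ` fst c)
      (\<lambda>y. g (chart_inv c y) (tvec A c (chart_inv c y) v) (tvec A c (chart_inv c y) w))" for v w
    using metric c_in smooth_on_continuous unfolding riemannian_metric_def by blast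
  have axis_nonzero: "axis 1 1 \<noteq> (0::real^2)" by (simp add: axis_eq_0_iff)
  have "continuous_on (snd c ` fst c) (\<lambda>y. q (chart_inv c y) (?X y))"
    using q c_in axis_nonzero unfolding continuous_density_def local_form_def[abs_def] by blast
  moreover have "?g y (?X y) (?X y) \<noteq> 0" if "y \<in> snd c ` fst c" for y
    using tvec_nonzero[OF c_in chart_inv_in[OF c_in that] axis_nonzero] by simp
  ultimately have "continuous_on (snd c ` fst c) (\<lambda>y. q (chart_inv c y) (?X y) / ?g y (?X y) (?X y) *
      sqrt (?g y (?X y) (?X y) * ?g y (?Y y) (?Y y) - (?g y (?X y) (?Y y))\<^sup>2))"
    by (intro continuous_intros cont_g) auto
  then show "continuous_on (snd c ` fst c) (local_density A c (form_of_density g q))"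
  proof (rule continuous_on_eq)
    fix y assume y_in: "y \<in> snd c ` fst c"
    have "0 < vol g (chart_inv c y) (?X y) (?Y y)"
      using area2_tvec_pos[OF c_in chart_inv_in[OF c_in y_in]] by (intro vol_pos) (simp add: area2_axis)
    then show "q (chart_inv c y) (?X y) / ?g y (?X y) (?X y) *
        sqrt (?g y (?X y) (?X y) * ?g y (?Y y) (?Y y) - (?g y (?X y) (?Y y))\<^sup>2) =
        local_density A c (form_of_density g q) y"
      by (simp add: local_density_def form_of_density_def flip: vol_square)
  qed
qed

end

locale compact_riemannian_surface = riemannian_surface A g + compact_surface A
  for A :: "'m::t2_space chart set" and g :: "'m bilin"
begin

lemma has_surface_integral_density:
  assumes "continuous_density q"
  shows "has_surface_integral A (form_of_density g q) (surface_integral A (form_of_density g q))"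
  using ex_surface_integral[OF two_form_density continuous_two_form_density] surface_integral_eqI assms
  by metis

lemma integrable_continuous_density: "continuous_density q \<Longrightarrow> integrable_density A g q"
  using has_surface_integral_density[of q] has_surface_integral_unique
  unfolding integrable_density_def by (auto simp: continuous_density_def)

lemma surface_integral_density_add:
  assumes "continuous_density p" "continuous_density q"
  shows "surface_integral A (form_of_density g (\<lambda>x X. p x X + q x X)) =
    surface_integral A (form_of_density g p) + surface_integral A (form_of_density g q)"
proof (rule surface_integral_eqI)
  have "form_of_density g (\<lambda>x X. p x X + q x X) =
      (\<lambda>x X Y. form_of_density g p x X Y + form_of_density g q x X Y)"
    by (simp add: form_of_density_def fun_eq_iff add_divide_distrib distrib_right)
  then show "has_surface_integral A (form_of_density g (\<lambda>x X. p x X + q x X))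
      (surface_integral A (form_of_density g p) + surface_integral A (form_of_density g q))"
    using assms by (simp add: has_surface_integral_add has_surface_integral_density)
qed

lemma surface_integral_density_cmult:
  assumes "continuous_density q"
  shows "surface_integral A (form_of_density g (\<lambda>x X. r * q x X)) =
    r * surface_integral A (form_of_density g q)"
proof (rule surface_integral_eqI)
  have "form_of_density g (\<lambda>x X. r * q x X) = (\<lambda>x X Y. r * form_of_density g q x X Y)"
    by (simp add: form_of_density_def fun_eq_iff)
  then show "has_surface_integral A (form_of_density g (\<lambda>x X. r * q x X))
      (r * surface_integral A (form_of_density g q))"
    using assms by (simp add: has_surface_integral_cmult has_surface_integral_density)
qed

lemma surface_integral_density_nonneg:
  assumes "continuous_density q" "\<And>x X. 0 \<le> q x X"
  shows "0 \<le> surface_integral A (form_of_density g q)"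
  by (rule surface_integral_nonneg[OF nonneg_form_density has_surface_integral_density]) (fact assms)+

lemma surface_integral_density_eq_0_iff:
  assumes "continuous_density q" "\<And>x X. 0 \<le> q x X"
  shows "surface_integral A (form_of_density g q) = 0 \<longleftrightarrow> (\<forall>x X. q x X = 0)"
  using surface_integral_eq_0_iff[OF two_form_density nonneg_form_density continuous_two_form_density
      has_surface_integral_density, OF assms(1,2,1,1)] form_of_density_eq_0_iff[OF assms(1)] by simp

end

section \<open>Primitives of 1-forms without periods\<close>

primrec curve_chain :: "'m::t2_space chart set \<Rightarrow> 'm \<Rightarrow> (real \<Rightarrow> 'm) list \<Rightarrow> 'm \<Rightarrow> bool" where
  "curve_chain A x [] y \<longleftrightarrow> x = y"
| "curve_chain A x (\<gamma> # \<gamma>s) y \<longleftrightarrow> smooth_curve A \<gamma> \<and> \<gamma> 0 = x \<and> curve_chain A (\<gamma> 1) \<gamma>s y"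

lemma curve_chain_append:
  "curve_chain A x \<gamma>s y \<Longrightarrow> curve_chain A y \<delta>s z \<Longrightarrow> curve_chain A x (\<gamma>s @ \<delta>s) z"
  by (induction \<gamma>s arbitrary: x) auto

lemma curve_chain_smooth: "curve_chain A x \<gamma>s y \<Longrightarrow> \<gamma> \<in> set \<gamma>s \<Longrightarrow> smooth_curve A \<gamma>"
  by (induction \<gamma>s arbitrary: x) auto

lemma curve_chain_start: "curve_chain A x \<gamma>s y \<Longrightarrow> \<gamma>s \<noteq> [] \<Longrightarrow> (\<gamma>s ! 0) 0 = x"
  by (cases \<gamma>s) auto

lemma curve_chain_nth_end:
  "curve_chain A x \<gamma>s y \<Longrightarrow> i < length \<gamma>s \<Longrightarrow>
    (\<gamma>s ! i) 1 = (if Suc i < length \<gamma>s then (\<gamma>s ! Suc i) 0 else y)"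
proof (induction \<gamma>s arbitrary: x i)
  case (Cons \<gamma> \<gamma>s)
  then show ?case
    using curve_chain_start[of A "\<gamma> 1" \<gamma>s y] by (cases i) auto
qed simp

lemma curve_chain_closed:
  assumes "curve_chain A x \<gamma>s x" "\<gamma>s \<noteq> []"
  shows "closed_curve A \<gamma>s"
proof -
  have "(\<gamma>s ! i) 1 = (\<gamma>s ! (Suc i mod length \<gamma>s)) 0" if "i < length \<gamma>s" for i
  proof (cases "Suc i < length \<gamma>s")
    case False
    then have "Suc i = length \<gamma>s" using that by simp
    then show ?thesis using curve_chain_nth_end[OF assms(1) that] curve_chain_start[OF assms] by simp
  qed (use curve_chain_nth_end[OF assms(1) that] in simp)
  then show ?thesis
    unfolding closed_curve_def using assms(2) curve_chain_smooth[OF assms(1)] by blast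
qed

lemma curve_integral_append: "curve_integral A \<alpha> (\<gamma>s @ \<delta>s) = curve_integral A \<alpha> \<gamma>s + curve_integral A \<alpha> \<delta>s"
  by (simp add: curve_integral_def)

context surface_atlas
begin

lemma smooth_curve_reverse:
  assumes "smooth_curve A \<gamma>"
  shows "smooth_curve A (\<lambda>t. \<gamma> (1 - t))"
proof -
  obtain T where T: "open T" "{0..1} \<subseteq> T" "continuous_on T \<gamma>"
      "\<And>c. c \<in> A \<Longrightarrow> smooth_on (T \<inter> \<gamma> -` fst c) (snd c \<circ> \<gamma>)"
    using assms unfolding smooth_curve_def by blast
  let ?r = "\<lambda>t::real. 1 - t"
  have open_r: "open (?r -` S)" if "open S" for S
    using that by (intro open_vimage continuous_intros) auto
  have "smooth_on (?r -` T \<inter> (\<lambda>t. \<gamma> (1 - t)) -` fst c) (snd c \<circ> (\<lambda>t. \<gamma> (1 - t)))" if c_in: "c \<in> A" for c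
  proof -
    have "open (?r -` (T \<inter> \<gamma> -` fst c))"
      using open_r continuous_open_preimage[OF T(3,1) open_chart_domain[OF c_in]] by blast
    then have "smooth_on (?r -` (T \<inter> \<gamma> -` fst c)) (\<lambda>t. (snd c \<circ> \<gamma>) (1 + - t))"
      by (rule smooth_on_compose_affine
          [OF bounded_linear_minus[OF bounded_linear_ident] _ _ T(4)[OF c_in]]) simp
    moreover have "?r -` T \<inter> (\<lambda>t. \<gamma> (1 - t)) -` fst c = ?r -` (T \<inter> \<gamma> -` fst c)" by auto
    ultimately show ?thesis by (simp add: o_def)
  qed
  moreover have "continuous_on (?r -` T) (\<lambda>t. \<gamma> (1 - t))"
    by (rule continuous_on_compose2[OF T(3)]) (auto intro!: continuous_intros)
  moreover have "{0..1} \<subseteq> ?r -` T" by (auto intro!: subsetD[OF T(2)])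
  ultimately show ?thesis unfolding smooth_curve_def using open_r[OF T(1)] by blast
qed

lemma curve_chain_reverse: "curve_chain A x \<gamma>s y \<Longrightarrow> \<exists>\<delta>s. curve_chain A y \<delta>s x"
proof (induction \<gamma>s arbitrary: x)
  case Nil
  then show ?case by (auto intro: exI[of _ "[]"])
next
  case (Cons \<gamma> \<gamma>s)
  then obtain \<delta>s where "curve_chain A y \<delta>s (\<gamma> 1)" by auto
  moreover have "curve_chain A (\<gamma> 1) [\<lambda>t. \<gamma> (1 - t)] x"
    using Cons.prems smooth_curve_reverse by auto
  ultimately show ?case using curve_chain_append by blast
qed

lemma smooth_curve_segment:
  assumes c_in: "c \<in> A" and segment: "\<And>t. t \<in> {0..1} \<Longrightarrow> y + t *\<^sub>R h \<in> snd c ` fst c"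
  shows "smooth_curve A (\<lambda>t. chart_inv c (y + t *\<^sub>R h))"
proof -
  let ?l = "\<lambda>t::real. y + t *\<^sub>R h" and ?R = "snd c ` fst c"
  have open_l: "open (?l -` S)" if "open S" for S
    using that by (intro open_vimage continuous_intros) auto
  have "smooth_on (?l -` ?R \<inter> (\<lambda>t. chart_inv c (?l t)) -` fst d) (snd d \<circ> (\<lambda>t. chart_inv c (?l t)))"
    if d_in: "d \<in> A" for d
  proof -
    have "open (?l -` (snd c ` (fst c \<inter> fst d)))"
      using open_l[OF open_chart_image[OF c_in open_chart_domain[OF d_in]]] by (simp add: Int_commute)
    then have "smooth_on (?l -` (snd c ` (fst c \<inter> fst d))) (\<lambda>t. (snd d \<circ> chart_inv c) (?l t))"
      by (rule smooth_on_compose_affine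
          [OF bounded_linear_scaleR_left _ _ smooth_transition[OF c_in d_in]]) simp
    moreover have "?l -` ?R \<inter> (\<lambda>t. chart_inv c (?l t)) -` fst d = ?l -` (snd c ` (fst c \<inter> fst d))"
      using chart_image_eq_vimage[OF c_in, of "fst d"] by (auto simp: Int_commute)
    ultimately show ?thesis by (simp add: o_def)
  qed
  moreover have "continuous_on (?l -` ?R) (\<lambda>t. chart_inv c (?l t))"
    by (rule continuous_on_compose2[OF continuous_chart_inv[OF c_in]]) (auto intro!: continuous_intros)
  moreover have "{0..1} \<subseteq> ?l -` ?R" using segment by auto
  ultimately show ?thesis unfolding smooth_curve_def using open_l[OF open_chart_range[OF c_in]] by blast
qed

lemma velocity_segment:
  assumes c_in: "c \<in> A" and t: "y + t *\<^sub>R h \<in> snd c ` fst c"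
  shows "velocity A (\<lambda>t. chart_inv c (y + t *\<^sub>R h)) t = tvec A c (chart_inv c (y + t *\<^sub>R h)) h"
proof -
  let ?x = "chart_inv c (y + t *\<^sub>R h)"
  have x_in: "?x \<in> fst c" "snd c ?x = y + t *\<^sub>R h" using c_in t by auto
  have "((snd (chart_at A ?x) \<circ> chart_inv c) has_derivative tvec A c ?x) (at (y + t *\<^sub>R h))"
    using transition_has_derivative[OF c_in x_in(1) chart_at_mem]
    unfolding x_in(2) tvec_eq_transition_derivative .
  from has_vector_derivative_along_line[OF this] show ?thesis
    unfolding velocity_def by (simp add: o_def vector_derivative_at)
qed

lemma curve_integral_segment:
  assumes c_in: "c \<in> A" and segment: "\<And>t. t \<in> {0..1} \<Longrightarrow> y + t *\<^sub>R h \<in> snd c ` fst c"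
  shows "curve_integral A \<alpha> [\<lambda>t. chart_inv c (y + t *\<^sub>R h)] =
    integral {0..1} (\<lambda>t. local_form A c \<alpha> h (y + t *\<^sub>R h))"
  unfolding curve_integral_def
  using velocity_segment[OF c_in segment] by (auto simp: local_form_def intro!: integral_cong)

lemma primitive_along_chains:
  fixes \<alpha> :: "'m \<Rightarrow> real^2 \<Rightarrow> 'b::euclidean_space"
  assumes no_periods: "\<And>\<gamma>s. closed_curve A \<gamma>s \<Longrightarrow> curve_integral A \<alpha> \<gamma>s = 0"
  obtains F where "\<And>x \<gamma>s y. curve_chain A x \<gamma>s y \<Longrightarrow> F y = F x + curve_integral A \<alpha> \<gamma>s"
proof -
  \<comment> \<open>The surface need not be connected: \<open>base x\<close> is a base point in the component of \<open>x\<close>.\<close>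
  define base where "base x = (SOME b. \<exists>\<gamma>s. curve_chain A x \<gamma>s b)" for x
  have base_eq: "base x = base y" if "curve_chain A x \<gamma>s y" for x y \<gamma>s
  proof -
    have "(\<exists>\<delta>s. curve_chain A x \<delta>s b) \<longleftrightarrow> (\<exists>\<delta>s. curve_chain A y \<delta>s b)" for b
      using that curve_chain_reverse[OF that] curve_chain_append by blast
    then show ?thesis by (simp add: base_def)
  qed
  have "\<exists>\<gamma>s. curve_chain A x \<gamma>s (base x)" for x
    unfolding base_def by (rule someI_ex) (metis curve_chain.simps(1))
  then have "\<exists>\<gamma>s. curve_chain A (base x) \<gamma>s x" for x
    using curve_chain_reverse by blast
  then obtain p where p: "\<And>x. curve_chain A (base x) (p x) x" by metis
  have zero: "curve_integral A \<alpha> \<gamma>s = 0" if "curve_chain A x \<gamma>s x" for x \<gamma>s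
    using curve_chain_closed[OF that] no_periods by (cases "\<gamma>s = []") (auto simp: curve_integral_def)
  show ?thesis
  proof (rule that[of "\<lambda>x. curve_integral A \<alpha> (p x)"])
    fix x \<gamma>s y assume chain: "curve_chain A x \<gamma>s y"
    obtain \<delta>s where \<delta>s: "curve_chain A y \<delta>s (base x)"
      using curve_chain_reverse[OF p[of y]] base_eq[OF chain] by auto
    have "curve_integral A \<alpha> (p x @ \<gamma>s @ \<delta>s) = 0"
      using curve_chain_append[OF p curve_chain_append[OF chain \<delta>s]] zero by blast
    moreover have "curve_integral A \<alpha> (p y @ \<delta>s) = 0"
      using curve_chain_append[OF p[of y] \<delta>s] base_eq[OF chain] zero by metis
    ultimately show "curve_integral A \<alpha> (p y) = curve_integral A \<alpha> (p x) + curve_integral A \<alpha> \<gamma>s"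
      by (simp add: curve_integral_append) (metis add.assoc add_right_cancel)
  qed
qed

lemma has_derivative_primitive:
  fixes \<alpha> :: "'m \<Rightarrow> real^2 \<Rightarrow> 'b::euclidean_space"
  assumes \<alpha>: "smooth_form A UNIV \<alpha>" and c_in: "c \<in> A" "y \<in> snd c ` fst c"
    and F: "\<And>x \<gamma>s y. curve_chain A x \<gamma>s y \<Longrightarrow> F y = F x + curve_integral A \<alpha> \<gamma>s"
  shows "((F \<circ> chart_inv c) has_derivative (\<lambda>w. local_form A c \<alpha> w y)) (at y)"
proof (rule has_derivative_of_line_integrals[OF open_chart_range[OF c_in(1)] c_in(2)])
  show "linear (\<lambda>w. local_form A c \<alpha> w z)" if "z \<in> snd c ` fst c" for z
    using \<alpha> that c_in by (intro linear_local_form) (auto simp: smooth_form_def)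
  show "continuous_on (snd c ` fst c) (local_form A c \<alpha> w)" for w
    by (rule smooth_on_continuous[OF smooth_form_local[OF \<alpha> c_in(1)]])
  fix h assume segment: "\<And>t. t \<in> {0..1} \<Longrightarrow> y + t *\<^sub>R h \<in> snd c ` fst c"
  have "curve_chain A (chart_inv c y) [\<lambda>t. chart_inv c (y + t *\<^sub>R h)] (chart_inv c (y + h))"
    using smooth_curve_segment[OF c_in(1) segment] by simp
  from F[OF this] show "(F \<circ> chart_inv c) (y + h) =
      (F \<circ> chart_inv c) y + integral {0..1} (\<lambda>t. local_form A c \<alpha> h (y + t *\<^sub>R h))"
    using curve_integral_segment[OF c_in(1) segment, of \<alpha>] by simp
qed

lemma ex_primitive:
  fixes \<alpha> :: "'m \<Rightarrow> real^2 \<Rightarrow> 'b::euclidean_space"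
  assumes \<alpha>: "smooth_form A UNIV \<alpha>"
    and no_periods: "\<And>\<gamma>s. closed_curve A \<gamma>s \<Longrightarrow> curve_integral A \<alpha> \<gamma>s = 0"
  obtains F where "smooth_map A UNIV F" "differential A F = \<alpha>"
proof -
  obtain F where F: "\<And>x \<gamma>s y. curve_chain A x \<gamma>s y \<Longrightarrow> F y = F x + curve_integral A \<alpha> \<gamma>s"
    using primitive_along_chains[of \<alpha>] no_periods by blast
  note deriv = has_derivative_primitive[OF \<alpha> _ _ F]
  have "smooth_map A UNIV F"
    unfolding smooth_map_def
  proof
    fix c assume c_in: "c \<in> A"
    show "smooth_on (snd c ` (UNIV \<inter> fst c)) (F \<circ> chart_inv c)"
      using smooth_onI[OF open_chart_range[OF c_in] deriv[OF c_in] smooth_form_local[OF \<alpha> c_in]] by simp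
  qed
  moreover have "differential A F x X = \<alpha> x X" for x X
  proof -
    have "snd (chart_at A x) x \<in> snd (chart_at A x) ` fst (chart_at A x)" using chart_at_mem(2) by blast
    from frechet_derivative_at[OF deriv[OF chart_at_mem(1) this], THEN fun_cong]
    show ?thesis
      unfolding differential_def local_form_def chart_inv_left[OF chart_at_mem] by simp
  qed
  ultimately show ?thesis by (intro that) (auto simp: fun_eq_iff)
qed

end

section \<open>Quaternions\<close>

lemmas quat_simps = qmult_def qcnj_def qreal_def prod_eq_iff vec_eq_iff forall_3 cross3_def inner_vec_def
  sum_3 inner_prod_def

lemma bounded_bilinear_qmult: "bounded_bilinear (\<odot>)"
  unfolding bilinear_conv_bounded_bilinear[symmetric] bilinear_def linear_iff
  by (simp add: quat_simps algebra_simps)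

interpretation qmult: bounded_bilinear "(\<odot>)"
  by (rule bounded_bilinear_qmult)

lemma bounded_linear_qcnj: "bounded_linear qcnj"
  by (simp add: linear_iff quat_simps flip: linear_conv_bounded_linear)

declare qmult.zero_left [simp] qmult.zero_right [simp]

lemma qmult_assoc: "(p \<odot> q) \<odot> r = p \<odot> (q \<odot> r)"
  by (simp add: quat_simps algebra_simps)

lemma qmult_qreal [simp]: "q \<odot> qreal a = a *\<^sub>R q" "qreal a \<odot> q = a *\<^sub>R q"
  by (simp_all add: quat_simps algebra_simps)

lemma qcnj_zero [simp]: "qcnj 0 = 0"
  and qcnj_qreal [simp]: "qcnj (qreal a) = qreal a"
  and qcnj_add: "qcnj (p + q) = qcnj p + qcnj q"
  and qcnj_minus [simp]: "qcnj (- q) = - qcnj q"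
  and qcnj_scaleR [simp]: "qcnj (a *\<^sub>R q) = a *\<^sub>R qcnj q"
  by (simp_all add: quat_simps)

lemma qcnj_qmult: "qcnj (p \<odot> q) = qcnj q \<odot> qcnj p"
  by (simp add: quat_simps algebra_simps)

lemma qcnj_qmult_self: "qcnj q \<odot> q = qreal ((norm q)\<^sup>2)" "q \<odot> qcnj q = qreal ((norm q)\<^sup>2)"
  by (simp_all add: power2_norm_eq_inner quat_simps algebra_simps)

lemma inner_eq_qmult: "p \<bullet> q = fst (qcnj p \<odot> q)"
  by (simp add: quat_simps)

lemma inner_qmult_left: "(u \<odot> p) \<bullet> (u \<odot> q) = (norm u)\<^sup>2 * (p \<bullet> q)"
proof -
  have "qcnj (u \<odot> p) \<odot> (u \<odot> q) = qcnj p \<odot> ((qcnj u \<odot> u) \<odot> q)"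
    by (simp only: qcnj_qmult qmult_assoc)
  also have "\<dots> = (norm u)\<^sup>2 *\<^sub>R (qcnj p \<odot> q)"
    by (simp add: qcnj_qmult_self qmult.scaleR_right)
  finally show ?thesis unfolding inner_eq_qmult by simp
qed

lemma norm_qmult: "norm (p \<odot> q) = norm p * norm q"
proof -
  have "(norm (p \<odot> q))\<^sup>2 = (norm p * norm q)\<^sup>2"
    using inner_qmult_left[of p q q] by (simp add: power2_norm_eq_inner power_mult_distrib)
  then show ?thesis by (simp add: power2_eq_iff_nonneg)
qed

definition qinv :: "quat \<Rightarrow> quat" where
  "qinv q = (1 / (norm q)\<^sup>2) *\<^sub>R qcnj q"

lemma qmult_qinv: "q \<noteq> 0 \<Longrightarrow> q \<odot> qinv q = qreal 1" "q \<noteq> 0 \<Longrightarrow> qinv q \<odot> q = qreal 1"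
  by (simp_all add: qinv_def qmult.scaleR_left qmult.scaleR_right qcnj_qmult_self) (simp_all add: qreal_def)

lemma norm_square_eq_minus_one:
  assumes "n \<odot> n = - qreal 1"
  shows "norm n = 1"
proof -
  have "norm n * norm n = 1"
    unfolding norm_qmult[symmetric] assms by (simp add: qreal_def norm_Pair)
  then show ?thesis using square_eq_1_iff[of "norm n"] norm_ge_zero[of n] by linarith
qed

lemma qcnj_square_eq_minus_one:
  assumes "n \<odot> n = - qreal 1"
  shows "qcnj n = - n"
proof -
  have "- qcnj n = qcnj n \<odot> (n \<odot> n)" by (simp add: assms qmult.minus_right)
  also have "\<dots> = n" by (simp add: qcnj_qmult_self norm_square_eq_minus_one[OF assms] flip: qmult_assoc)
  finally show ?thesis by (simp add: minus_equation_iff)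
qed

lemma qcnj_qmult_add_qmult_eq_0_iff:
  assumes t: "qcnj t = - t"
  shows "qcnj m \<odot> t + t \<odot> m = 0 \<longleftrightarrow> (\<exists>k. m = k *\<^sub>R t) \<or> t = 0"
proof
  assume "qcnj m \<odot> t + t \<odot> m = 0"
  then have "qcnj (t \<odot> m) = t \<odot> m"
    by (simp add: qcnj_qmult t qmult.minus_right add_eq_0_iff2)
  then have real: "t \<odot> m = qreal (fst (t \<odot> m))" by (simp add: qcnj_def qreal_def prod_eq_iff vec_eq_iff)
  have "(norm t)\<^sup>2 *\<^sub>R m = (qcnj t \<odot> t) \<odot> m" by (simp add: qcnj_qmult_self)
  also have "\<dots> = - (t \<odot> (t \<odot> m))" by (simp add: t qmult.minus_left qmult_assoc)
  also have "\<dots> = (- fst (t \<odot> m)) *\<^sub>R t" by (subst real) simp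
  finally have "(norm t)\<^sup>2 *\<^sub>R m = (- fst (t \<odot> m)) *\<^sub>R t" .
  then have "m = (- fst (t \<odot> m) / (norm t)\<^sup>2) *\<^sub>R t" if "t \<noteq> 0"
    using that by (subst eq_vector_fraction_iff) simp
  then show "(\<exists>k. m = k *\<^sub>R t) \<or> t = 0" by blast
next
  assume "(\<exists>k. m = k *\<^sub>R t) \<or> t = 0"
  then show "qcnj m \<odot> t + t \<odot> m = 0"
    by (auto simp: t qmult.minus_left qmult.scaleR_left qmult.scaleR_right)
qed

lemma bounded_linear_qimag: "bounded_linear qimag"
  by (rule bounded_linear_intro[where K=1]) (simp_all add: qimag_def norm_Pair)

lemma norm_qimag [simp]: "norm (qimag v) = norm v"
  by (simp add: qimag_def norm_Pair)

section \<open>Quaternionic line bundles\<close>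

locale line_bundle = surface_atlas A for A :: "'m::t2_space chart set" +
  fixes L :: "('m, 'l) spin_data"
  assumes is_bundle: "quaternionic_line_bundle A L"
begin

lemma lproj_lscale [simp]: "lproj L (lscale L v q) = lproj L v"
  and lscale_one [simp]: "lscale L v (qreal 1) = v"
  and lscale_lscale [simp]: "lscale L (lscale L v p) q = lscale L v (p \<odot> q)"
  and lscale_add: "lscale L v (p + q) = ladd L (lscale L v p) (lscale L v q)"
  using is_bundle unfolding quaternionic_line_bundle_def by (elim conjE, iprover)+

lemma lneg_lscale: "lneg L (lscale L v q) = lscale L v (- q)"
  by (simp add: lneg_def)

lemma ex_frame: "\<exists>U t. (U, t) \<in> lframes L \<and> x \<in> U"
proof -
  have "(\<Union>(U, s)\<in>lframes L. U) = UNIV"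
    using is_bundle unfolding quaternionic_line_bundle_def by (elim conjE)
  then have "x \<in> (\<Union>(U, s)\<in>lframes L. U)" by simp
  then show ?thesis by auto
qed

lemma frame:
  assumes "(U, t) \<in> lframes L"
  shows "open U" "x \<in> U \<Longrightarrow> lproj L (t x) = x"
    "x \<in> U \<Longrightarrow> lproj L v = x \<Longrightarrow> \<exists>!q. v = lscale L (t x) q"
proof -
  have "\<forall>(U, s)\<in>lframes L. open U \<and>
      (\<forall>x\<in>U. lproj L (s x) = x \<and> (\<forall>v. lproj L v = x \<longrightarrow> (\<exists>!q. v = lscale L (s x) q)))"
    using is_bundle unfolding quaternionic_line_bundle_def by (elim conjE)
  from bspec[OF this assms] show "open U" "x \<in> U \<Longrightarrow> lproj L (t x) = x"
    "x \<in> U \<Longrightarrow> lproj L v = x \<Longrightarrow> \<exists>!q. v = lscale L (t x) q"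
    by auto
qed

lemma frame_not_lzero:
  assumes "(U, t) \<in> lframes L" "x \<in> U"
  shows "\<not> lzero L (t x)"
proof
  assume "lzero L (t x)"
  then have "t x = lscale L (t x) 0" "t x = lscale L (t x) (qreal 1)" by (simp_all add: lzero_def)
  then have "0 = qreal 1" using frame(3)[OF assms frame(2)[OF assms]] by metis
  then show False by (simp add: qreal_def zero_prod_def)
qed

lemma ex1_coef:
  assumes "\<not> lzero L b" "lproj L v = lproj L b"
  shows "\<exists>!q. v = lscale L b q"
proof -
  obtain U t where t_frame: "(U, t) \<in> lframes L" "lproj L b \<in> U" using ex_frame by blast
  define e where "e = t (lproj L b)"
  have unique: "p = q" if "lscale L e p = lscale L e q" for p q
    using frame(3)[OF t_frame, of "lscale L e p"] frame(2)[OF t_frame] that by (metis e_def lproj_lscale)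
  obtain p q where b: "b = lscale L e p" and v: "v = lscale L e q"
    using frame(3)[OF t_frame] assms(2) e_def by metis
  have "p \<noteq> 0" using assms(1) b by (auto simp: lzero_def)
  note inverse = qmult_qinv[OF this]
  show ?thesis
  proof (rule ex1I)
    show "v = lscale L b (qinv p \<odot> q)" by (simp add: b v inverse(1) flip: qmult_assoc)
    fix r assume "v = lscale L b r"
    then have "q = p \<odot> r" using unique by (simp add: b v)
    then show "r = qinv p \<odot> q" by (simp add: inverse(2) flip: qmult_assoc)
  qed
qed

lemma lscale_coef: "\<not> lzero L b \<Longrightarrow> lproj L v = lproj L b \<Longrightarrow> lscale L b (coef L b v) = v"
  unfolding coef_def using theI'[OF ex1_coef] by metis

lemma coef_lscale: "\<not> lzero L b \<Longrightarrow> coef L b (lscale L b q) = q"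
  unfolding coef_def by (rule the1_equality[OF ex1_coef]) simp_all

lemma coef_nonzero:
  assumes "\<not> lzero L b" "\<not> lzero L v" "lproj L v = lproj L b"
  shows "coef L b v \<noteq> 0"
proof
  assume "coef L b v = 0"
  then have "v = lscale L b 0" using lscale_coef[OF assms(1,3)] by simp
  then show False using assms(2) by (simp add: lzero_def)
qed

lemma coef_change_basis:
  assumes "\<not> lzero L b" "\<not> lzero L t" "lproj L b = lproj L t" "lproj L v = lproj L t"
  shows "coef L b v = qinv (coef L t b) \<odot> coef L t v"
proof -
  have "lscale L t (coef L t b \<odot> coef L b v) = v"
    using lscale_coef[OF assms(2,3)] lscale_coef[OF assms(1)] assms(3,4) by (metis lscale_lscale)
  then have "coef L t v = coef L t b \<odot> coef L b v" using coef_lscale[OF assms(2)] by metis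
  then show ?thesis
    by (simp add: qmult_qinv(2)[OF coef_nonzero[OF assms(2,1,3)]] flip: qmult_assoc)
qed

lemma smooth_map_section_coef:
  "\<psi> \<in> section_of A L \<Longrightarrow> (U, t) \<in> lframes L \<Longrightarrow> smooth_map A U (\<lambda>x. coef L (t x) (\<psi> x))"
  unfolding section_of_def by blast

lemma smooth_on_section_coef:
  assumes "\<psi> \<in> section_of A L" "(U, t) \<in> lframes L" "c \<in> A"
  shows "smooth_on (snd c ` (U \<inter> fst c)) (\<lambda>y. coef L (t (chart_inv c y)) (\<psi> (chart_inv c y)))"
  using smooth_map_section_coef[OF assms(1,2)] assms(3) unfolding smooth_map_def by (simp add: o_def)

lemma ck_on_chart_frames:
  assumes "c \<in> A" "\<And>U t. (U, t) \<in> lframes L \<Longrightarrow> ck_on n (snd c ` (U \<inter> fst c)) f"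
  shows "ck_on n (snd c ` fst c) f"
proof (rule ck_on_local)
  fix y assume "y \<in> snd c ` fst c"
  then obtain x where x_in: "x \<in> fst c" "y = snd c x" by blast
  obtain U t where t_frame: "(U, t) \<in> lframes L" "x \<in> U" using ex_frame by blast
  show "\<exists>T. open T \<and> y \<in> T \<and> ck_on n T f"
    using x_in t_frame assms(2)[OF t_frame(1)] open_chart_image[OF assms(1) frame(1)[OF t_frame(1)]]
    by (intro exI[of _ "snd c ` (U \<inter> fst c)"]) auto
qed

end

section \<open>The form of a nowhere vanishing spinor\<close>

locale spin_surface = riemannian_surface A g for A :: "'m::t2_space chart set" and g :: "'m bilin" +
  fixes L :: "('m, 'l) spin_data"
  assumes spin: "spin_bundle A g L"

sublocale spin_surface \<subseteq> line_bundle A L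
  using spin by unfold_locales (simp add: spin_bundle_def)

context spin_surface
begin

lemma linear_spair: "lproj L v = lproj L w \<Longrightarrow> linear (spair L v w)"
  and spair_lscale: "lproj L v = lproj L w \<Longrightarrow>
    spair L (lscale L v p) (lscale L w q) X = qcnj p \<odot> spair L v w X \<odot> q"
  and qcnj_spair: "lproj L v = lproj L w \<Longrightarrow> qcnj (spair L v w X) = - spair L w v X"
  and spair_nonzero: "\<not> lzero L v \<Longrightarrow> X \<noteq> 0 \<Longrightarrow> spair L v v X \<noteq> 0"
  and smooth_form_frame_spair: "(U, t) \<in> lframes L \<Longrightarrow> smooth_form A U (\<lambda>x. spair L (t x) (t x))"
  using spin unfolding spin_bundle_def spin_pairing_def by blast+

end

locale spinor = spin_surface A g L
  for A :: "'m::t2_space chart set" and g :: "'m bilin" and L :: "('m, 'l) spin_data" +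
  fixes \<psi> :: "'m \<Rightarrow> 'l"
  assumes nonvanishing: "\<psi> \<in> nonvanishing_section A L"
begin

lemma section_spinor: "\<psi> \<in> section_of A L"
  and lproj_spinor [simp]: "lproj L (\<psi> x) = x"
  and spinor_not_lzero: "\<not> lzero L (\<psi> x)"
  using nonvanishing unfolding nonvanishing_section_def section_of_def by auto

lemmas lscale_coef_spinor = lscale_coef[OF spinor_not_lzero, unfolded lproj_spinor]

lemma lscale_spinor_inject: "lscale L (\<psi> x) p = lscale L (\<psi> x) q \<longleftrightarrow> p = q"
  using coef_lscale[OF spinor_not_lzero] by metis

definition spinor_form :: "'m \<Rightarrow> real^2 \<Rightarrow> quat" where
  "spinor_form x = spair L (\<psi> x) (\<psi> x)"

lemma linear_spinor_form: "linear (spinor_form x)"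
  unfolding spinor_form_def by (rule linear_spair) simp

lemma qcnj_spinor_form: "qcnj (spinor_form x X) = - spinor_form x X"
  unfolding spinor_form_def by (rule qcnj_spair) simp

lemma spinor_form_eq_0_iff [simp]: "spinor_form x X = 0 \<longleftrightarrow> X = 0"
  using spair_nonzero[OF spinor_not_lzero] linear_0[OF linear_spinor_form]
  unfolding spinor_form_def by metis

lemma spinor_form_zero [simp]: "spinor_form x 0 = 0"
  by simp

lemma spair_spinor: "spair L (lscale L (\<psi> x) p) (lscale L (\<psi> x) q) X = qcnj p \<odot> spinor_form x X \<odot> q"
  unfolding spinor_form_def by (rule spair_lscale) simp

lemma lnorm2_spinor: "lnorm2 L (lscale L (\<psi> x) p) X = (norm p)\<^sup>2 * norm (spinor_form x X)"
proof -
  have "norm (qcnj p) = norm p" by (simp add: norm_eq_sqrt_inner quat_simps)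
  then show ?thesis unfolding lnorm2_def spair_spinor by (simp add: norm_qmult power2_eq_square)
qed

lemma linner_spinor:
  "linner L (lscale L (\<psi> x) p) (lscale L (\<psi> x) q) X = (p \<bullet> q) * norm (spinor_form x X)"
proof -
  have "linner L (lscale L (\<psi> x) p) (lscale L (\<psi> x) q) X =
      ((norm (p + q))\<^sup>2 - (norm p)\<^sup>2 - (norm q)\<^sup>2) / 2 * norm (spinor_form x X)"
    unfolding linner_def lscale_add[symmetric] lnorm2_spinor by (simp add: left_diff_distrib)
  then show ?thesis
    unfolding power2_norm_eq_inner by (simp add: inner_add_left inner_add_right inner_commute)
qed

lemma metric_constraint_iff: "metric_constraint g L \<psi> \<longleftrightarrow> (\<forall>x X. (norm (spinor_form x X))\<^sup>2 = g x X X)"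
  unfolding metric_constraint_def lnorm2_def spinor_form_def ..

lemma smooth_spinor_form: "smooth_form A UNIV spinor_form"
  unfolding smooth_form_def
proof (intro conjI ballI allI)
  fix c w assume c_in: "c \<in> A"
  have "smooth_on (snd c ` (U \<inter> fst c)) (local_form A c spinor_form w)"
    if t_frame: "(U, t) \<in> lframes L" for U t
  proof -
    let ?S = "snd c ` (U \<inter> fst c)" and ?p = "\<lambda>y. coef L (t (chart_inv c y)) (\<psi> (chart_inv c y))"
    let ?\<sigma> = "local_form A c (\<lambda>x. spair L (t x) (t x)) w"
    have S: "open ?S" using open_chart_image[OF c_in frame(1)[OF t_frame]] .
    have "smooth_on ?S ?p" using smooth_on_section_coef[OF section_spinor t_frame c_in] .
    moreover have "smooth_on ?S ?\<sigma>"
      using smooth_form_frame_spair[OF t_frame] c_in unfolding smooth_form_def by blast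
    ultimately have "smooth_on ?S (\<lambda>y. qcnj (?p y) \<odot> ?\<sigma> y \<odot> ?p y)"
      by (intro smooth_on_bounded_bilinear[OF bounded_bilinear_qmult S]
          smooth_on_bounded_linear[OF bounded_linear_qcnj S])
    moreover have "qcnj (?p y) \<odot> ?\<sigma> y \<odot> ?p y = local_form A c spinor_form w y" if "y \<in> ?S" for y
    proof -
      have "chart_inv c y \<in> U" using that c_in by auto
      then have "\<psi> (chart_inv c y) = lscale L (t (chart_inv c y)) (?p y)"
        using lscale_coef[OF frame_not_lzero[OF t_frame]] frame(2)[OF t_frame] by simp
      then show ?thesis
        unfolding local_form_def spinor_form_def using spair_lscale[OF refl] by metis
    qed
    ultimately show ?thesis using smooth_on_cong[OF S] by (metis (no_types, lifting))
  qed
  then show "smooth_on (snd c ` (UNIV \<inter> fst c)) (local_form A c spinor_form w)"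
    unfolding smooth_on_def by (simp add: ck_on_chart_frames[OF c_in])
qed (rule linear_spinor_form)

lemma continuous_coef_spinor:
  assumes c_in: "c \<in> A" and v: "\<And>x. lproj L (v x) = x"
    and cont: "\<And>U t. (U, t) \<in> lframes L \<Longrightarrow>
      continuous_on (snd c ` (U \<inter> fst c)) (\<lambda>y. coef L (t (chart_inv c y)) (v (chart_inv c y)))"
  shows "continuous_on (snd c ` fst c) (\<lambda>y. coef L (\<psi> (chart_inv c y)) (v (chart_inv c y)))"
  unfolding ck_on.simps(1)[symmetric]
proof (rule ck_on_chart_frames[OF c_in], unfold ck_on.simps(1))
  fix U t assume t_frame: "(U, t) \<in> lframes L"
  let ?S = "snd c ` (U \<inter> fst c)" and ?p = "\<lambda>y. coef L (t (chart_inv c y)) (\<psi> (chart_inv c y))"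
  have frame_y: "\<not> lzero L (t (chart_inv c y))" "lproj L (t (chart_inv c y)) = chart_inv c y"
    if "y \<in> ?S" for y
    using that c_in frame_not_lzero[OF t_frame] frame(2)[OF t_frame] by auto
  have "continuous_on ?S ?p"
    using smooth_on_section_coef[OF section_spinor t_frame c_in] by (rule smooth_on_continuous)
  moreover have "?p y \<noteq> 0" if "y \<in> ?S" for y
    using coef_nonzero[OF frame_y(1)[OF that] spinor_not_lzero] frame_y(2)[OF that] by simp
  ultimately have "continuous_on ?S (\<lambda>y. qinv (?p y) \<odot> coef L (t (chart_inv c y)) (v (chart_inv c y)))"
    unfolding qinv_def using cont[OF t_frame]
    by (intro qmult.continuous_on continuous_intros
        bounded_linear.continuous_on[OF bounded_linear_qcnj]) auto
  then show "continuous_on ?S (\<lambda>y. coef L (\<psi> (chart_inv c y)) (v (chart_inv c y)))"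
    by (rule continuous_on_eq) (use coef_change_basis[OF spinor_not_lzero frame_y(1)] frame_y(2) v in simp)
qed

end

section \<open>The integrands in the frame given by the spinor\<close>

lemma norm_diff_projections:
  fixes m s t :: "'a::real_inner"
  assumes "s \<bullet> t = 0"
  shows "(norm (m - (m \<bullet> s / (norm s)\<^sup>2) *\<^sub>R s - (m \<bullet> t / (norm t)\<^sup>2) *\<^sub>R t))\<^sup>2 =
    (norm m)\<^sup>2 - (m \<bullet> s)\<^sup>2 / (norm s)\<^sup>2 - (m \<bullet> t)\<^sup>2 / (norm t)\<^sup>2"
proof -
  define a b where coefficients: "a = m \<bullet> s / (norm s)\<^sup>2" "b = m \<bullet> t / (norm t)\<^sup>2"
  \<comment> \<open>This includes \<open>s = 0\<close> and \<open>t = 0\<close>, where division by zero gives \<open>0\<close>.\<close>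
  have projections: "a * (s \<bullet> s) = m \<bullet> s" "b * (t \<bullet> t) = m \<bullet> t"
    by (auto simp: coefficients simp flip: power2_norm_eq_inner)
  have "(norm (m - a *\<^sub>R s - b *\<^sub>R t))\<^sup>2 =
      (norm m)\<^sup>2 - 2 * a * (m \<bullet> s) - 2 * b * (m \<bullet> t) + a * (a * (s \<bullet> s)) + b * (b * (t \<bullet> t))"
    unfolding power2_norm_eq_inner
    using assms inner_commute[of s m] inner_commute[of t m] inner_commute[of t s]
    by (simp add: inner_diff_left inner_diff_right algebra_simps)
  also have "\<dots> = (norm m)\<^sup>2 - a * (m \<bullet> s) - b * (m \<bullet> t)" unfolding projections by simp
  finally show ?thesis by (simp add: coefficients power2_eq_square)
qed

locale dirac_spinor = spinor A g L \<psi>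
  for A :: "'m::t2_space chart set" and g :: "'m bilin" and L :: "('m, 'l) spin_data" and \<psi> :: "'m \<Rightarrow> 'l" +
  fixes J :: "'l \<Rightarrow> 'l" and D :: "('m \<Rightarrow> 'l) \<Rightarrow> 'm \<Rightarrow> real^2 \<Rightarrow> 'l"
  assumes cplx: "spin_complex_structure A g L J"
    and dirac: "dirac_structure A g L J D"
begin

lemma lproj_J [simp]: "lproj L (J v) = lproj L v"
  and J_lscale: "J (lscale L v q) = lscale L (J v) q"
  and J_J: "J (J v) = lneg L v"
  and J_section: "\<phi> \<in> section_of A L \<Longrightarrow> J \<circ> \<phi> \<in> section_of A L"
  and spair_rot: "lproj L v = lproj L w \<Longrightarrow> spair L v w (rot g (lproj L v) X) = spair L (J v) w X"
    "lproj L v = lproj L w \<Longrightarrow> spair L v w (rot g (lproj L v) X) = spair L v (J w) X"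
  using cplx unfolding spin_complex_structure_def by (elim conjE, blast)+

lemma Kbar_dirac: "D \<psi> \<in> Kbar_form A g L J"
  using dirac section_spinor unfolding dirac_structure_def by (elim conjE) blast

lemma lproj_dirac [simp]: "lproj L (D \<psi> x X) = x"
  and dirac_add: "D \<psi> x (X + Y) = ladd L (D \<psi> x X) (D \<psi> x Y)"
  and dirac_scale: "D \<psi> x (r *\<^sub>R X) = lscale L (D \<psi> x X) (qreal r)"
  and dirac_rot: "D \<psi> x (rot g x X) = lneg L (J (D \<psi> x X))"
  and smooth_form_frame_coef_dirac: "(U, t) \<in> lframes L \<Longrightarrow> smooth_form A U (\<lambda>x X. coef L (t x) (D \<psi> x X))"
  using Kbar_dirac unfolding Kbar_form_def bundle_form_def star_def by blast+

lemma ext_deriv_spair: "ext_deriv A (\<lambda>y. spair L (\<psi> y) (\<psi> y)) x X Y =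
    (spair L (D \<psi> x X) (\<psi> x) Y - spair L (D \<psi> x Y) (\<psi> x) X) +
    (spair L (\<psi> x) (D \<psi> x X) Y - spair L (\<psi> x) (D \<psi> x Y) X)"
  using dirac section_spinor unfolding dirac_structure_def by (elim conjE) simp

definition dirac_coef :: "'m \<Rightarrow> real^2 \<Rightarrow> quat" where
  "dirac_coef x X = coef L (\<psi> x) (D \<psi> x X)"

definition J_coef :: "'m \<Rightarrow> quat" where
  "J_coef x = coef L (\<psi> x) (J (\<psi> x))"

definition J_form :: "'m \<Rightarrow> real^2 \<Rightarrow> quat" where
  "J_form x X = J_coef x \<odot> spinor_form x X"

lemma dirac_eq_lscale: "D \<psi> x X = lscale L (\<psi> x) (dirac_coef x X)"
  unfolding dirac_coef_def by (rule lscale_coef_spinor[symmetric]) simp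

lemma J_eq_lscale: "J (\<psi> x) = lscale L (\<psi> x) (J_coef x)"
  unfolding J_coef_def by (rule lscale_coef_spinor[symmetric]) simp

lemma J_coef_square: "J_coef x \<odot> J_coef x = - qreal 1"
proof -
  have "lscale L (\<psi> x) (J_coef x \<odot> J_coef x) = lscale L (\<psi> x) (qreal (-1))"
    using J_J[of "\<psi> x"] by (simp add: J_eq_lscale J_lscale lneg_def)
  then show ?thesis by (simp add: lscale_spinor_inject qreal_def)
qed

lemmas qcnj_J_coef = qcnj_square_eq_minus_one[OF J_coef_square]
  and norm_J_coef = norm_square_eq_minus_one[OF J_coef_square]

lemma inner_J_coef: "(J_coef x \<odot> p) \<bullet> q = - (p \<bullet> (J_coef x \<odot> q))"
  using inner_qmult_left[of "J_coef x" p "J_coef x \<odot> q"]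
  by (simp add: norm_J_coef J_coef_square qmult.minus_left flip: qmult_assoc)

definition Kbar_coef :: "'m \<Rightarrow> (real^2 \<Rightarrow> quat) \<Rightarrow> bool" where
  "Kbar_coef x N \<longleftrightarrow> linear N \<and> (\<forall>X. N (rot g x X) = - (J_coef x \<odot> N X))"

lemma Kbar_coef_rot: "Kbar_coef x N \<Longrightarrow> N (rot g x X) = - (J_coef x \<odot> N X)"
  unfolding Kbar_coef_def by blast

lemma Kbar_coef_dirac: "Kbar_coef x (dirac_coef x)"
  unfolding Kbar_coef_def
proof (intro conjI allI)
  show "linear (dirac_coef x)"
  proof
    show "dirac_coef x (X + Y) = dirac_coef x X + dirac_coef x Y" for X Y
      using dirac_add[of x X Y] by (simp add: dirac_eq_lscale lscale_spinor_inject flip: lscale_add)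
    show "dirac_coef x (r *\<^sub>R X) = r *\<^sub>R dirac_coef x X" for r X
      using dirac_scale[of x r X] by (simp add: dirac_eq_lscale lscale_spinor_inject)
  qed
  show "dirac_coef x (rot g x X) = - (J_coef x \<odot> dirac_coef x X)" for X
    using dirac_rot[of x X]
    by (simp add: dirac_eq_lscale J_lscale J_eq_lscale lneg_lscale lscale_spinor_inject)
qed

lemma dirac_coef_zero [simp]: "dirac_coef x 0 = 0"
  using Kbar_coef_dirac[of x] by (simp add: Kbar_coef_def linear_0)

lemma spinor_form_rot:
  "spinor_form x (rot g x X) = - J_form x X" "spinor_form x (rot g x X) = spinor_form x X \<odot> J_coef x"
proof -
  have "spinor_form x (rot g x X) = spair L (J (\<psi> x)) (lscale L (\<psi> x) (qreal 1)) X"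
    using spair_rot(1)[of "\<psi> x" "\<psi> x" X] by (simp add: spinor_form_def)
  then show "spinor_form x (rot g x X) = - J_form x X"
    unfolding J_eq_lscale spair_spinor by (simp add: J_form_def qcnj_J_coef qmult.minus_left)
  have "spinor_form x (rot g x X) = spair L (lscale L (\<psi> x) (qreal 1)) (J (\<psi> x)) X"
    using spair_rot(2)[of "\<psi> x" "\<psi> x" X] by (simp add: spinor_form_def)
  then show "spinor_form x (rot g x X) = spinor_form x X \<odot> J_coef x"
    unfolding J_eq_lscale spair_spinor by simp
qed

lemma Kbar_coef_spinor_form: "Kbar_coef x (spinor_form x)"
  unfolding Kbar_coef_def using linear_spinor_form spinor_form_rot(1) by (simp add: J_form_def)

lemma Kbar_coef_J_form: "Kbar_coef x (J_form x)"
  using Kbar_coef_spinor_form[of x] unfolding Kbar_coef_def J_form_def[abs_def] linear_iff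
  by (simp add: qmult.add_right qmult.scaleR_right qmult.minus_right)

lemma norm_J_form: "norm (J_form x X) = norm (spinor_form x X)"
  by (simp add: J_form_def norm_qmult norm_J_coef)

lemma spinor_form_orthogonal_J_form: "spinor_form x X \<bullet> J_form x X = 0"
  using inner_J_coef[of x "spinor_form x X" "spinor_form x X"] by (simp add: J_form_def inner_commute)

lemma qcnj_J_form: "qcnj (J_form x X) = - J_form x X"
  using spinor_form_rot[of x X]
  by (simp add: J_form_def qcnj_qmult qcnj_spinor_form qcnj_J_coef qmult.minus_left qmult.minus_right)

lemma inner_rot_combination:
  assumes M: "Kbar_coef x M" and N: "Kbar_coef x N"
  shows "M (a *\<^sub>R X + b *\<^sub>R rot g x X) \<bullet> N (a *\<^sub>R X + b *\<^sub>R rot g x X) = (a\<^sup>2 + b\<^sup>2) * (M X \<bullet> N X)"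
proof -
  have "linear M" "linear N" using M N by (auto simp: Kbar_coef_def)
  then show ?thesis
    using inner_qmult_left[of "J_coef x" "M X" "N X"]
    by (simp add: linear_add linear_scale Kbar_coef_rot[OF M] Kbar_coef_rot[OF N] norm_J_coef inner_J_coef
        inner_diff_left inner_diff_right power2_eq_square algebra_simps)
qed

lemma wedge_density_dirac:
  assumes N: "Kbar_coef x N" and \<nu>: "\<And>X. \<nu> x X = lscale L (\<psi> x) (N X)"
  shows "wedge_density g L (star g (D \<psi>)) \<nu> x X = (dirac_coef x X \<bullet> N X) * norm (spinor_form x X)"
proof -
  have "dirac_coef x (rot g x (rot g x X)) = - dirac_coef x X"
    unfolding rot_rot using Kbar_coef_dirac[of x] by (simp add: Kbar_coef_def linear_neg)
  moreover have "(J_coef x \<odot> dirac_coef x X) \<bullet> (J_coef x \<odot> N X) = dirac_coef x X \<bullet> N X"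
    unfolding inner_qmult_left norm_J_coef by simp
  ultimately show ?thesis
    unfolding wedge_density_def wedge_def star_def dirac_eq_lscale \<nu> linner_spinor Kbar_coef_rot[OF N]
    by (simp add: Kbar_coef_rot[OF Kbar_coef_dirac, of x X])
qed

lemma integrand1_eq: "integrand1 g L D \<psi> x X = (norm (dirac_coef x X))\<^sup>2"
  unfolding integrand1_def wedge_density_dirac[OF Kbar_coef_dirac dirac_eq_lscale] lnorm2_def
    power2_norm_eq_inner
  by (cases "X = 0") (auto simp flip: spinor_form_def)

lemma integrand2_eq:
  "integrand2 g L D \<psi> x X = (dirac_coef x X \<bullet> spinor_form x X)\<^sup>2 / (norm (spinor_form x X))\<^sup>2"
proof -
  have "wedge_density g L (star g (D \<psi>)) (\<lambda>y Y. lscale L (\<psi> y) (spair L (\<psi> y) (\<psi> y) Y)) x X =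
      (dirac_coef x X \<bullet> spinor_form x X) * norm (spinor_form x X)"
    by (rule wedge_density_dirac[OF Kbar_coef_spinor_form]) (simp add: spinor_form_def)
  then show ?thesis
    unfolding integrand2_def lnorm2_def spinor_form_def[symmetric]
    by (cases "X = 0") (auto simp: power2_eq_square power4_eq_xxxx)
qed

lemma integrand3_eq:
  "integrand3 g L J D \<psi> x X = (dirac_coef x X \<bullet> J_form x X)\<^sup>2 / (norm (J_form x X))\<^sup>2"
proof -
  have "wedge_density g L (star g (D \<psi>)) (\<lambda>y Y. lscale L (J (\<psi> y)) (spair L (\<psi> y) (\<psi> y) Y)) x X =
      (dirac_coef x X \<bullet> J_form x X) * norm (spinor_form x X)"
    by (rule wedge_density_dirac[OF Kbar_coef_J_form]) (simp add: J_eq_lscale J_form_def spinor_form_def)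
  then show ?thesis
    unfolding integrand3_def lnorm2_def spinor_form_def[symmetric] norm_J_form
    by (cases "X = 0") (auto simp: power2_eq_square power4_eq_xxxx)
qed

definition energy_density :: "real \<Rightarrow> real \<Rightarrow> real \<Rightarrow> 'm \<Rightarrow> real^2 \<Rightarrow> real" where
  "energy_density \<epsilon>\<^sub>1 \<epsilon>\<^sub>2 \<epsilon>\<^sub>3 x X = \<epsilon>\<^sub>1 * integrand1 g L D \<psi> x X +
    (\<epsilon>\<^sub>2 - \<epsilon>\<^sub>1) * integrand2 g L D \<psi> x X + (\<epsilon>\<^sub>3 - \<epsilon>\<^sub>1) * integrand3 g L J D \<psi> x X"

definition dirac_residual :: "'m \<Rightarrow> real^2 \<Rightarrow> quat" where
  "dirac_residual x X = dirac_coef x X -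
     (dirac_coef x X \<bullet> spinor_form x X / (norm (spinor_form x X))\<^sup>2) *\<^sub>R spinor_form x X -
     (dirac_coef x X \<bullet> J_form x X / (norm (J_form x X))\<^sup>2) *\<^sub>R J_form x X"

lemma energy_density_eq:
  "energy_density \<epsilon>\<^sub>1 \<epsilon>\<^sub>2 \<epsilon>\<^sub>3 x X = \<epsilon>\<^sub>1 * (norm (dirac_residual x X))\<^sup>2 +
    \<epsilon>\<^sub>2 * integrand2 g L D \<psi> x X + \<epsilon>\<^sub>3 * integrand3 g L J D \<psi> x X"
  unfolding dirac_residual_def norm_diff_projections[OF spinor_form_orthogonal_J_form]
  by (simp add: energy_density_def integrand1_eq integrand2_eq integrand3_eq algebra_simps
      diff_divide_distrib)

lemma energy_density_nonneg:
  "0 \<le> \<epsilon>\<^sub>1 \<Longrightarrow> 0 \<le> \<epsilon>\<^sub>2 \<Longrightarrow> 0 \<le> \<epsilon>\<^sub>3 \<Longrightarrow> 0 \<le> energy_density \<epsilon>\<^sub>1 \<epsilon>\<^sub>2 \<epsilon>\<^sub>3 x X"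
  unfolding energy_density_eq integrand2_eq integrand3_eq by simp

definition dirac_equation :: "'m \<Rightarrow> real^2 \<Rightarrow> bool" where
  "dirac_equation x X \<longleftrightarrow> (\<exists>k. dirac_coef x X = k *\<^sub>R J_form x X)"

lemma energy_density_eq_0_iff:
  assumes "0 < \<epsilon>\<^sub>1" "0 < \<epsilon>\<^sub>2"
  shows "energy_density \<epsilon>\<^sub>1 \<epsilon>\<^sub>2 0 x X = 0 \<longleftrightarrow> dirac_equation x X"
proof -
  have "energy_density \<epsilon>\<^sub>1 \<epsilon>\<^sub>2 0 x X = 0 \<longleftrightarrow> dirac_residual x X = 0 \<and> dirac_coef x X \<bullet> spinor_form x X = 0"
    unfolding energy_density_eq integrand2_eq using assms by (auto simp: add_nonneg_eq_0_iff)
  also have "\<dots> \<longleftrightarrow> dirac_equation x X"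
  proof
    assume "dirac_residual x X = 0 \<and> dirac_coef x X \<bullet> spinor_form x X = 0"
    then show "dirac_equation x X" unfolding dirac_equation_def dirac_residual_def by auto
  next
    assume "dirac_equation x X"
    then show "dirac_residual x X = 0 \<and> dirac_coef x X \<bullet> spinor_form x X = 0"
      using spinor_form_orthogonal_J_form[of x X]
      by (auto simp: dirac_equation_def dirac_residual_def inner_commute power2_norm_eq_inner)
  qed
  finally show ?thesis .
qed

lemma ext_deriv_spinor_form:
  "ext_deriv A spinor_form x X Y =
     (qcnj (dirac_coef x X) \<odot> spinor_form x Y - qcnj (dirac_coef x Y) \<odot> spinor_form x X) +
     (spinor_form x Y \<odot> dirac_coef x X - spinor_form x X \<odot> dirac_coef x Y)"
proof -
  have "spair L (D \<psi> x X) (\<psi> x) Y = qcnj (dirac_coef x X) \<odot> spinor_form x Y"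
    "spair L (\<psi> x) (D \<psi> x X) Y = spinor_form x Y \<odot> dirac_coef x X" for X Y
    using spair_spinor[of x "dirac_coef x X" "qreal 1" Y] spair_spinor[of x "qreal 1" "dirac_coef x X" Y]
    by (simp_all flip: dirac_eq_lscale)
  then show ?thesis using ext_deriv_spair[of x X Y] unfolding spinor_form_def[abs_def] by simp
qed

lemma ext_deriv_spinor_form_rot:
  "ext_deriv A spinor_form x X (rot g x X) =
    (-2) *\<^sub>R (qcnj (dirac_coef x X) \<odot> J_form x X + J_form x X \<odot> dirac_coef x X)"
proof -
  have "qcnj (dirac_coef x (rot g x X)) \<odot> spinor_form x X = qcnj (dirac_coef x X) \<odot> J_form x X"
    by (simp add: Kbar_coef_rot[OF Kbar_coef_dirac] qcnj_qmult qcnj_J_coef qmult.minus_left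
        qmult.minus_right qmult_assoc J_form_def)
  moreover have "spinor_form x X \<odot> J_coef x = - J_form x X"
    using spinor_form_rot[of x X] by simp
  then have "spinor_form x X \<odot> dirac_coef x (rot g x X) = J_form x X \<odot> dirac_coef x X"
    by (simp add: Kbar_coef_rot[OF Kbar_coef_dirac] qmult.minus_right qmult.minus_left flip: qmult_assoc)
  ultimately show ?thesis
    unfolding ext_deriv_spinor_form spinor_form_rot(1)
    by (simp add: qmult.minus_left qmult.minus_right scaleR_2 scaleR_add_right)
qed

lemma ext_deriv_spinor_form_rot_eq_0_iff:
  "ext_deriv A spinor_form x X (rot g x X) = 0 \<longleftrightarrow> dirac_equation x X"
proof -
  have "dirac_equation x X" if "J_form x X = 0"
  proof -
    have "X = 0" using that norm_J_form[of x X] by simp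
    then show ?thesis using that by (simp add: dirac_equation_def)
  qed
  then show ?thesis
    unfolding ext_deriv_spinor_form_rot dirac_equation_def
    using qcnj_qmult_add_qmult_eq_0_iff[OF qcnj_J_form, of "dirac_coef x X" x X] by auto
qed

lemma closed_form_iff_dirac_equation: "closed_form A spinor_form \<longleftrightarrow> (\<forall>x X. dirac_equation x X)"
proof
  assume "closed_form A spinor_form"
  then show "\<forall>x X. dirac_equation x X"
    unfolding closed_form_def using ext_deriv_spinor_form_rot_eq_0_iff by blast
next
  assume dirac_equation: "\<forall>x X. dirac_equation x X"
  have "ext_deriv A spinor_form x X Y = 0" for x X Y
  proof (cases "X = 0")
    case True
    then show ?thesis by (simp add: ext_deriv_spinor_form)
  next
    case False
    obtain a b where Y: "Y = a *\<^sub>R X + b *\<^sub>R rot g x X" using rot_basis[OF False] .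
    have "linear (spinor_form x)" "linear (dirac_coef x)"
      using Kbar_coef_spinor_form Kbar_coef_dirac unfolding Kbar_coef_def by blast+
    then have "ext_deriv A spinor_form x X Y = b *\<^sub>R ext_deriv A spinor_form x X (rot g x X)"
      unfolding Y ext_deriv_spinor_form
      by (simp add: linear_add linear_scale qcnj_add qmult.add_left qmult.add_right qmult.scaleR_left
          qmult.scaleR_right algebra_simps)
    then show ?thesis using ext_deriv_spinor_form_rot_eq_0_iff dirac_equation by simp
  qed
  then show "closed_form A spinor_form" unfolding closed_form_def by blast
qed

end

section \<open>The energy\<close>

context dirac_spinor
begin

definition continuous_Kbar_coef :: "('m \<Rightarrow> real^2 \<Rightarrow> quat) \<Rightarrow> bool" where
  "continuous_Kbar_coef N \<longleftrightarrow> (\<forall>x. Kbar_coef x (N x)) \<and>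
     (\<forall>c\<in>A. \<forall>w. continuous_on (snd c ` fst c) (local_form A c N w))"

lemma continuous_Kbar_coef_dirac: "continuous_Kbar_coef dirac_coef"
  unfolding continuous_Kbar_coef_def
proof (intro conjI allI ballI)
  fix c w assume c_in: "c \<in> A"
  have "continuous_on (snd c ` (U \<inter> fst c))
      (\<lambda>y. coef L (t (chart_inv c y)) (D \<psi> (chart_inv c y) (tvec A c (chart_inv c y) w)))"
    if "(U, t) \<in> lframes L" for U t
    using smooth_form_frame_coef_dirac[OF that] c_in smooth_on_continuous
    unfolding smooth_form_def local_form_def[abs_def] by blast
  then show "continuous_on (snd c ` fst c) (local_form A c dirac_coef w)"
    using continuous_coef_spinor[OF c_in, of "\<lambda>x. D \<psi> x (tvec A c x w)"]
    by (simp add: dirac_coef_def local_form_def[abs_def])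
qed (rule Kbar_coef_dirac)

lemma continuous_Kbar_coef_spinor_form: "continuous_Kbar_coef spinor_form"
  unfolding continuous_Kbar_coef_def
  using Kbar_coef_spinor_form smooth_on_continuous[OF smooth_form_local[OF smooth_spinor_form]] by blast

lemma continuous_Kbar_coef_J_form: "continuous_Kbar_coef J_form"
  unfolding continuous_Kbar_coef_def
proof (intro conjI allI ballI)
  fix c w assume c_in: "c \<in> A"
  have "continuous_on (snd c ` fst c) (\<lambda>y. coef L (\<psi> (chart_inv c y)) ((J \<circ> \<psi>) (chart_inv c y)))"
    using smooth_on_continuous[OF smooth_on_section_coef[OF J_section[OF section_spinor] _ c_in]]
    by (intro continuous_coef_spinor[OF c_in]) auto
  then have "continuous_on (snd c ` fst c) (\<lambda>y. J_coef (chart_inv c y) \<odot> local_form A c spinor_form w y)"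
    using continuous_Kbar_coef_spinor_form c_in
    by (intro qmult.continuous_on) (simp_all add: J_coef_def continuous_Kbar_coef_def)
  then show "continuous_on (snd c ` fst c) (local_form A c J_form w)"
    by (simp add: local_form_def[abs_def] J_form_def)
qed (rule Kbar_coef_J_form)

lemma continuous_density_norm_square:
  assumes "continuous_Kbar_coef M"
  shows "continuous_density (\<lambda>x X. (norm (M x X))\<^sup>2)"
  unfolding continuous_density_def
proof (intro conjI allI ballI impI)
  have M: "Kbar_coef x (M x)" for x using assms by (simp add: continuous_Kbar_coef_def)
  show "(\<lambda>X. (norm (M x X))\<^sup>2) \<in> K_power g 2 x" for x
    by (rule K_powerI) (simp add: power2_norm_eq_inner inner_rot_combination[OF M M])
  fix c and w :: "real^2" assume "c \<in> A"
  then have "continuous_on (snd c ` fst c) (\<lambda>y. (norm (local_form A c M w y))\<^sup>2)"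
    using assms unfolding continuous_Kbar_coef_def by (intro continuous_intros) blast
  then show "continuous_on (snd c ` fst c) (local_form A c (\<lambda>x X. (norm (M x X))\<^sup>2) w)"
    by (simp add: local_form_def[abs_def])
qed

lemma continuous_density_projection:
  assumes M: "continuous_Kbar_coef M" and N: "continuous_Kbar_coef N" "\<And>x X. X \<noteq> 0 \<Longrightarrow> N x X \<noteq> 0"
  shows "continuous_density (\<lambda>x X. (M x X \<bullet> N x X)\<^sup>2 / (norm (N x X))\<^sup>2)"
  unfolding continuous_density_def
proof (intro conjI allI ballI impI)
  have Kbar: "Kbar_coef x (M x)" "Kbar_coef x (N x)" for x
    using assms by (simp_all add: continuous_Kbar_coef_def)
  show "(\<lambda>X. (M x X \<bullet> N x X)\<^sup>2 / (norm (N x X))\<^sup>2) \<in> K_power g 2 x" for x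
    by (rule K_powerI)
      (simp add: power2_norm_eq_inner inner_rot_combination[OF Kbar]
        inner_rot_combination[OF Kbar(2) Kbar(2)] power_mult_distrib power2_eq_square[of "a\<^sup>2 + b\<^sup>2" for a b])
  fix c and w :: "real^2" assume c_in: "c \<in> A" "w \<noteq> 0"
  have "local_form A c N w y \<noteq> 0" if "y \<in> snd c ` fst c" for y
    unfolding local_form_def
    using N(2) tvec_nonzero[OF c_in(1) chart_inv_in[OF c_in(1) that] c_in(2)] by blast
  then have "continuous_on (snd c ` fst c)
      (\<lambda>y. (local_form A c M w y \<bullet> local_form A c N w y)\<^sup>2 / (norm (local_form A c N w y))\<^sup>2)"
    using M N(1) c_in(1) unfolding continuous_Kbar_coef_def by (intro continuous_intros) auto
  then show "continuous_on (snd c ` fst c) (local_form A c (\<lambda>x X. (M x X \<bullet> N x X)\<^sup>2 / (norm (N x X))\<^sup>2) w)"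
    by (simp add: local_form_def[abs_def])
qed

lemma continuous_integrands:
  "continuous_density (integrand1 g L D \<psi>)" "continuous_density (integrand2 g L D \<psi>)"
  "continuous_density (integrand3 g L J D \<psi>)"
proof -
  have "J_form x X \<noteq> 0" if "X \<noteq> 0" for x X
    using norm_J_form[of x X] that by (metis norm_eq_zero spinor_form_eq_0_iff)
  then show "continuous_density (integrand1 g L D \<psi>)" "continuous_density (integrand2 g L D \<psi>)"
    "continuous_density (integrand3 g L J D \<psi>)"
    unfolding integrand1_eq[abs_def] integrand2_eq[abs_def] integrand3_eq[abs_def]
    by (intro continuous_density_norm_square continuous_density_projection continuous_Kbar_coef_dirac
        continuous_Kbar_coef_spinor_form continuous_Kbar_coef_J_form; simp)+
qed

lemma continuous_energy_density: "continuous_density (energy_density \<epsilon>\<^sub>1 \<epsilon>\<^sub>2 \<epsilon>\<^sub>3)"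
  unfolding energy_density_def[abs_def]
  by (intro continuous_density_add continuous_density_cmult continuous_integrands)

end

locale compact_dirac_spinor = dirac_spinor A g L \<psi> J D + compact_riemannian_surface A g
  for A :: "'m::t2_space chart set" and g :: "'m bilin" and L :: "('m, 'l) spin_data" and \<psi> :: "'m \<Rightarrow> 'l"
    and J :: "'l \<Rightarrow> 'l" and D :: "('m \<Rightarrow> 'l) \<Rightarrow> 'm \<Rightarrow> real^2 \<Rightarrow> 'l"
begin

lemmas integrable_integrands = continuous_integrands[THEN integrable_continuous_density]

lemma energy_eq_integral:
  "energy A g L J D \<epsilon>\<^sub>1 \<epsilon>\<^sub>2 \<epsilon>\<^sub>3 \<psi> = surface_integral A (form_of_density g (energy_density \<epsilon>\<^sub>1 \<epsilon>\<^sub>2 \<epsilon>\<^sub>3))"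
  unfolding energy_def energy_density_def[abs_def]
  by (simp add: surface_integral_density_add surface_integral_density_cmult continuous_density_add
      continuous_density_cmult continuous_integrands)

lemma energy_nonneg:
  "0 \<le> \<epsilon>\<^sub>1 \<Longrightarrow> 0 \<le> \<epsilon>\<^sub>2 \<Longrightarrow> 0 \<le> \<epsilon>\<^sub>3 \<Longrightarrow> 0 \<le> energy A g L J D \<epsilon>\<^sub>1 \<epsilon>\<^sub>2 \<epsilon>\<^sub>3 \<psi>"
  unfolding energy_eq_integral
  by (intro surface_integral_density_nonneg continuous_energy_density energy_density_nonneg)

lemma energy_eq_0_iff_closed:
  assumes "0 < \<epsilon>\<^sub>1" "0 < \<epsilon>\<^sub>2"
  shows "energy A g L J D \<epsilon>\<^sub>1 \<epsilon>\<^sub>2 0 \<psi> = 0 \<longleftrightarrow> closed_form A spinor_form"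
proof -
  have "energy A g L J D \<epsilon>\<^sub>1 \<epsilon>\<^sub>2 0 \<psi> = 0 \<longleftrightarrow> (\<forall>x X. energy_density \<epsilon>\<^sub>1 \<epsilon>\<^sub>2 0 x X = 0)"
    unfolding energy_eq_integral using assms
    by (intro surface_integral_density_eq_0_iff continuous_energy_density energy_density_nonneg) auto
  then show ?thesis
    by (simp add: energy_density_eq_0_iff[OF assms] closed_form_iff_dirac_equation)
qed

end

section \<open>Isometric immersions\<close>

context riemannian_surface
begin

lemma metric_polarization:
  assumes "linear h" "\<And>X. (norm (h X))\<^sup>2 = g x X X"
  shows "h X \<bullet> h Y = g x X Y"
proof -
  have "(norm (h (X + Y)))\<^sup>2 = g x (X + Y) (X + Y)" by (rule assms)
  then show ?thesis
    using assms(2)[of X] assms(2)[of Y] metric_sym[of x X Y]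
    by (simp add: linear_add[OF assms(1)] metric_linear power2_norm_eq_inner inner_add_left
        inner_add_right inner_commute)
qed

lemma positive_conformal_unimodular_eq_id:
  assumes B: "linear B" "\<And>X Y. g x (B X) Y = g x X (B Y)" "\<And>X. X \<noteq> 0 \<Longrightarrow> 0 < g x (B X) X"
      "det (matrix B) = 1"
    and conformal: "0 < c" "\<And>X Y. g x (B X) (B Y) = c * g x X Y"
  shows "B X = X"
proof -
  have B_square: "B (B Z) = c *\<^sub>R Z" for Z
  proof -
    let ?W = "B (B Z) + (- c) *\<^sub>R Z"
    have "g x ?W Y = 0" for Y
      using B(2)[of "B Z" Y] conformal(2)[of Z Y] by (simp only: metric_linear) simp
    then have "?W = 0" using metric_eq_0_iff by blast
    then show ?thesis by simp
  qed
  have "matrix B ** matrix B = matrix (\<lambda>Z. c *\<^sub>R Z)"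
    using matrix_compose[OF B(1) B(1)] B_square by (simp add: o_def)
  then have "det (matrix (\<lambda>Z::real^2. c *\<^sub>R Z)) = 1"
    using det_mul[of "matrix B" "matrix B"] B(4) by simp
  then have "c * c = 1" by (simp add: det_2 matrix_def axis_def)
  then have c_eq_1: "c = 1" using conformal(1) by (simp add: square_eq_1_iff)
  \<comment> \<open>As \<open>B\<^sup>2 = 1\<close>, the vector \<open>B X - X\<close> lies in the eigenspace of the positive map \<open>B\<close> for \<open>-1\<close>.\<close>
  let ?Z = "B X - X"
  have "B ?Z = - ?Z" using B_square[of X] c_eq_1 by (simp add: linear_diff[OF B(1)])
  then have "g x (B ?Z) ?Z = - g x ?Z ?Z" using metric_linear(3)[of x "-1" ?Z ?Z] by simp
  then have "?Z = 0" using B(3)[of ?Z] metric_nonneg[of x ?Z] by force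
  then show ?thesis by simp
qed

lemma spin_iso_of_regular_homotopy_class:
  assumes iso: "isometric_immersion A g f" and homotopic: "in_regular_homotopy_class A g L f"
  shows "spin_iso A (induced_bundle (differential A f)) L"
proof -
  obtain \<omega> B where \<omega>: "conformal_form A g \<omega>"
    and B: "\<And>x. linear (B x)" "\<And>x X Y. g x (B x X) Y = g x X (B x Y)"
      "\<And>x X. X \<noteq> 0 \<Longrightarrow> 0 < g x (B x X) X" "\<And>x. det (matrix (B x)) = 1"
    and df: "\<And>x X. differential A f x X = \<omega> x (B x X)" and spin_iso: "spin_iso A (induced_bundle \<omega>) L"
    using homotopic unfolding in_regular_homotopy_class_def by metis
  have "B x X = X" for x X
  proof -
    obtain \<rho> where \<rho>: "\<rho> > 0" "\<And>X Y. \<omega> x X \<bullet> \<omega> x Y = \<rho> * g x X Y"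
      using \<omega> unfolding conformal_form_def by blast
    have "\<rho> * g x (B x X) (B x Y) = g x X Y" for X Y
      using iso \<rho>(2) unfolding isometric_immersion_def df by metis
    then have "g x (B x X) (B x Y) = 1 / \<rho> * g x X Y" for X Y
      using \<rho>(1) by (simp add: field_simps)
    from positive_conformal_unimodular_eq_id[where B="B x" and x=x, OF B _ this]
    show ?thesis using \<rho>(1) by simp
  qed
  then have "differential A f = \<omega>" using df by (intro ext) simp
  then show ?thesis using spin_iso by simp
qed

lemma regular_homotopy_class_of_spin_iso:
  assumes iso: "isometric_immersion A g f" and spin_iso: "spin_iso A (induced_bundle (differential A f)) L"
  shows "in_regular_homotopy_class A g L f"
proof -
  have f: "immersion A f" "\<And>x X Y. differential A f x X \<bullet> differential A f x Y = g x X Y"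
    using iso unfolding isometric_immersion_def by auto
  have "smooth_form A UNIV (differential A f)"
    using f(1) unfolding immersion_def by (intro smooth_form_differential) simp
  then have "conformal_form A g (differential A f)"
    unfolding conformal_form_def using f(2) by (auto intro!: exI[of _ 1])
  moreover have "det (matrix (\<lambda>X::real^2. X)) = 1"
    by (simp add: det_2 matrix_def axis_def)
  ultimately show ?thesis
    unfolding in_regular_homotopy_class_def
    using f(1) spin_iso metric_pos
    by (intro conjI exI[of _ "differential A f"] exI[of _ "\<lambda>x X. X"]) (auto simp: linear_iff)
qed

end

context spinor
begin

lemma spin_iso_induced_bundle:
  assumes "\<And>x X. qimag (\<omega> x X) = spinor_form x X"
  shows "spin_iso A (induced_bundle \<omega>) L"
proof -
  define \<Phi> where "\<Phi> v = lscale L (\<psi> (fst v)) (snd v)" for v :: "'m \<times> quat"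
  have lproj: "lproj L (\<Phi> v) = fst v" for v by (simp add: \<Phi>_def)
  have "inj \<Phi>"
  proof (rule injI)
    fix v w assume eq: "\<Phi> v = \<Phi> w"
    then have "fst v = fst w" using lproj by metis
    then show "v = w" using eq by (simp add: \<Phi>_def lscale_spinor_inject prod_eq_iff)
  qed
  moreover have "\<Phi> (lproj L u, coef L (\<psi> (lproj L u)) u) = u" for u
    by (simp add: \<Phi>_def lscale_coef_spinor)
  then have "surj \<Phi>" by (rule surjI)
  ultimately have "bij \<Phi>" by (rule bijI)
  moreover have "spair L (\<Phi> v) (\<Phi> w) X = spair (induced_bundle \<omega>) v w X" if "fst v = fst w" for v w X
    using that by (simp add: \<Phi>_def spair_spinor induced_bundle_def assms)
  moreover have "smooth_map A (UNIV \<inter> V) (\<lambda>x. coef L (t x) (\<Phi> (x, qreal 1)))"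
    if "(V, t) \<in> lframes L" for V t
    using smooth_map_section_coef[OF section_spinor that] by (simp add: \<Phi>_def)
  ultimately show ?thesis
    unfolding spin_iso_def using lproj
    by (intro exI[of _ \<Phi>]) (auto simp: induced_bundle_def \<Phi>_def lscale_add)
qed

lemma closed_form_of_differential:
  assumes "smooth_map A UNIV f" "\<And>x X. qimag (differential A f x X) = spinor_form x X"
  shows "closed_form A spinor_form"
proof -
  note qimag_f = differential_bounded_linear[OF bounded_linear_qimag assms(1)]
  have "spinor_form = differential A (\<lambda>x. qimag (f x))"
    using qimag_f(2) assms(2) by (intro ext) simp
  then show ?thesis using closed_form_differential[OF qimag_f(1)] by simp
qed

lemma isometric_immersion_of_spinor_form:
  assumes f: "smooth_map A UNIV f" "\<And>x X. qimag (differential A f x X) = spinor_form x X"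
    and constraint: "metric_constraint g L \<psi>"
  shows "isometric_immersion A g f"
proof -
  have norm: "(norm (differential A f x X))\<^sup>2 = g x X X" for x X
    using constraint by (simp add: metric_constraint_iff flip: f(2))
  have linear: "linear (differential A f x)" for x
    using smooth_form_differential[OF f(1)] by (simp add: smooth_form_def)
  have "inj (differential A f x)" for x
    unfolding linear_injective_0[OF linear]
    using norm[of x] by (metis metric_eq_0_iff norm_zero zero_power2)
  then show ?thesis
    unfolding isometric_immersion_def immersion_def using f(1) metric_polarization[OF linear norm] by blast
qed

lemma closed_form_iff_isometric_immersion:
  assumes constraint: "metric_constraint g L \<psi>" and periods: "vanishing_periods A spinor_form"
  shows "closed_form A spinor_form \<longleftrightarrow> (\<exists>f. isometric_immersion A g f \<and>
    (\<forall>x X. qimag (differential A f x X) = spinor_form x X) \<and> in_regular_homotopy_class A g L f)"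
proof
  assume "closed_form A spinor_form"
  then obtain F where F: "smooth_map A UNIV F" "differential A F = spinor_form"
    using ex_primitive[OF smooth_spinor_form] periods unfolding vanishing_periods_def by blast
  define f where "f x = snd (F x)" for x
  have f: "smooth_map A UNIV f" "differential A f x X = snd (spinor_form x X)" for x X
    using differential_bounded_linear[OF bounded_linear_snd F(1)] F(2) by (simp_all add: f_def[abs_def])
  have df: "qimag (differential A f x X) = spinor_form x X" for x X
    using qcnj_spinor_form[of x X] by (simp add: f(2) qimag_def qcnj_def prod_eq_iff)
  have iso: "isometric_immersion A g f" by (rule isometric_immersion_of_spinor_form[OF f(1) df constraint])
  show "\<exists>f. isometric_immersion A g f \<and>
    (\<forall>x X. qimag (differential A f x X) = spinor_form x X) \<and> in_regular_homotopy_class A g L f"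
    using iso df regular_homotopy_class_of_spin_iso[OF iso spin_iso_induced_bundle[OF df]] by blast
next
  assume "\<exists>f. isometric_immersion A g f \<and>
    (\<forall>x X. qimag (differential A f x X) = spinor_form x X) \<and> in_regular_homotopy_class A g L f"
  then show "closed_form A spinor_form"
    using closed_form_of_differential unfolding isometric_immersion_def immersion_def by blast
qed

end

context spin_surface
begin

lemma ex_spinor_of_immersion:
  assumes f: "isometric_immersion A g f" "in_regular_homotopy_class A g L f"
  shows "\<exists>\<psi>\<in>nonvanishing_section A L. metric_constraint g L \<psi> \<and>
    (\<forall>x X. qimag (differential A f x X) = spair L (\<psi> x) (\<psi> x) X)"
proof -
  let ?I = "induced_bundle (differential A f)"
  have df: "differential A f x X \<bullet> differential A f x Y = g x X Y" for x X Y
    using f(1) unfolding isometric_immersion_def by blast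
  obtain \<Phi> where lproj: "\<forall>v. lproj L (\<Phi> v) = lproj ?I v"
    and smooth: "\<forall>(U, s)\<in>lframes ?I. \<forall>(V, t)\<in>lframes L. smooth_map A (U \<inter> V) (\<lambda>x. coef L (t x) (\<Phi> (s x)))"
    and spair: "\<forall>v w X. lproj ?I v = lproj ?I w \<longrightarrow> spair L (\<Phi> v) (\<Phi> w) X = spair ?I v w X"
    using spin_iso_of_regular_homotopy_class[OF f] unfolding spin_iso_def by (elim exE conjE)
  define \<psi> where "\<psi> x = \<Phi> (x, qreal 1)" for x
  have spair_\<psi>: "spair L (\<psi> x) (\<psi> x) X = qimag (differential A f x X)" for x X
    using spair[rule_format, of "(x, qreal 1)" "(x, qreal 1)" X] by (simp add: \<psi>_def induced_bundle_def)
  have "lproj L (\<psi> x) = x" for x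
    using lproj[rule_format, of "(x, qreal 1)"] by (simp add: \<psi>_def induced_bundle_def)
  then have "\<psi> \<in> section_of A L"
    using smooth by (simp add: section_of_def \<psi>_def induced_bundle_def)
  moreover have "\<not> lzero L (\<psi> x)" for x
  proof
    assume "lzero L (\<psi> x)"
    then have "qimag (differential A f x X) = 0" for X
      using spair_lscale[of "\<psi> x" "\<psi> x" 0 0 X] by (simp add: lzero_def spair_\<psi>)
    then have "differential A f x (axis 1 1) = 0" by (metis norm_eq_zero norm_qimag)
    then show False using df[of x "axis 1 1" "axis 1 1"] by (simp add: axis_eq_0_iff)
  qed
  moreover have "metric_constraint g L \<psi>"
    unfolding metric_constraint_def lnorm2_def spair_\<psi> by (simp add: df power2_norm_eq_inner)
  ultimately show ?thesis using spair_\<psi> by (auto simp: nonvanishing_section_def)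
qed

end

context compact_dirac_spinor
begin

lemma energy_eq_0_of_isometric_immersion:
  assumes "0 < \<epsilon>\<^sub>1" "0 < \<epsilon>\<^sub>2" "isometric_immersion A g f"
    "\<And>x X. qimag (differential A f x X) = spair L (\<psi> x) (\<psi> x) X"
  shows "energy A g L J D \<epsilon>\<^sub>1 \<epsilon>\<^sub>2 0 \<psi> = 0"
  using assms unfolding energy_eq_0_iff_closed[OF assms(1,2)] isometric_immersion_def immersion_def
  by (intro closed_form_of_differential) (auto simp: spinor_form_def)

lemma energy_eq_0_iff_isometric_immersion:
  assumes "0 < \<epsilon>\<^sub>1" "0 < \<epsilon>\<^sub>2" "metric_constraint g L \<psi>" "vanishing_periods A (\<lambda>x. spair L (\<psi> x) (\<psi> x))"
  shows "energy A g L J D \<epsilon>\<^sub>1 \<epsilon>\<^sub>2 0 \<psi> = 0 \<longleftrightarrow> (\<exists>f. isometric_immersion A g f \<and>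
    (\<forall>x X. qimag (differential A f x X) = spair L (\<psi> x) (\<psi> x) X) \<and> in_regular_homotopy_class A g L f)"
  using closed_form_iff_isometric_immersion[OF assms(3), folded energy_eq_0_iff_closed[OF assms(1,2)]]
    assms(4) by (simp add: spinor_form_def[abs_def])

end

theorem theorem3:
  fixes A :: "'m::t2_space chart set"
    and g :: "'m bilin"
    and L :: "('m, 'l) spin_data"
    and J :: "'l \<Rightarrow> 'l"
    and D :: "('m \<Rightarrow> 'l) \<Rightarrow> 'm \<Rightarrow> real^2 \<Rightarrow> 'l"
    and \<epsilon>\<^sub>1 \<epsilon>\<^sub>2 \<epsilon>\<^sub>3 :: real
  assumes surface: "oriented_surface A" "compact (UNIV :: 'm set)"
    and metric: "riemannian_metric A g"
    and spin: "spin_bundle A g L"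
    and cplx: "spin_complex_structure A g L J"
    and dirac: "dirac_structure A g L J D"
    and nonneg: "0 \<le> \<epsilon>\<^sub>1" "0 \<le> \<epsilon>\<^sub>2" "0 \<le> \<epsilon>\<^sub>3"
  shows "(\<forall>\<psi>\<in>nonvanishing_section A L.
            integrable_density A g (integrand1 g L D \<psi>) \<and>
            integrable_density A g (integrand2 g L D \<psi>) \<and>
            integrable_density A g (integrand3 g L J D \<psi>)) \<and>
         (\<forall>\<psi>\<in>nonvanishing_section A L. metric_constraint g L \<psi> \<longrightarrow>
            0 \<le> energy A g L J D \<epsilon>\<^sub>1 \<epsilon>\<^sub>2 \<epsilon>\<^sub>3 \<psi>) \<and>
         (\<epsilon>\<^sub>3 = 0 \<and> 0 < \<epsilon>\<^sub>1 \<and> 0 < \<epsilon>\<^sub>2 \<longrightarrow>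
           (\<forall>\<psi>\<in>nonvanishing_section A L. metric_constraint g L \<psi> \<and>
              vanishing_periods A (\<lambda>x. spair L (\<psi> x) (\<psi> x)) \<longrightarrow>
              (energy A g L J D \<epsilon>\<^sub>1 \<epsilon>\<^sub>2 \<epsilon>\<^sub>3 \<psi> = 0 \<longleftrightarrow>
                (\<exists>f. isometric_immersion A g f \<and>
                   (\<forall>x X. qimag (differential A f x X) = spair L (\<psi> x) (\<psi> x) X) \<and>
                   in_regular_homotopy_class A g L f))) \<and>
           (\<forall>f. isometric_immersion A g f \<and> in_regular_homotopy_class A g L f \<longrightarrow>
              (\<exists>\<psi>\<in>nonvanishing_section A L. metric_constraint g L \<psi> \<and>
                 (\<forall>x X. qimag (differential A f x X) = spair L (\<psi> x) (\<psi> x) X) \<and>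
                 energy A g L J D \<epsilon>\<^sub>1 \<epsilon>\<^sub>2 \<epsilon>\<^sub>3 \<psi> = 0)))"
proof -
  interpret spin_surface A g L
    using surface metric spin by unfold_locales
  have spinor: "compact_dirac_spinor A g L \<psi> J D" if "\<psi> \<in> nonvanishing_section A L" for \<psi>
    using that surface(2) cplx dirac by unfold_locales
  note integrable = compact_dirac_spinor.integrable_integrands[OF spinor]
    and energy_nonneg = compact_dirac_spinor.energy_nonneg[OF spinor nonneg]
    and energy_eq_0_iff = compact_dirac_spinor.energy_eq_0_iff_isometric_immersion[OF spinor]
    and energy_eq_0 = compact_dirac_spinor.energy_eq_0_of_isometric_immersion[OF spinor]
  have "\<exists>\<psi>\<in>nonvanishing_section A L. metric_constraint g L \<psi> \<and>
      (\<forall>x X. qimag (differential A f x X) = spair L (\<psi> x) (\<psi> x) X) \<and> energy A g L J D \<epsilon>\<^sub>1 \<epsilon>\<^sub>2 0 \<psi> = 0"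
    if pos: "0 < \<epsilon>\<^sub>1" "0 < \<epsilon>\<^sub>2"
      and f: "isometric_immersion A g f" "in_regular_homotopy_class A g L f" for f
    using ex_spinor_of_immersion[OF f] energy_eq_0[OF _ pos f(1)] by blast
  then show ?thesis
    using integrable energy_nonneg energy_eq_0_iff by auto
qed

end
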